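(* Let $\Gamma$ be a group of $C^2$ diffeomorphisms of a compact Riemannian manifold $M$, and $\nu$ be a probability measure on $\Gamma$ such that for some $p>1$, $\int\left(\log\|f\|_{C^2}+\log\|f^{-1}\|_{C^2}\right)^p d\nu(f)<+\infty$. Let $F$ be a finite orbit of $\Gamma$ such that $\nu$ is uniformly expanding on $F$. Then for every $x\in M\setminus F$ and every $\varepsilon>0$ there exists a compact set $K\subset M\setminus F$ such that: (1) $(\nu^{n}\ast\delta_x)(K)\ge1-\varepsilon$ for $n\ge n_x$, for some integer $n_x$; and (2) for $\nu^{\mathbf{N}}$-almost every $\omega$, $$\limsup_{n\to\infty}\frac1n\,\#\left\{k\in\{1,\ldots,n\}:\ f^k_\omega(x)\in K\right\}\ge1-\varepsilon.$$ Furthermore the integer $n_x$ in (1) is locally uniform in $M\setminus F$.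
   Context: For $\omega=(f_n)_{n\ge0}\in\Gamma^{\mathbf{N}}$, $f^0_\omega=\mathrm{id}$ and $f_\omega^n=f_{n-1}\circ\cdots\circ f_0$. In $\nu^n\ast\delta_x$, $\nu^n$ (also written $\nu^{(n)}$) is the $n$-th convolution power of $\nu$, and $\nu^n\ast\delta_x$ is the law of $f_\omega^n(x)$ for $\omega$ of law $\nu^{\mathbf{N}}$. $\nu$ is uniformly expanding on $F$ if there exist $c>0$ and an integer $n_0\ge1$ such that $\int\log\frac{\|D_yf(v)\|}{\|v\|}\,d\nu^{(n_0)}(f)\ge c$ for every $y\in F$ and every $v\in T_yM\setminus\{0\}$. *)

theory Defs
  imports "HOL-Probability.Probability"
begin

section \<open>Differentiable maps between open subsets of Euclidean spaces\<close>

text \<open>\<open>f\<close> is of class \<open>C\<^sup>k\<close> on the open set \<open>S\<close>. Since the domain is finite-dimensional, it is enough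
  to ask that the directional derivatives \<open>x \<mapsto> Df(x)(v)\<close> are of class \<open>C\<^sup>k\<^sup>-\<^sup>1\<close> for each fixed \<open>v\<close>.\<close>

primrec Ck_on :: "nat \<Rightarrow> 'a::euclidean_space set \<Rightarrow> ('a \<Rightarrow> 'b::real_normed_vector) \<Rightarrow> bool" where
  "Ck_on 0 S f \<longleftrightarrow> continuous_on S f"
| "Ck_on (Suc k) S f \<longleftrightarrow> (\<forall>x\<in>S. f differentiable (at x)) \<and>
     (\<forall>v. Ck_on k S (\<lambda>x. frechet_derivative f (at x) v))"

definition smooth_on :: "'a::euclidean_space set \<Rightarrow> ('a \<Rightarrow> 'b::real_normed_vector) \<Rightarrow> bool" where
  "smooth_on S f \<longleftrightarrow> (\<forall>k. Ck_on k S f)"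

section \<open>Smooth manifolds\<close>

text \<open>The underlying space of the manifold is the whole type \<open>'m\<close>; the model space is \<open>'e\<close>, so that the
  dimension of the manifold is \<open>DIM('e)\<close>. A chart is a pair of a domain and a coordinate map.\<close>

type_synonym ('m, 'e) chart = "'m set \<times> ('m \<Rightarrow> 'e)"

abbreviation chart_dom :: "('m, 'e) chart \<Rightarrow> 'm set" where "chart_dom c \<equiv> fst c"
abbreviation chart_map :: "('m, 'e) chart \<Rightarrow> 'm \<Rightarrow> 'e" where "chart_map c \<equiv> snd c"
abbreviation chart_img :: "('m, 'e) chart \<Rightarrow> 'e set" where "chart_img c \<equiv> chart_map c ` chart_dom c"
abbreviation chart_inv :: "('m, 'e) chart \<Rightarrow> 'e \<Rightarrow> 'm" where
  "chart_inv c \<equiv> inv_into (chart_dom c) (chart_map c)"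

definition is_chart :: "('m::topological_space, 'e::euclidean_space) chart \<Rightarrow> bool" where
  "is_chart c \<longleftrightarrow> open (chart_dom c) \<and> open (chart_img c) \<and>
     homeomorphism (chart_dom c) (chart_img c) (chart_map c) (chart_inv c)"

text \<open>The map \<open>f\<close> read in the charts \<open>c\<close> (source) and \<open>d\<close> (target), meaningful on \<open>rep_dom c d f\<close>.
  For \<open>f = id\<close> this is the change of coordinates.\<close>

definition rep_dom :: "('m, 'e) chart \<Rightarrow> ('m, 'e) chart \<Rightarrow> ('m \<Rightarrow> 'm) \<Rightarrow> 'e set" where
  "rep_dom c d f = chart_map c ` (chart_dom c \<inter> f -` chart_dom d)"

definition rep :: "('m, 'e) chart \<Rightarrow> ('m, 'e) chart \<Rightarrow> ('m \<Rightarrow> 'm) \<Rightarrow> 'e \<Rightarrow> 'e" where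
  "rep c d f = chart_map d \<circ> f \<circ> chart_inv c"

definition smooth_atlas :: "('m::topological_space, 'e::euclidean_space) chart set \<Rightarrow> bool" where
  "smooth_atlas A \<longleftrightarrow> (\<forall>c\<in>A. is_chart c) \<and> (\<Union>c\<in>A. chart_dom c) = UNIV \<and>
     (\<forall>c\<in>A. \<forall>d\<in>A. smooth_on (rep_dom c d id) (rep c d id))"

definition Ck_map :: "nat \<Rightarrow> ('m::topological_space, 'e::euclidean_space) chart set \<Rightarrow> ('m \<Rightarrow> 'm) \<Rightarrow> bool" where
  "Ck_map k A f \<longleftrightarrow> continuous_on UNIV f \<and> (\<forall>c\<in>A. \<forall>d\<in>A. Ck_on k (rep_dom c d f) (rep c d f))"

definition Ck_diffeo :: "nat \<Rightarrow> ('m::topological_space, 'e::euclidean_space) chart set \<Rightarrow> ('m \<Rightarrow> 'm) \<Rightarrow> bool" where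
  "Ck_diffeo k A f \<longleftrightarrow> bij f \<and> Ck_map k A f \<and> Ck_map k A (inv f)"

definition charts_at :: "('m, 'e) chart set \<Rightarrow> 'm \<Rightarrow> ('m, 'e) chart set" where
  "charts_at A p = {c\<in>A. p \<in> chart_dom c}"

text \<open>A tangent vector at \<open>p\<close> is the family of its coordinates in all charts around \<open>p\<close>, which are
  related by the differentials of the changes of coordinates; it is set to 0 at all other charts.
  The vector space operations are componentwise.\<close>

type_synonym ('m, 'e) tvec = "('m, 'e) chart \<Rightarrow> 'e"

definition tangent_space :: "('m, 'e::euclidean_space) chart set \<Rightarrow> 'm \<Rightarrow> ('m, 'e) tvec set" where
  "tangent_space A p = {v. (\<forall>c. c \<notin> charts_at A p \<longrightarrow> v c = 0) \<and>
     (\<forall>c\<in>charts_at A p. \<forall>d\<in>charts_at A p.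
        v d = frechet_derivative (rep c d id) (at (chart_map c p)) (v c))}"

abbreviation zero_tvec :: "('m, 'e::euclidean_space) tvec" where "zero_tvec \<equiv> (\<lambda>_. 0)"

text \<open>The tangent vector at \<open>p\<close> with coordinates \<open>a\<close> in the chart \<open>c\<close>.\<close>

definition tvec_of_coord ::
    "('m, 'e::euclidean_space) chart set \<Rightarrow> ('m, 'e) chart \<Rightarrow> 'm \<Rightarrow> 'e \<Rightarrow> ('m, 'e) tvec" where
  "tvec_of_coord A c p a = (\<lambda>d. if d \<in> charts_at A p
     then frechet_derivative (rep c d id) (at (chart_map c p)) a else 0)"

definition some_chart :: "('m, 'e) chart set \<Rightarrow> 'm \<Rightarrow> ('m, 'e) chart" where
  "some_chart A p = (SOME c. c \<in> charts_at A p)"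

definition differential ::
    "('m, 'e::euclidean_space) chart set \<Rightarrow> ('m \<Rightarrow> 'm) \<Rightarrow> 'm \<Rightarrow> ('m, 'e) tvec \<Rightarrow> ('m, 'e) tvec" where
  "differential A f p v = (let c = some_chart A p; d = some_chart A (f p) in
     tvec_of_coord A d (f p) (frechet_derivative (rep c d f) (at (chart_map c p)) (v c)))"

section \<open>Riemannian metrics\<close>

type_synonym ('m, 'e) metric = "'m \<Rightarrow> ('m, 'e) tvec \<Rightarrow> ('m, 'e) tvec \<Rightarrow> real"

definition metric_coeff ::
    "('m, 'e::euclidean_space) chart set \<Rightarrow> ('m, 'e) metric \<Rightarrow> ('m, 'e) chart \<Rightarrow> 'e \<Rightarrow> 'e \<Rightarrow> 'e \<Rightarrow> real" where
  "metric_coeff A g c z a b =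
     (let p = chart_inv c z in g p (tvec_of_coord A c p a) (tvec_of_coord A c p b))"

definition riemannian_metric :: "('m, 'e::euclidean_space) chart set \<Rightarrow> ('m, 'e) metric \<Rightarrow> bool" where
  "riemannian_metric A g \<longleftrightarrow>
     (\<forall>p. \<forall>u\<in>tangent_space A p. \<forall>v\<in>tangent_space A p. \<forall>w\<in>tangent_space A p.
        g p u v = g p v u \<and>
        (\<forall>r. g p (\<lambda>c. r *\<^sub>R u c + v c) w = r * g p u w + g p v w)) \<and>
     (\<forall>p. \<forall>v\<in>tangent_space A p. v \<noteq> zero_tvec \<longrightarrow> g p v v > 0) \<and>
     (\<forall>c\<in>A. \<forall>a b. smooth_on (chart_img c) (\<lambda>z. metric_coeff A g c z a b))"

definition riemannian_manifold ::
    "('m::{t2_space, second_countable_topology}, 'e::euclidean_space) chart set \<Rightarrow> ('m, 'e) metric \<Rightarrow> bool" where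
  "riemannian_manifold A g \<longleftrightarrow> smooth_atlas A \<and> riemannian_metric A g"

definition tnorm :: "('m, 'e) metric \<Rightarrow> 'm \<Rightarrow> ('m, 'e) tvec \<Rightarrow> real" where
  "tnorm g p v = sqrt (g p v v)"

text \<open>The Christoffel symbols \<open>\<Gamma>(a,b)\<close> of the Levi-Civita connection in the chart \<open>c\<close> at the point with
  coordinates \<open>z\<close>, characterized by the Koszul formula (constant vector fields commute).\<close>

definition christoffel ::
    "('m, 'e::euclidean_space) chart set \<Rightarrow> ('m, 'e) metric \<Rightarrow> ('m, 'e) chart \<Rightarrow> 'e \<Rightarrow> 'e \<Rightarrow> 'e \<Rightarrow> 'e" where
  "christoffel A g c z a b =
     (let D = (\<lambda>u v w. frechet_derivative (\<lambda>y. metric_coeff A g c y v w) (at z) u) in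
      THE w. \<forall>d. metric_coeff A g c z w d = (D a b d + D b a d - D d a b) / 2)"

text \<open>The second derivative of \<open>f\<close> at \<open>p\<close>, i.e. the covariant derivative \<open>(\<nabla>\<^sub>u Df)(v)\<close>, where \<open>Df\<close> is viewed
  as a section of \<open>T\<^sup>*M \<otimes> f\<^sup>*TM\<close>. In coordinates:
  \<open>D\<^sup>2F(u,v) + \<Gamma>(DF u, DF v) - DF(\<Gamma>(u,v))\<close>. It does not depend on the charts.\<close>

definition second_differential ::
    "('m, 'e::euclidean_space) chart set \<Rightarrow> ('m, 'e) metric \<Rightarrow> ('m \<Rightarrow> 'm) \<Rightarrow> 'm \<Rightarrow>
      ('m, 'e) tvec \<Rightarrow> ('m, 'e) tvec \<Rightarrow> ('m, 'e) tvec" where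
  "second_differential A g f p u v =
     (let c = some_chart A p; d = some_chart A (f p); z = chart_map c p;
          F = rep c d f; DF = frechet_derivative F (at z);
          D2F = (\<lambda>a b. frechet_derivative (\<lambda>y. frechet_derivative F (at y) b) (at z) a)
      in tvec_of_coord A d (f p)
           (D2F (u c) (v c) + christoffel A g d (F z) (DF (u c)) (DF (v c))
             - DF (christoffel A g c z (u c) (v c))))"

definition differential_norm ::
    "('m, 'e::euclidean_space) chart set \<Rightarrow> ('m, 'e) metric \<Rightarrow> ('m \<Rightarrow> 'm) \<Rightarrow> 'm \<Rightarrow> real" where
  "differential_norm A g f p =
     (SUP v \<in> tangent_space A p - {zero_tvec}.
        tnorm g (f p) (differential A f p v) / tnorm g p v)"

definition second_differential_norm ::
    "('m, 'e::euclidean_space) chart set \<Rightarrow> ('m, 'e) metric \<Rightarrow> ('m \<Rightarrow> 'm) \<Rightarrow> 'm \<Rightarrow> real" where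
  "second_differential_norm A g f p =
     (SUP (u, v) \<in> (tangent_space A p - {zero_tvec}) \<times> (tangent_space A p - {zero_tvec}).
        tnorm g (f p) (second_differential A g f p u v) / (tnorm g p u * tnorm g p v))"

text \<open>The \<open>C\<^sup>2\<close> norm measures the derivatives of order 1 and 2 (there is no canonical derivative of
  order 0 for self-maps of a manifold, and it would be bounded anyway). Computing it in a fixed finite
  atlas or through an embedding gives a quantity that is polynomially comparable, up to multiplicative
  constants, hence the same moment conditions. As
  \<open>\<parallel>f\<parallel> \<parallel>f\<^sup>-\<^sup>1\<parallel> \<ge> \<parallel>Df\<parallel> \<parallel>Df\<^sup>-\<^sup>1\<parallel> \<ge> 1\<close>, the sum of the logarithms in the moment condition is nonnegative.\<close>

definition C2_norm :: "('m, 'e::euclidean_space) chart set \<Rightarrow> ('m, 'e) metric \<Rightarrow> ('m \<Rightarrow> 'm) \<Rightarrow> real" where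
  "C2_norm A g f = (SUP p. differential_norm A g f p) + (SUP p. second_differential_norm A g f p)"

section \<open>Random dynamics\<close>

definition C2_diffeo_group ::
    "('m::topological_space, 'e::euclidean_space) chart set \<Rightarrow> ('m \<Rightarrow> 'm) set \<Rightarrow> bool" where
  "C2_diffeo_group A \<Gamma> \<longleftrightarrow> (\<forall>f\<in>\<Gamma>. Ck_diffeo 2 A f) \<and>
     id \<in> \<Gamma> \<and> (\<forall>f\<in>\<Gamma>. \<forall>h\<in>\<Gamma>. f \<circ> h \<in> \<Gamma>) \<and> (\<forall>f\<in>\<Gamma>. inv f \<in> \<Gamma>)"

definition is_orbit :: "('m \<Rightarrow> 'm) set \<Rightarrow> 'm set \<Rightarrow> bool" where
  "is_orbit \<Gamma> F \<longleftrightarrow> (\<exists>y. F = (\<lambda>f. f y) ` \<Gamma>)"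

text \<open>A probability measure on \<open>\<Gamma>\<close>. The \<open>\<sigma>\<close>-algebra on \<open>\<Gamma>\<close> is only required to make the action and the
  composition measurable, which holds for the Borel \<open>\<sigma>\<close>-algebra of the \<open>C\<^sup>2\<close> topology (a second
  countable group topology), and for the discrete one if \<open>\<Gamma>\<close> is countable.\<close>

definition prob_measure_on_group ::
    "('m::topological_space \<Rightarrow> 'm) set \<Rightarrow> ('m \<Rightarrow> 'm) measure \<Rightarrow> bool" where
  "prob_measure_on_group \<Gamma> \<nu> \<longleftrightarrow> prob_space \<nu> \<and> space \<nu> = \<Gamma> \<and>
     (\<forall>x. (\<lambda>f. f x) \<in> measurable \<nu> borel) \<and>
     (\<lambda>(f, h). f \<circ> h) \<in> measurable (\<nu> \<Otimes>\<^sub>M \<nu>) \<nu>"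

primrec conv_power :: "('m \<Rightarrow> 'm) measure \<Rightarrow> nat \<Rightarrow> ('m \<Rightarrow> 'm) measure" where
  "conv_power \<nu> 0 = return \<nu> id"
| "conv_power \<nu> (Suc n) = distr (\<nu> \<Otimes>\<^sub>M conv_power \<nu> n) \<nu> (\<lambda>(f, h). f \<circ> h)"

definition conv_dirac :: "('m::topological_space \<Rightarrow> 'm) measure \<Rightarrow> 'm \<Rightarrow> 'm measure" where
  "conv_dirac \<mu> x = distr \<mu> borel (\<lambda>f. f x)"

primrec random_iterate :: "(nat \<Rightarrow> 'm \<Rightarrow> 'm) \<Rightarrow> nat \<Rightarrow> 'm \<Rightarrow> 'm" where
  "random_iterate \<omega> 0 = id"
| "random_iterate \<omega> (Suc n) = \<omega> n \<circ> random_iterate \<omega> n"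

definition uniformly_expanding_on ::
    "('m, 'e::euclidean_space) chart set \<Rightarrow> ('m, 'e) metric \<Rightarrow> ('m \<Rightarrow> 'm) measure \<Rightarrow> 'm set \<Rightarrow> bool" where
  "uniformly_expanding_on A g \<nu> F \<longleftrightarrow>
     (\<exists>c>0. \<exists>n\<^sub>0\<ge>1. \<forall>y\<in>F. \<forall>v\<in>tangent_space A y - {zero_tvec}.
        (\<integral>f. ln (tnorm g (f y) (differential A f y v) / tnorm g y v) \<partial>conv_power \<nu> n\<^sub>0) \<ge> c)"

end

theory Submission
  imports Defs
begin

text \<open>Near the finite invariant set \<open>F\<close> the dynamics is repelling on average, and the proof turns this into
  a negative drift of the function \<open>\<phi> = - log d(\<cdot>, F)\<close>, which is large near \<open>F\<close>.

  Let \<open>X\<^sub>n\<close> be the random orbit of a point outside \<open>F\<close>. For a fixed map \<open>f\<close>, if \<open>x\<close> tends to \<open>q \<in> F\<close> from the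
  direction \<open>v\<close>, then \<open>\<phi>(f x) - \<phi>(x)\<close> tends to \<open>- log (\<parallel>D\<^sub>qf v\<parallel> / \<parallel>v\<parallel>)\<close>. The increments of \<open>\<phi>\<close> are dominated by
  the logarithms of the Lipschitz constants of \<open>f\<close> and \<open>f\<^sup>-\<^sup>1\<close>, which are integrable, so by dominated
  convergence uniform expansion gives \<open>E \<phi>(X\<^sub>n\<^sub>0) \<le> \<phi>(x) - c/2\<close> for all \<open>x\<close> close to \<open>F\<close> (\<open>drift_near_F\<close>).
  The average \<open>\<psi>\<close> of \<open>E \<phi>(X\<^sub>j)\<close> over \<open>j < n\<^sub>0\<close> differs from \<open>\<phi>\<close> by a bounded amount and has a negative drift
  already after one step. As the increments have a moment of order \<open>p\<close>, where one may take \<open>1 < p \<le> 2\<close>, this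
  yields a drift inequality for the power (\<open>\<psi>_powr_drift\<close>), in which \<open>P\<close> is the transition operator:
  \<open>P \<psi>\<^sup>p \<le> \<psi>\<^sup>p - c p \<psi>\<^sup>p\<^sup>-\<^sup>1 + b\<close> outside \<open>F\<close>.

  This inequality implies tightness in \<open>- F\<close> at every time, not only on average over time. The functions
  \<open>W\<^sub>j = min 1 ((\<psi> / (T + c j))\<^sup>p)\<close> satisfy \<open>P W\<^sub>j \<le> W\<^sub>j\<^sub>+\<^sub>1 + b / (T + c j)\<^sup>p\<close>, and iterating this \<open>n\<close> times bounds the
  probability of \<open>\<psi>(X\<^sub>n) \<ge> T\<close> by \<open>W\<^sub>n(x)\<close> plus a tail of a convergent series. The first term tends to 0 locally
  uniformly in \<open>x\<close>, the second one is small for large \<open>T\<close> because \<open>p > 1\<close> (\<open>uniform_tightness\<close>). This is the first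
  assertion, with a compact set \<open>K\<close> that depends on \<open>\<epsilon>\<close> only.

  For the second assertion, let \<open>A\<close> be the event that the frequency of visits to \<open>K\<close> is eventually at most \<open>1 - \<epsilon>\<close>. By tightness and
  Markov's inequality, from any starting point outside \<open>F\<close> such an event has probability at most 1/2. Restarting
  the orbit at time \<open>n\<close> shows that \<open>P(A \<inter> C) \<le> P(C) / 2\<close> for every event \<open>C\<close> that depends on the first \<open>n\<close> maps.
  Such events approximate \<open>A\<close>, hence \<open>P(A) \<le> P(A) / 2\<close> and \<open>A\<close> is negligible (\<open>AE_limsup_visits\<close>).

  The geometric input is a comparison of the distance to \<open>F\<close> before and after applying \<open>f\<close>
  (\<open>dist_F_image_le\<close>), obtained by following the image of a segment in a chart, together with two facts that
  connect the supremum \<open>Lip f\<close> of the norms of \<open>Df\<close> with the moment condition. First, \<open>Lip f\<close> is bounded below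
  over all diffeomorphisms \<open>f\<close> (\<open>Lip_ge\<close>), since a surjection of \<open>M\<close> cannot contract every member of a finite
  cover too much. Second, \<open>Lip f\<close> is at most the \<open>C\<^sup>2\<close> norm (\<open>Lip_le_C2_norm\<close>). The second summand in the \<open>C\<^sup>2\<close>
  norm is a supremum of real numbers, which is meaningful only when they are bounded; boundedness
  follows from compactness once the second differential is known to be independent of the charts,
  that is, from the transformation law of the Christoffel symbols (\<open>christoffel_change\<close>).\<close>

section \<open>Calculus of functions of class C2\<close>

abbreviation Dv :: "('a::euclidean_space \<Rightarrow> 'b::real_normed_vector) \<Rightarrow> 'a \<Rightarrow> 'a \<Rightarrow> 'b" where
  "Dv f x \<equiv> frechet_derivative f (at x)"

abbreviation D2v :: "('a::euclidean_space \<Rightarrow> 'b::real_normed_vector) \<Rightarrow> 'a \<Rightarrow> 'a \<Rightarrow> 'a \<Rightarrow> 'b" where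
  "D2v f x a b \<equiv> frechet_derivative (\<lambda>y. frechet_derivative f (at y) b) (at x) a"

lemma Dv_eqI: "(f has_derivative f') (at x) \<Longrightarrow> Dv f x = f'"
  using frechet_derivative_at by metis

lemma has_derivative_Dv: "f differentiable (at x) \<Longrightarrow> (f has_derivative Dv f x) (at x)"
  by (simp add: frechet_derivative_works)

lemma has_derivative_transform_open:
  assumes "(f has_derivative f') (at x)" "open U" "x \<in> U" "\<And>y. y \<in> U \<Longrightarrow> f y = g y"
  shows "(g has_derivative f') (at x)"
  using has_derivative_transform_within_open[OF assms(1,2,3)] assms(4) by blast

lemma linear_expand_Basis:
  fixes L :: "'a::euclidean_space \<Rightarrow> 'b::real_vector"
  assumes "linear L"
  shows "L e = (\<Sum>i\<in>Basis. (e \<bullet> i) *\<^sub>R L i)"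
  using linear_sum[OF assms, of "\<lambda>i. (e \<bullet> i) *\<^sub>R i" Basis] linear_scale[OF assms]
  by (simp add: euclidean_representation)

text \<open>The product rule for \<open>y \<mapsto> L\<^sub>y(h y)\<close> when only the maps \<open>y \<mapsto> L\<^sub>y(e)\<close> with fixed \<open>e\<close> are known to be
  differentiable, which is how \<open>Ck_on\<close> expresses regularity. Expanding \<open>h y\<close> in a basis reduces it to
  products of scalar functions with such maps.\<close>

lemma has_derivative_apply:
  fixes L :: "'a::euclidean_space \<Rightarrow> 'c::euclidean_space \<Rightarrow> 'b::real_normed_vector"
  assumes U: "open U" "x \<in> U" and lin: "\<And>y. y \<in> U \<Longrightarrow> linear (L y)"
    and L': "\<And>e. ((\<lambda>y. L y e) has_derivative L' e) (at x)"
    and h: "(h has_derivative h') (at x)"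
  shows "((\<lambda>y. L y (h y)) has_derivative (\<lambda>w. L' (h x) w + L x (h' w))) (at x)"
proof -
  have 1: "((\<lambda>y. \<Sum>i\<in>Basis. (h y \<bullet> i) *\<^sub>R L y i) has_derivative
      (\<lambda>w. \<Sum>i\<in>Basis. (h x \<bullet> i) *\<^sub>R L' i w + (h' w \<bullet> i) *\<^sub>R L x i)) (at x)"
    by (rule has_derivative_sum) (auto intro!: derivative_eq_intros h L')
  have "((\<lambda>y. \<Sum>i\<in>Basis. (h x \<bullet> i) *\<^sub>R L y i) has_derivative (\<lambda>w. \<Sum>i\<in>Basis. (h x \<bullet> i) *\<^sub>R L' i w)) (at x)"
    by (rule has_derivative_sum) (auto intro!: derivative_eq_intros L')
  then have "((\<lambda>y. L y (h x)) has_derivative (\<lambda>w. \<Sum>i\<in>Basis. (h x \<bullet> i) *\<^sub>R L' i w)) (at x)"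
    by (rule has_derivative_transform_open[OF _ U]) (simp only: linear_expand_Basis[OF lin, symmetric])
  then have "(\<lambda>w. \<Sum>i\<in>Basis. (h x \<bullet> i) *\<^sub>R L' i w) = L' (h x)"
    using L' has_derivative_unique by blast
  then have 2: "(\<Sum>i\<in>Basis. (h x \<bullet> i) *\<^sub>R L' i w) = L' (h x) w" for w by (rule fun_cong)
  have "(\<lambda>w. \<Sum>i\<in>Basis. (h x \<bullet> i) *\<^sub>R L' i w + (h' w \<bullet> i) *\<^sub>R L x i) = (\<lambda>w. L' (h x) w + L x (h' w))"
    by (simp only: sum.distrib 2 linear_expand_Basis[OF lin[OF U(2)], symmetric])
  moreover have "((\<lambda>y. L y (h y)) has_derivative
      (\<lambda>w. \<Sum>i\<in>Basis. (h x \<bullet> i) *\<^sub>R L' i w + (h' w \<bullet> i) *\<^sub>R L x i)) (at x)"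
    by (rule has_derivative_transform_open[OF 1 U]) (simp only: linear_expand_Basis[OF lin, symmetric])
  ultimately show ?thesis by (simp only:)
qed

lemma linear_Dv: "f differentiable (at x) \<Longrightarrow> linear (Dv f x)"
  using has_derivative_Dv has_derivative_linear by blast

lemma Ck_on_subset: "Ck_on k U f \<Longrightarrow> V \<subseteq> U \<Longrightarrow> Ck_on k V f"
  by (induction k arbitrary: f) (auto intro: continuous_on_subset)

lemma Ck_on_2D:
  assumes "Ck_on 2 U f" "x \<in> U"
  shows "f differentiable (at x)" "(\<lambda>y. Dv f y b) differentiable (at x)"
    "continuous_on U (\<lambda>x. D2v f x a b)"
  using assms by (auto simp: numeral_2_eq_2)

lemma Ck_on_2_has_derivative:
  assumes "Ck_on 2 U f" "x \<in> U"
  shows "(f has_derivative Dv f x) (at x)" "((\<lambda>y. Dv f y b) has_derivative (\<lambda>a. D2v f x a b)) (at x)"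
    "linear (Dv f x)" "linear (\<lambda>a. D2v f x a b)"
  using Ck_on_2D[OF assms] has_derivative_Dv linear_Dv by blast+

lemma Ck_on_2_continuous:
  assumes "Ck_on 2 U f"
  shows "continuous_on U f" "continuous_on U (\<lambda>x. Dv f x b)"
  using Ck_on_2D[OF assms] by (auto intro!: continuous_at_imp_continuous_on differentiable_imp_continuous_within)

lemma linear_D2v:
  assumes f: "Ck_on 2 U f" "x \<in> U" "open U"
  shows "linear (D2v f x a)"
proof (rule linearI)
  note d = Ck_on_2_has_derivative[OF f(1)]
  fix b c :: 'a and r :: real
  have "((\<lambda>y. Dv f y b + Dv f y c) has_derivative (\<lambda>a. D2v f x a b + D2v f x a c)) (at x)"
    by (intro has_derivative_add d f)
  then have "((\<lambda>y. Dv f y (b + c)) has_derivative (\<lambda>a. D2v f x a b + D2v f x a c)) (at x)"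
    by (rule has_derivative_transform_open[OF _ f(3,2)]) (simp add: linear_add[OF d(3)])
  from fun_cong[OF Dv_eqI[OF this]] show "D2v f x a (b + c) = D2v f x a b + D2v f x a c" .
  have "((\<lambda>y. r *\<^sub>R Dv f y b) has_derivative (\<lambda>a. r *\<^sub>R D2v f x a b)) (at x)"
    by (intro has_derivative_scaleR_right d f)
  then have "((\<lambda>y. Dv f y (r *\<^sub>R b)) has_derivative (\<lambda>a. r *\<^sub>R D2v f x a b)) (at x)"
    by (rule has_derivative_transform_open[OF _ f(3,2)]) (simp add: linear_scale[OF d(3)])
  from fun_cong[OF Dv_eqI[OF this]] show "D2v f x a (r *\<^sub>R b) = r *\<^sub>R D2v f x a b" .
qed

lemma Dv_compose:
  assumes "f differentiable (at x)" "h differentiable (at (f x))"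
  shows "Dv (\<lambda>y. h (f y)) x a = Dv h (f x) (Dv f x a)" "(\<lambda>y. h (f y)) differentiable (at x)"
proof -
  have "((\<lambda>y. h (f y)) has_derivative (\<lambda>a. Dv h (f x) (Dv f x a))) (at x)"
    using diff_chain_at[OF has_derivative_Dv[OF assms(1)] has_derivative_Dv[OF assms(2)]] by (simp add: o_def)
  then show "Dv (\<lambda>y. h (f y)) x a = Dv h (f x) (Dv f x a)" "(\<lambda>y. h (f y)) differentiable (at x)"
    using fun_cong[OF Dv_eqI] by (auto simp: differentiable_def)
qed

lemma D2v_compose:
  fixes f :: "'a::euclidean_space \<Rightarrow> 'b::euclidean_space" and h :: "'b \<Rightarrow> 'c::real_normed_vector"
  assumes f: "Ck_on 2 U f" "open U" "x \<in> U" and h: "Ck_on 2 V h" "open V" and sub: "\<And>y. y \<in> U \<Longrightarrow> f y \<in> V"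
  shows "D2v (\<lambda>y. h (f y)) x a b = D2v h (f x) (Dv f x a) (Dv f x b) + Dv h (f x) (D2v f x a b)"
proof -
  note df = Ck_on_2_has_derivative[OF f(1)] and dh = Ck_on_2_has_derivative[OF h(1)]
  have "((\<lambda>y. Dv h (f y) (Dv f y b)) has_derivative
      (\<lambda>a. (\<lambda>e w. D2v h (f x) (Dv f x w) e) (Dv f x b) a + Dv h (f x) (D2v f x a b))) (at x)"
  proof (rule has_derivative_apply[OF f(2,3), where h = "\<lambda>y. Dv f y b"])
    show "linear (Dv h (f y))" if "y \<in> U" for y by (rule dh) (use sub that in auto)
    show "((\<lambda>y. Dv h (f y) e) has_derivative (\<lambda>w. D2v h (f x) (Dv f x w) e)) (at x)" for e
      using diff_chain_at[OF df(1)[OF f(3)] dh(2)[OF sub[OF f(3)]], of e] by (simp add: o_def)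
    show "((\<lambda>y. Dv f y b) has_derivative (\<lambda>a. D2v f x a b)) (at x)" by (rule df f)+
  qed
  then have "((\<lambda>y. Dv (\<lambda>y. h (f y)) y b) has_derivative
      (\<lambda>a. D2v h (f x) (Dv f x a) (Dv f x b) + Dv h (f x) (D2v f x a b))) (at x)"
    by (rule has_derivative_transform_open[OF _ f(2,3)])
      (use Ck_on_2D[OF f(1)] Ck_on_2D[OF h(1) sub] in \<open>auto simp: Dv_compose\<close>)
  from fun_cong[OF Dv_eqI[OF this]] show ?thesis .
qed

text \<open>The mean value theorem for the second difference of \<open>f\<close> over a parallelogram, used below for both
  orders of the two sides.\<close>

lemma D2v_mean_value:
  fixes f :: "'a::euclidean_space \<Rightarrow> real"
  assumes f: "Ck_on 2 (ball x r) f" and st: "0 < s" "0 < t" "s * norm a + t * norm b < r"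
  shows "\<exists>\<sigma> \<tau>. 0 < \<sigma> \<and> \<sigma> < s \<and> 0 < \<tau> \<and> \<tau> < t \<and>
    f (x + s *\<^sub>R a + t *\<^sub>R b) - f (x + s *\<^sub>R a) - f (x + t *\<^sub>R b) + f x = s * t * D2v f (x + \<sigma> *\<^sub>R a + \<tau> *\<^sub>R b) b a"
proof -
  note d = Ck_on_2_has_derivative[OF f]
  have inb: "x + \<sigma> *\<^sub>R a + \<tau> *\<^sub>R b \<in> ball x r" if "0 \<le> \<sigma>" "\<sigma> \<le> s" "0 \<le> \<tau>" "\<tau> \<le> t" for \<sigma> \<tau>
  proof -
    have "norm (\<sigma> *\<^sub>R a + \<tau> *\<^sub>R b) \<le> \<sigma> * norm a + \<tau> * norm b"
      using norm_triangle_ineq[of "\<sigma> *\<^sub>R a" "\<tau> *\<^sub>R b"] that by simp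
    also have "\<dots> \<le> s * norm a + t * norm b" using that by (intro add_mono mult_right_mono) auto
    finally have "norm (\<sigma> *\<^sub>R a + \<tau> *\<^sub>R b) < r" using st by simp
    moreover have "dist (x + \<sigma> *\<^sub>R a + \<tau> *\<^sub>R b) x = norm (\<sigma> *\<^sub>R a + \<tau> *\<^sub>R b)"
      by (simp add: dist_norm add.assoc)
    ultimately show ?thesis by (simp add: dist_commute)
  qed
  have inb0: "x + \<sigma> *\<^sub>R a \<in> ball x r" if "0 \<le> \<sigma>" "\<sigma> \<le> s" for \<sigma>
    using inb[OF that, of 0] st by simp
  have aff: "((\<lambda>\<sigma>. x + \<sigma> *\<^sub>R a + t *\<^sub>R b) has_derivative (\<lambda>h. h *\<^sub>R a)) (at \<sigma>)" for \<sigma> t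
    by (auto intro!: derivative_eq_intros)
  have aff': "((\<lambda>\<tau>. x + \<sigma> *\<^sub>R a + \<tau> *\<^sub>R b) has_derivative (\<lambda>h. h *\<^sub>R b)) (at \<tau>)" for \<sigma> \<tau>
    by (auto intro!: derivative_eq_intros)
  define G where "G \<sigma> = f (x + \<sigma> *\<^sub>R a + t *\<^sub>R b) - f (x + \<sigma> *\<^sub>R a)" for \<sigma>
  have dG: "(G has_real_derivative (Dv f (x + \<sigma> *\<^sub>R a + t *\<^sub>R b) a - Dv f (x + \<sigma> *\<^sub>R a) a)) (at \<sigma>)"
    if "0 \<le> \<sigma>" "\<sigma> \<le> s" for \<sigma>
  proof -
    have "((\<lambda>\<sigma>. f (x + \<sigma> *\<^sub>R a + t *\<^sub>R b)) has_derivative (\<lambda>h. Dv f (x + \<sigma> *\<^sub>R a + t *\<^sub>R b) (h *\<^sub>R a))) (at \<sigma>)"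
      using diff_chain_at[OF aff d(1)[OF inb[OF that, of t]]] st by (simp add: o_def)
    moreover have "((\<lambda>\<sigma>. f (x + \<sigma> *\<^sub>R a)) has_derivative (\<lambda>h. Dv f (x + \<sigma> *\<^sub>R a) (h *\<^sub>R a))) (at \<sigma>)"
      using diff_chain_at[OF aff[where t = 0] d(1)[OF inb[OF that, where \<tau> = 0]]] st by (simp add: o_def)
    ultimately have "(G has_derivative (\<lambda>h. Dv f (x + \<sigma> *\<^sub>R a + t *\<^sub>R b) (h *\<^sub>R a) - Dv f (x + \<sigma> *\<^sub>R a) (h *\<^sub>R a))) (at \<sigma>)"
      unfolding G_def by (rule has_derivative_diff)
    moreover have "(\<lambda>h. Dv f (x + \<sigma> *\<^sub>R a + t *\<^sub>R b) (h *\<^sub>R a) - Dv f (x + \<sigma> *\<^sub>R a) (h *\<^sub>R a))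
        = (*) (Dv f (x + \<sigma> *\<^sub>R a + t *\<^sub>R b) a - Dv f (x + \<sigma> *\<^sub>R a) a)"
      using linear_scale[OF d(3)[OF inb[OF that, of t]]] linear_scale[OF d(3)[OF inb0[OF that]]] st
      by (intro ext) (simp add: algebra_simps)
    ultimately show ?thesis by (simp add: has_field_derivative_def)
  qed
  obtain \<sigma> where \<sigma>: "0 < \<sigma>" "\<sigma> < s" "G s - G 0 = (s - 0) * (Dv f (x + \<sigma> *\<^sub>R a + t *\<^sub>R b) a - Dv f (x + \<sigma> *\<^sub>R a) a)"
    using MVT2[OF st(1) dG] by blast
  define H where "H \<tau> = Dv f (x + \<sigma> *\<^sub>R a + \<tau> *\<^sub>R b) a" for \<tau>
  have dH: "(H has_real_derivative (D2v f (x + \<sigma> *\<^sub>R a + \<tau> *\<^sub>R b) b a)) (at \<tau>)" if "0 \<le> \<tau>" "\<tau> \<le> t" for \<tau>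
  proof -
    have m: "x + \<sigma> *\<^sub>R a + \<tau> *\<^sub>R b \<in> ball x r" using \<sigma> that by (intro inb) auto
    have "(H has_derivative (\<lambda>h. D2v f (x + \<sigma> *\<^sub>R a + \<tau> *\<^sub>R b) (h *\<^sub>R b) a)) (at \<tau>)"
      unfolding H_def
      using diff_chain_at[OF aff' d(2)[OF m, of a]] by (simp add: o_def)
    then show ?thesis
      using linear_scale[OF d(4)[OF m]] by (simp add: has_field_derivative_def mult_commute_abs)
  qed
  obtain \<tau> where \<tau>: "0 < \<tau>" "\<tau> < t" "H t - H 0 = (t - 0) * D2v f (x + \<sigma> *\<^sub>R a + \<tau> *\<^sub>R b) b a"
    using MVT2[OF st(2) dH] by blast
  have "f (x + s *\<^sub>R a + t *\<^sub>R b) - f (x + s *\<^sub>R a) - f (x + t *\<^sub>R b) + f x = G s - G 0"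
    by (simp add: G_def)
  also have "\<dots> = s * (H t - H 0)" using \<sigma>(3) by (simp add: H_def)
  also have "\<dots> = s * t * D2v f (x + \<sigma> *\<^sub>R a + \<tau> *\<^sub>R b) b a" using \<tau>(3) by simp
  finally show ?thesis using \<sigma>(1,2) \<tau>(1,2) by blast
qed

text \<open>The second difference is symmetric in the two directions. Divided by the area it is, by the mean value
  theorem, a value of either mixed derivative near \<open>x\<close>, and both are continuous.\<close>

lemma D2v_symmetric_real:
  fixes f :: "'a::euclidean_space \<Rightarrow> real"
  assumes f: "Ck_on 2 U f" "open U" "x \<in> U"
  shows "D2v f x a b = D2v f x b a"
proof (rule ccontr)
  assume ne: "D2v f x a b \<noteq> D2v f x b a"
  define e where "e = \<bar>D2v f x a b - D2v f x b a\<bar> / 2"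
  have e: "e > 0" using ne by (simp add: e_def)
  have c: "\<exists>d>0. \<forall>y. dist y x < d \<longrightarrow> dist (D2v f y a b) (D2v f x a b) < e" for a b
  proof -
    have "continuous (at x) (\<lambda>x. D2v f x a b)"
      using Ck_on_2D(3)[OF f(1,3)] f(2,3) by (simp add: continuous_on_eq_continuous_at)
    then show ?thesis using e unfolding continuous_at_eps_delta by blast
  qed
  obtain d1 where d1: "d1 > 0" "\<And>y. dist y x < d1 \<Longrightarrow> dist (D2v f y a b) (D2v f x a b) < e" using c by blast
  obtain d2 where d2: "d2 > 0" "\<And>y. dist y x < d2 \<Longrightarrow> dist (D2v f y b a) (D2v f x b a) < e" using c by blast
  obtain d3 where d3: "d3 > 0" "ball x d3 \<subseteq> U" using f(2,3) openE by blast
  define r where "r = min d1 (min d2 d3)"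
  have r: "r > 0" "r \<le> d1" "r \<le> d2" "r \<le> d3" using d1 d2 d3 by (auto simp: r_def)
  have fr: "Ck_on 2 (ball x r) f"
    by (rule Ck_on_subset[OF f(1) subset_trans[OF subset_ball[OF r(4)] d3(2)]])
  (* A step for which the whole parallelogram stays in the ball of radius r. *)
  define s where "s = r / (norm a + norm b + 1)"
  have pos: "norm a + norm b + 1 > 0" using norm_ge_zero[of a] norm_ge_zero[of b] by linarith
  have s: "s > 0" using r pos by (simp add: s_def)
  have sr: "s * norm a + s * norm b < r"
  proof -
    have "s * norm a + s * norm b = s * (norm a + norm b + 1) - s" by (simp add: algebra_simps)
    also have "\<dots> = r - s" using pos by (simp add: s_def)
    finally show ?thesis using s by simp
  qed
  have near: "dist (x + \<sigma> *\<^sub>R a + \<tau> *\<^sub>R b) x < r" if "0 < \<sigma>" "\<sigma> < s" "0 < \<tau>" "\<tau> < s" for \<sigma> \<tau>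
  proof -
    have "norm (\<sigma> *\<^sub>R a + \<tau> *\<^sub>R b) \<le> \<sigma> * norm a + \<tau> * norm b"
      using norm_triangle_ineq[of "\<sigma> *\<^sub>R a" "\<tau> *\<^sub>R b"] that by simp
    also have "\<dots> \<le> s * norm a + s * norm b" using that by (intro add_mono mult_right_mono) auto
    finally show ?thesis using sr by (simp add: dist_norm add.assoc)
  qed
  obtain \<sigma> \<tau> where 1: "0 < \<sigma>" "\<sigma> < s" "0 < \<tau>" "\<tau> < s"
    "f (x + s *\<^sub>R a + s *\<^sub>R b) - f (x + s *\<^sub>R a) - f (x + s *\<^sub>R b) + f x = s * s * D2v f (x + \<sigma> *\<^sub>R a + \<tau> *\<^sub>R b) b a"
    using D2v_mean_value[OF fr s s sr] by blast
  have sr': "s * norm b + s * norm a < r" using sr by simp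
  obtain \<sigma>' \<tau>' where 2: "0 < \<sigma>'" "\<sigma>' < s" "0 < \<tau>'" "\<tau>' < s"
    "f (x + s *\<^sub>R b + s *\<^sub>R a) - f (x + s *\<^sub>R b) - f (x + s *\<^sub>R a) + f x = s * s * D2v f (x + \<sigma>' *\<^sub>R b + \<tau>' *\<^sub>R a) a b"
    using D2v_mean_value[OF fr s s sr'] by blast
  have "s * s * D2v f (x + \<sigma> *\<^sub>R a + \<tau> *\<^sub>R b) b a = s * s * D2v f (x + \<sigma>' *\<^sub>R b + \<tau>' *\<^sub>R a) a b"
    using 1(5) 2(5) by (simp add: algebra_simps)
  then have eq: "D2v f (x + \<sigma> *\<^sub>R a + \<tau> *\<^sub>R b) b a = D2v f (x + \<tau>' *\<^sub>R a + \<sigma>' *\<^sub>R b) a b"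
    using s by (simp add: algebra_simps)
  have "dist (D2v f (x + \<sigma> *\<^sub>R a + \<tau> *\<^sub>R b) b a) (D2v f x b a) < e"
    using near[OF 1(1-4)] r by (intro d2) auto
  moreover have "dist (D2v f (x + \<tau>' *\<^sub>R a + \<sigma>' *\<^sub>R b) a b) (D2v f x a b) < e"
    using near[OF 2(3,4,1,2)] r by (intro d1) auto
  ultimately show False unfolding eq dist_real_def e_def by (smt (verit) field_sum_of_halves)
qed

lemma Ck_on_2_inner:
  fixes f :: "'a::euclidean_space \<Rightarrow> 'b::euclidean_space"
  assumes f: "Ck_on 2 U f" "open U"
  shows "Ck_on 2 U (\<lambda>x. f x \<bullet> i)" "x \<in> U \<Longrightarrow> D2v (\<lambda>x. f x \<bullet> i) x a b = D2v f x a b \<bullet> i"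
proof -
  note d = Ck_on_2_has_derivative[OF f(1)]
  have 1: "Dv (\<lambda>x. f x \<bullet> i) x = (\<lambda>a. Dv f x a \<bullet> i)" if "x \<in> U" for x
    by (rule Dv_eqI, rule has_derivative_inner_left, rule d(1)[OF that])
  have "((\<lambda>y. Dv (\<lambda>x. f x \<bullet> i) y b) has_derivative (\<lambda>a. D2v f x a b \<bullet> i)) (at x)" if "x \<in> U" for x b
    by (rule has_derivative_transform_open[OF has_derivative_inner_left[OF d(2)[OF that]] f(2) that]) (simp add: 1)
  note 2 = this
  have 3: "D2v (\<lambda>x. f x \<bullet> i) x a b = D2v f x a b \<bullet> i" if "x \<in> U" for x a b
    using fun_cong[OF Dv_eqI[OF 2[OF that]]] .
  have 4: "continuous_on U (\<lambda>x. D2v (\<lambda>x. f x \<bullet> i) x a b)" for a b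
    using Ck_on_2D(3)[OF f(1)] by (cases "U = {}") (auto simp: 3 intro!: continuous_intros cong: continuous_on_cong)
  show "x \<in> U \<Longrightarrow> D2v (\<lambda>x. f x \<bullet> i) x a b = D2v f x a b \<bullet> i" by (rule 3)
  show "Ck_on 2 U (\<lambda>x. f x \<bullet> i)"
    using 2 4 has_derivative_inner_left[OF d(1)]
    unfolding numeral_2_eq_2 Ck_on.simps differentiable_def by blast
qed

lemma D2v_symmetric:
  fixes f :: "'a::euclidean_space \<Rightarrow> 'b::euclidean_space"
  assumes f: "Ck_on 2 U f" "open U" "x \<in> U"
  shows "D2v f x a b = D2v f x b a"
proof (rule euclidean_eqI)
  fix i :: 'b
  show "D2v f x a b \<bullet> i = D2v f x b a \<bullet> i"
    using D2v_symmetric_real[OF Ck_on_2_inner(1)[OF f(1,2), of i] f(2,3), of a b]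
    by (simp add: Ck_on_2_inner(2)[OF f(1,2,3)])
qed

text \<open>Turns bounds on a basis into an operator bound that is uniform over a family of linear maps. The weight
  \<open>r\<close> makes it possible to iterate: for a multilinear map, the earlier arguments join the index \<open>z\<close> and
  their norms form \<open>r\<close>.\<close>

lemma linear_bound_on_basis:
  fixes B :: "'z \<Rightarrow> 'e::euclidean_space \<Rightarrow> 'b::real_normed_vector"
  assumes lin: "\<And>z. z \<in> Z \<Longrightarrow> linear (B z)"
    and bd: "\<And>i. i \<in> Basis \<Longrightarrow> \<exists>C. \<forall>z\<in>Z. norm (B z i) \<le> C * r z"
    and r: "\<And>z. z \<in> Z \<Longrightarrow> 0 \<le> r z"
  shows "\<exists>C\<ge>0. \<forall>z\<in>Z. \<forall>e. norm (B z e) \<le> C * r z * norm e"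
proof -
  obtain C where C: "\<And>i z. i \<in> Basis \<Longrightarrow> z \<in> Z \<Longrightarrow> norm (B z i) \<le> C i * r z"
    using bd by metis
  have "norm (B z e) \<le> (\<Sum>i\<in>Basis. \<bar>C i\<bar>) * r z * norm e" if z: "z \<in> Z" for z e
  proof -
    have "norm (B z e) = norm (\<Sum>i\<in>Basis. (e \<bullet> i) *\<^sub>R B z i)"
      by (simp only: linear_expand_Basis[OF lin[OF z], of e])
    also have "\<dots> \<le> (\<Sum>i\<in>Basis. norm ((e \<bullet> i) *\<^sub>R B z i))" by (rule norm_sum)
    also have "\<dots> \<le> (\<Sum>i\<in>Basis. norm e * (\<bar>C i\<bar> * r z))"
    proof (rule sum_mono)
      fix i :: 'e assume i: "i \<in> Basis"
      have "norm (B z i) \<le> \<bar>C i\<bar> * r z"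
        using C[OF i z] mult_right_mono[OF abs_ge_self[of "C i"] r[OF z]] by linarith
      then show "norm ((e \<bullet> i) *\<^sub>R B z i) \<le> norm e * (\<bar>C i\<bar> * r z)"
        using Basis_le_norm[OF i, of e] by (auto intro!: mult_mono)
    qed
    also have "\<dots> = (\<Sum>i\<in>Basis. \<bar>C i\<bar>) * r z * norm e"
      by (simp add: sum_distrib_left sum_distrib_right mult_ac)
    finally show ?thesis .
  qed
  then show ?thesis by (intro exI[of _ "\<Sum>i\<in>Basis. \<bar>C i\<bar>"]) (auto intro: sum_nonneg)
qed

lemma finite_family_bounded:
  fixes C :: "'i \<Rightarrow> 'j \<Rightarrow> real"
  assumes "finite I" "finite J"
  obtains K where "1 \<le> K" "\<And>i j. i \<in> I \<Longrightarrow> j \<in> J \<Longrightarrow> C i j \<le> K"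
proof (rule that[of "Max (insert 1 ((\<lambda>(i, j). C i j) ` (I \<times> J)))"])
  show "1 \<le> Max (insert 1 ((\<lambda>(i, j). C i j) ` (I \<times> J)))" using assms by (intro Max_ge) auto
  show "C i j \<le> Max (insert 1 ((\<lambda>(i, j). C i j) ` (I \<times> J)))" if "i \<in> I" "j \<in> J" for i j
    using assms that by (intro Max_ge) force+
qed

lemma Dv_cong_open:
  assumes "open U" "x \<in> U" "\<And>y. y \<in> U \<Longrightarrow> f y = g y"
  shows "Dv f x = Dv g x"
proof -
  have "(f has_derivative f') (at x) \<longleftrightarrow> (g has_derivative f') (at x)" for f'
    using has_derivative_transform_open[OF _ assms(1,2), of f f' g]
      has_derivative_transform_open[OF _ assms(1,2), of g f' f] assms(3) by metis
  then show ?thesis unfolding frechet_derivative_def by simp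
qed

lemma D2v_cong_open:
  assumes "open U" "x \<in> U" "\<And>y. y \<in> U \<Longrightarrow> f y = g y"
  shows "D2v f x a b = D2v g x a b"
proof -
  have "Dv f y b = Dv g y b" if "y \<in> U" for y
    using Dv_cong_open[OF assms(1) that assms(3)] by simp
  from Dv_cong_open[OF assms(1,2) this] show ?thesis by simp
qed

section \<open>Riemannian manifolds in charts\<close>

locale riemannian =
  fixes A :: "('m::{t2_space, second_countable_topology}, 'e::euclidean_space) chart set"
    and g :: "('m, 'e) metric"
  assumes riemannian: "riemannian_manifold A g"
begin

subsection \<open>Charts\<close>

lemma is_chart: "c \<in> A \<Longrightarrow> is_chart c"
  using riemannian by (simp add: riemannian_manifold_def smooth_atlas_def)

lemma open_chart: "c \<in> A \<Longrightarrow> open (chart_dom c)" "c \<in> A \<Longrightarrow> open (chart_img c)"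
  using is_chart by (auto simp: is_chart_def)

lemma chart_continuous:
  "c \<in> A \<Longrightarrow> continuous_on (chart_dom c) (chart_map c)" "c \<in> A \<Longrightarrow> continuous_on (chart_img c) (chart_inv c)"
  using is_chart homeomorphism_cont1 homeomorphism_cont2 unfolding is_chart_def by blast+

lemma chart_inv_map: "c \<in> A \<Longrightarrow> x \<in> chart_dom c \<Longrightarrow> chart_inv c (chart_map c x) = x"
  using is_chart homeomorphism_apply1 unfolding is_chart_def by blast

lemma chart_map_inv: "z \<in> chart_img c \<Longrightarrow> chart_map c (chart_inv c z) = z"
  by (rule f_inv_into_f)

lemma chart_inv_dom: "z \<in> chart_img c \<Longrightarrow> chart_inv c z \<in> chart_dom c"
  by (rule inv_into_into)

lemma charts_at_iff: "c \<in> charts_at A x \<longleftrightarrow> c \<in> A \<and> x \<in> chart_dom c"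
  by (simp add: charts_at_def)

lemma some_chart_at: "some_chart A x \<in> charts_at A x"
proof -
  have "x \<in> (\<Union>c\<in>A. chart_dom c)"
    using riemannian unfolding riemannian_manifold_def smooth_atlas_def by blast
  then have "\<exists>c. c \<in> charts_at A x" unfolding charts_at_def by blast
  then show ?thesis unfolding some_chart_def by (rule someI_ex)
qed

lemma mem_rep_dom: "c \<in> A \<Longrightarrow> z \<in> rep_dom c d f \<longleftrightarrow> z \<in> chart_img c \<and> f (chart_inv c z) \<in> chart_dom d"
proof
  assume c: "c \<in> A" and "z \<in> rep_dom c d f"
  then obtain x where "x \<in> chart_dom c" "f x \<in> chart_dom d" "z = chart_map c x"
    unfolding rep_dom_def by blast
  then show "z \<in> chart_img c \<and> f (chart_inv c z) \<in> chart_dom d"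
    using chart_inv_map[OF c] by simp
next
  assume z: "z \<in> chart_img c \<and> f (chart_inv c z) \<in> chart_dom d"
  then show "z \<in> rep_dom c d f"
    unfolding rep_dom_def using chart_inv_dom[of z c] chart_map_inv[of z c]
    by (intro image_eqI[of _ _ "chart_inv c z"]) auto
qed

lemma open_rep_dom:
  assumes "c \<in> A" "d \<in> A" "continuous_on UNIV f"
  shows "open (rep_dom c d f)"
proof -
  have "continuous_on (chart_img c) (\<lambda>z. f (chart_inv c z))"
    by (rule continuous_on_compose2[OF assms(3) chart_continuous(2)[OF assms(1)]]) simp
  from continuous_open_preimage[OF this open_chart(2)[OF assms(1)] open_chart(1)[OF assms(2)]]
  have "open (chart_img c \<inter> (\<lambda>z. f (chart_inv c z)) -` chart_dom d)" .
  moreover have "rep_dom c d f = chart_img c \<inter> (\<lambda>z. f (chart_inv c z)) -` chart_dom d"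
    by (rule set_eqI) (simp add: mem_rep_dom[OF assms(1)])
  ultimately show ?thesis by simp
qed

text \<open>With this, changes of coordinates are the special case \<open>f = id\<close> of all statements on local
  representatives of maps.\<close>

lemma Ck_map_id: "Ck_map 2 A id"
  using riemannian by (simp add: Ck_map_def riemannian_manifold_def smooth_atlas_def smooth_on_def)

lemma rep_C2:
  assumes "Ck_map 2 A f" "c \<in> A" "d \<in> A"
  shows "Ck_on 2 (rep_dom c d f) (rep c d f)" "open (rep_dom c d f)"
  using assms open_rep_dom by (auto simp: Ck_map_def)

lemma rep_at: "c \<in> A \<Longrightarrow> x \<in> chart_dom c \<Longrightarrow> rep c d f (chart_map c x) = chart_map d (f x)"
  by (simp add: rep_def chart_inv_map)

lemma map_in_rep_dom: "c \<in> A \<Longrightarrow> x \<in> chart_dom c \<Longrightarrow> f x \<in> chart_dom d \<Longrightarrow> chart_map c x \<in> rep_dom c d f"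
  by (simp add: mem_rep_dom chart_inv_map)

text \<open>The chain rule of first and second order for local representatives. The base point is kept on the
  manifold, so that the three charts may be arbitrary charts around \<open>x\<close>, \<open>f x\<close> and \<open>h (f x)\<close>.\<close>

lemma rep_compose:
  assumes f: "Ck_map 2 A f" and h: "Ck_map 2 A h" and c: "c \<in> A" "d \<in> A" "e \<in> A"
    and x: "x \<in> chart_dom c" "f x \<in> chart_dom d" "h (f x) \<in> chart_dom e"
  shows "Dv (rep c e (h \<circ> f)) (chart_map c x) a = Dv (rep d e h) (chart_map d (f x)) (Dv (rep c d f) (chart_map c x) a)"
    and "D2v (rep c e (h \<circ> f)) (chart_map c x) a b =
      D2v (rep d e h) (chart_map d (f x)) (Dv (rep c d f) (chart_map c x) a) (Dv (rep c d f) (chart_map c x) b)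
      + Dv (rep d e h) (chart_map d (f x)) (D2v (rep c d f) (chart_map c x) a b)"
proof -
  let ?z = "chart_map c x"
  define U where "U = rep_dom c d f \<inter> rep_dom c e (h \<circ> f)"
  have "continuous_on UNIV (h \<circ> f)"
    using f h by (auto simp: Ck_map_def o_def intro: continuous_on_compose2)
  then have U: "open U"
    unfolding U_def using open_rep_dom[OF c(1,2), of f] open_rep_dom[OF c(1,3), of "h \<circ> f"] f
    by (simp add: Ck_map_def open_Int)
  have z: "?z \<in> U" unfolding U_def using map_in_rep_dom c x by auto
  have eq: "rep c e (h \<circ> f) y = rep d e h (rep c d f y)" and in2: "rep c d f y \<in> rep_dom d e h" if "y \<in> U" for y
    using that c by (auto simp: U_def mem_rep_dom rep_def chart_inv_map)
  have F: "Ck_on 2 U (rep c d f)"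
    by (rule Ck_on_subset[OF rep_C2(1)[OF f c(1,2)]]) (simp add: U_def)
  note H = rep_C2[OF h c(2,3)]
  have zz: "rep c d f ?z = chart_map d (f x)" using rep_at c x by simp
  show "Dv (rep c e (h \<circ> f)) ?z a = Dv (rep d e h) (chart_map d (f x)) (Dv (rep c d f) ?z a)"
    using Dv_cong_open[OF U z eq] Dv_compose(1)[OF Ck_on_2D(1)[OF F z] Ck_on_2D(1)[OF H(1) in2[OF z]], where a = a]
    by (simp add: zz)
  show "D2v (rep c e (h \<circ> f)) ?z a b =
      D2v (rep d e h) (chart_map d (f x)) (Dv (rep c d f) ?z a) (Dv (rep c d f) ?z b)
      + Dv (rep d e h) (chart_map d (f x)) (D2v (rep c d f) ?z a b)"
    using D2v_cong_open[OF U z eq, where a = a and b = b] D2v_compose[OF F U z H in2, where a = a and b = b] by (simp add: zz)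
qed

lemma Dv_rep_id: "c \<in> charts_at A x \<Longrightarrow> Dv (rep c c id) (chart_map c x) a = a"
proof -
  assume c: "c \<in> charts_at A x"
  have "Dv (rep c c id) (chart_map c x) = Dv (\<lambda>z. z) (chart_map c x)"
    using c by (intro Dv_cong_open[of "chart_img c"]) (auto simp: charts_at_iff open_chart rep_def chart_map_inv)
  also have "\<dots> = (\<lambda>a. a)" by (rule Dv_eqI) simp
  finally show ?thesis by simp
qed

lemma linear_Dv_rep:
  assumes "Ck_map 2 A f" "c \<in> charts_at A x" "d \<in> charts_at A (f x)"
  shows "linear (Dv (rep c d f) (chart_map c x))"
  by (rule Ck_on_2_has_derivative[OF rep_C2(1)[OF assms(1), of c d]])
    (use assms in \<open>auto simp: charts_at_iff map_in_rep_dom\<close>)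

lemma linear_trans: "c \<in> charts_at A x \<Longrightarrow> d \<in> charts_at A x \<Longrightarrow> linear (Dv (rep c d id) (chart_map c x))"
  using linear_Dv_rep[OF Ck_map_id] by simp

lemma trans_trans:
  assumes "c \<in> charts_at A x" "d \<in> charts_at A x" "e \<in> charts_at A x"
  shows "Dv (rep d e id) (chart_map d x) (Dv (rep c d id) (chart_map c x) a) = Dv (rep c e id) (chart_map c x) a"
  using rep_compose(1)[OF Ck_map_id Ck_map_id, of c d e x a] assms by (simp add: charts_at_iff)

lemma trans_inverse:
  assumes "c \<in> charts_at A x" "d \<in> charts_at A x"
  shows "Dv (rep d c id) (chart_map d x) (Dv (rep c d id) (chart_map c x) a) = a"
  using trans_trans[OF assms assms(1)] Dv_rep_id[OF assms(1)] by simp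

subsection \<open>Tangent vectors in coordinates\<close>

abbreviation tv :: "('m, 'e) chart \<Rightarrow> 'm \<Rightarrow> 'e \<Rightarrow> ('m, 'e) tvec" where
  "tv \<equiv> tvec_of_coord A"

lemma tv_coord: "d \<in> charts_at A x \<Longrightarrow> tv c x a d = Dv (rep c d id) (chart_map c x) a"
  by (simp add: tvec_of_coord_def)

lemma tv_self: "c \<in> charts_at A x \<Longrightarrow> tv c x a c = a"
  by (simp add: tv_coord Dv_rep_id)

lemma tv_tangent: "c \<in> charts_at A x \<Longrightarrow> tv c x a \<in> tangent_space A x"
  unfolding tangent_space_def by (auto simp: tv_coord trans_trans) (simp add: tvec_of_coord_def)

lemma tangent_coord:
  assumes "v \<in> tangent_space A x" "c \<in> charts_at A x" "d \<in> charts_at A x"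
  shows "v d = Dv (rep c d id) (chart_map c x) (v c)"
  using assms unfolding tangent_space_def by blast

lemma tangent_eq_tv:
  assumes "v \<in> tangent_space A x" "c \<in> charts_at A x"
  shows "v = tv c x (v c)"
proof
  fix d
  show "v d = tv c x (v c) d"
  proof (cases "d \<in> charts_at A x")
    case True
    then show ?thesis using tangent_coord[OF assms True] by (simp only: tv_coord[OF True])
  next
    case False
    then have "v d = 0" using assms(1) unfolding tangent_space_def by blast
    with False show ?thesis by (simp only: tvec_of_coord_def if_False)
  qed
qed

lemma tv_change:
  assumes "c \<in> charts_at A x" "d \<in> charts_at A x"
  shows "tv c x a = tv d x (Dv (rep c d id) (chart_map c x) a)"
  using tangent_eq_tv[OF tv_tangent[OF assms(1)] assms(2)] by (simp add: tv_coord assms)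

lemma tv_linear:
  assumes "c \<in> charts_at A x"
  shows "tv c x (r *\<^sub>R a + b) = (\<lambda>d. r *\<^sub>R tv c x a d + tv c x b d)"
proof
  fix d
  show "tv c x (r *\<^sub>R a + b) d = r *\<^sub>R tv c x a d + tv c x b d"
  proof (cases "d \<in> charts_at A x")
    case True
    note l = linear_trans[OF assms True]
    show ?thesis by (simp only: tv_coord[OF True] linear_add[OF l] linear_scale[OF l])
  qed (simp add: tvec_of_coord_def)
qed

lemma tv_eq_zero_iff: "c \<in> charts_at A x \<Longrightarrow> tv c x a = zero_tvec \<longleftrightarrow> a = 0"
proof
  assume c: "c \<in> charts_at A x" and "tv c x a = zero_tvec"
  then have "tv c x a c = 0" by simp
  with c show "a = 0" by (simp add: tv_self)
next
  assume c: "c \<in> charts_at A x" and "a = 0"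
  then show "tv c x a = zero_tvec"
    by (auto simp: tvec_of_coord_def linear_0[OF linear_trans])
qed

subsection \<open>The metric in coordinates\<close>

abbreviation G :: "('m, 'e) chart \<Rightarrow> 'e \<Rightarrow> 'e \<Rightarrow> 'e \<Rightarrow> real" where
  "G \<equiv> metric_coeff A g"

lemma metric: "riemannian_metric A g"
  using riemannian by (simp add: riemannian_manifold_def)

lemma G_eq: "c \<in> charts_at A x \<Longrightarrow> G c (chart_map c x) a b = g x (tv c x a) (tv c x b)"
  by (simp add: metric_coeff_def charts_at_iff chart_inv_map)

lemma img_point: "c \<in> A \<Longrightarrow> z \<in> chart_img c \<Longrightarrow> \<exists>x. c \<in> charts_at A x \<and> z = chart_map c x"
  by (auto simp: charts_at_iff)

lemma G_sym:
  assumes "c \<in> A" "z \<in> chart_img c"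
  shows "G c z a b = G c z b a"
proof -
  obtain x where x: "c \<in> charts_at A x" "z = chart_map c x" using img_point[OF assms] by blast
  show ?thesis
    using metric tv_tangent[OF x(1)] unfolding x(2) G_eq[OF x(1)] riemannian_metric_def by blast
qed

lemma G_linear_left:
  assumes "c \<in> A" "z \<in> chart_img c"
  shows "linear (\<lambda>a. G c z a b)"
proof -
  obtain x where x: "c \<in> charts_at A x" "z = chart_map c x" using img_point[OF assms] by blast
  have l: "G c z (r *\<^sub>R a + a') b = r * G c z a b + G c z a' b" for r a a'
    using metric tv_tangent[OF x(1)] unfolding x(2) G_eq[OF x(1)] tv_linear[OF x(1)] riemannian_metric_def by blast
  have l0: "G c z 0 b = 0" using l[of 1 0 0] by simp
  show ?thesis
    by (rule linearI) (use l[of 1] l[where a' = 0] l0 in auto)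
qed

lemma G_linear_right:
  assumes "c \<in> A" "z \<in> chart_img c"
  shows "linear (\<lambda>b. G c z a b)"
  using G_linear_left[OF assms, of a] G_sym[OF assms] by simp

lemma G_pos:
  assumes "c \<in> A" "z \<in> chart_img c" "a \<noteq> 0"
  shows "0 < G c z a a"
proof -
  obtain x where x: "c \<in> charts_at A x" "z = chart_map c x" using img_point[OF assms(1,2)] by blast
  then show ?thesis
    using metric tv_tangent[OF x(1), of a] tv_eq_zero_iff[OF x(1), of a] assms(3)
    by (auto simp: G_eq riemannian_metric_def)
qed

lemma G_nonneg: "c \<in> A \<Longrightarrow> z \<in> chart_img c \<Longrightarrow> 0 \<le> G c z a a"
  using G_pos[of c z a] linear_0[OF G_linear_left, of c z 0] by (cases "a = 0") auto

lemma G_expand: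
  assumes "c \<in> A" "z \<in> chart_img c"
  shows "G c z a a = (\<Sum>i\<in>Basis. \<Sum>j\<in>Basis. (a \<bullet> i) * ((a \<bullet> j) * G c z i j))"
proof -
  have "G c z a a = (\<Sum>i\<in>Basis. (a \<bullet> i) * G c z i a)"
    using linear_expand_Basis[OF G_linear_left[OF assms], of a a] by simp
  also have "\<dots> = (\<Sum>i\<in>Basis. (a \<bullet> i) * (\<Sum>j\<in>Basis. (a \<bullet> j) * G c z i j))"
    using linear_expand_Basis[OF G_linear_right[OF assms], of _ a] by simp
  finally show ?thesis by (simp add: sum_distrib_left)
qed

lemma G_change:
  assumes "c \<in> charts_at A x" "d \<in> charts_at A x"
  shows "G c (chart_map c x) a b =
    G d (chart_map d x) (Dv (rep c d id) (chart_map c x) a) (Dv (rep c d id) (chart_map c x) b)"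
  by (simp add: G_eq assms tv_change[OF assms])

lemma G_C2: "c \<in> A \<Longrightarrow> Ck_on 2 (chart_img c) (\<lambda>z. G c z a b)"
  using metric unfolding riemannian_metric_def smooth_on_def by blast

lemma tnorm_coord:
  assumes "v \<in> tangent_space A x" "c \<in> charts_at A x"
  shows "tnorm g x v = sqrt (G c (chart_map c x) (v c) (v c))"
  unfolding tnorm_def G_eq[OF assms(2)] tangent_eq_tv[OF assms, symmetric] ..

lemma tnorm_pos: "v \<in> tangent_space A x - {zero_tvec} \<Longrightarrow> 0 < tnorm g x v"
  using metric by (auto simp: tnorm_def riemannian_metric_def)

lemma tnorm_nonneg: "v \<in> tangent_space A x \<Longrightarrow> 0 \<le> tnorm g x v"
  using tnorm_coord[OF _ some_chart_at] G_nonneg some_chart_at by (metis charts_at_iff imageI real_sqrt_ge_zero)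

lemma tangent_nonzero: "tangent_space A x - {zero_tvec} \<noteq> {}"
proof -
  obtain i :: 'e where "i \<in> Basis" using nonempty_Basis by blast
  then have "i \<noteq> 0" by auto
  then show ?thesis
    using tv_tangent[OF some_chart_at] tv_eq_zero_iff[OF some_chart_at] by blast
qed

subsection \<open>The differential in coordinates\<close>

text \<open>The differential is defined through one chosen chart at \<open>x\<close> and one at \<open>f x\<close>, unrelated to the choices at
  neighbouring points. Only in this form, with arbitrary charts, can it be estimated locally uniformly.\<close>

lemma differential_coord:
  assumes f: "Ck_map 2 A f" and v: "v \<in> tangent_space A x" and c: "c \<in> charts_at A x" and d: "d \<in> charts_at A (f x)"
  shows "differential A f x v \<in> tangent_space A (f x)"
    and "differential A f x v d = Dv (rep c d f) (chart_map c x) (v c)"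
proof -
  let ?c = "some_chart A x" and ?d = "some_chart A (f x)"
  have s: "?c \<in> charts_at A x" "?d \<in> charts_at A (f x)" by (rule some_chart_at)+
  have df: "differential A f x v = tv ?d (f x) (Dv (rep ?c ?d f) (chart_map ?c x) (v ?c))"
    by (simp add: differential_def Let_def)
  then show "differential A f x v \<in> tangent_space A (f x)" by (simp add: tv_tangent s)
  have vc: "v ?c = Dv (rep c ?c id) (chart_map c x) (v c)"
    by (rule tangent_coord[OF v c s(1)])
  have "differential A f x v d = Dv (rep ?d d id) (chart_map ?d (f x)) (Dv (rep ?c ?d f) (chart_map ?c x) (v ?c))"
    by (simp add: df tv_coord d)
  also have "Dv (rep ?c ?d f) (chart_map ?c x) (v ?c) = Dv (rep c ?d f) (chart_map c x) (v c)"
    using rep_compose(1)[OF Ck_map_id f, of c ?c ?d x "v c"] s c unfolding vc by (simp add: charts_at_iff)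
  also have "Dv (rep ?d d id) (chart_map ?d (f x)) (Dv (rep c ?d f) (chart_map c x) (v c)) = Dv (rep c d f) (chart_map c x) (v c)"
    using rep_compose(1)[OF f Ck_map_id, of c ?d d x "v c"] s c d by (simp add: charts_at_iff)
  finally show "differential A f x v d = Dv (rep c d f) (chart_map c x) (v c)" .
qed

subsection \<open>Christoffel symbols and the second differential\<close>

text \<open>The Koszul expression for commuting fields: twice the Christoffel symbol, paired with \<open>d\<close>.\<close>

definition Koszul :: "('m, 'e) chart \<Rightarrow> 'e \<Rightarrow> 'e \<Rightarrow> 'e \<Rightarrow> 'e \<Rightarrow> real" where
  "Koszul c z a b d = Dv (\<lambda>y. G c y b d) z a + Dv (\<lambda>y. G c y a d) z b - Dv (\<lambda>y. G c y a b) z d"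

lemma Dv_G_linear:
  assumes c: "c \<in> A" "z \<in> chart_img c"
  shows "linear (\<lambda>b. Dv (\<lambda>y. G c y b d) z a)" "linear (\<lambda>d. Dv (\<lambda>y. G c y b d) z a)" "linear (Dv (\<lambda>y. G c y b d) z)"
proof -
  note D = Ck_on_2_has_derivative[OF G_C2[OF c(1)] c(2)]
  note o = open_chart(2)[OF c(1)]
  show l: "linear (\<lambda>b. Dv (\<lambda>y. G c y b d) z a)" for d
  proof (rule linearI)
    fix b b' r
    have "((\<lambda>y. G c y (b + b') d) has_derivative (\<lambda>a. Dv (\<lambda>y. G c y b d) z a + Dv (\<lambda>y. G c y b' d) z a)) (at z)"
      by (rule has_derivative_transform_open[OF has_derivative_add[OF D(1) D(1)] o c(2)])
        (simp add: linear_add[OF G_linear_left[OF c(1)]])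
    from fun_cong[OF Dv_eqI[OF this]]
    show "Dv (\<lambda>y. G c y (b + b') d) z a = Dv (\<lambda>y. G c y b d) z a + Dv (\<lambda>y. G c y b' d) z a" .
    have "((\<lambda>y. G c y (r *\<^sub>R b) d) has_derivative (\<lambda>a. r *\<^sub>R Dv (\<lambda>y. G c y b d) z a)) (at z)"
      by (rule has_derivative_transform_open[OF has_derivative_scaleR_right[OF D(1)] o c(2)])
        (simp add: linear_scale[OF G_linear_left[OF c(1)]])
    from fun_cong[OF Dv_eqI[OF this]]
    show "Dv (\<lambda>y. G c y (r *\<^sub>R b) d) z a = r *\<^sub>R Dv (\<lambda>y. G c y b d) z a" .
  qed
  have "Dv (\<lambda>y. G c y b d) z = Dv (\<lambda>y. G c y d b) z" for d
    by (rule Dv_cong_open[OF o c(2)]) (rule G_sym[OF c(1)])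
  then show "linear (\<lambda>d. Dv (\<lambda>y. G c y b d) z a)" using l[of b] by simp
  show "linear (Dv (\<lambda>y. G c y b d) z)" by (rule D)
qed

lemma Koszul_linear: 
  assumes "c \<in> A" "z \<in> chart_img c"
  shows "linear (Koszul c z a b)"
  unfolding Koszul_def[abs_def]
  by (intro linear_compose_add linear_compose_sub Dv_G_linear assms)

lemma G_nondegenerate:
  assumes "c \<in> A" "z \<in> chart_img c" "\<And>d. G c z w d = G c z w' d"
  shows "w = w'"
proof (rule ccontr)
  assume "w \<noteq> w'"
  then have "0 < G c z (w - w') (w - w')" by (intro G_pos assms) simp
  also have "\<dots> = 0" using linear_diff[OF G_linear_left[OF assms(1,2), of "w - w'"], of w w'] assms(3)[of "w - w'"] by simp
  finally show False by simp
qed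

text \<open>The Riesz representation with respect to the metric: \<open>w \<mapsto> G(w, \<cdot>)\<close> is an injective linear map between
  spaces of the same finite dimension.\<close>

lemma G_represents:
  assumes c: "c \<in> A" "z \<in> chart_img c" and l: "linear l"
  shows "\<exists>w. \<forall>d. G c z w d = l d"
proof -
  define T where "T w = (\<Sum>i\<in>Basis. G c z w i *\<^sub>R i)" for w
  have Ti: "T w \<bullet> i = G c z w i" if "i \<in> Basis" for w i
    using that by (simp add: T_def)
  have "linear T"
    unfolding T_def
    by (rule linearI) (simp_all add: linear_add[OF G_linear_left[OF c]] linear_scale[OF G_linear_left[OF c]]
        scaleR_add_left sum.distrib scaleR_sum_right)
  moreover have "inj T"
  proof (rule injI)
    fix w w' assume "T w = T w'"
    then have i: "G c z w i = G c z w' i" if "i \<in> Basis" for i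
      using Ti[OF that, of w] Ti[OF that, of w'] \<open>T w = T w'\<close> by simp
    show "w = w'"
    proof (rule G_nondegenerate[OF c])
      fix d
      show "G c z w d = G c z w' d"
        using linear_expand_Basis[OF G_linear_right[OF c], of w d] linear_expand_Basis[OF G_linear_right[OF c], of w' d] i
        by simp
    qed
  qed
  ultimately have "surj T" using linear_inj_imp_surj by blast
  then obtain w where w: "T w = (\<Sum>i\<in>Basis. l i *\<^sub>R i)" by (metis surjD)
  have i: "G c z w i = l i" if "i \<in> Basis" for i
    using Ti[OF that, of w] that by (simp add: w)
  have "G c z w d = l d" for d
    using linear_expand_Basis[OF G_linear_right[OF c], of w d] linear_expand_Basis[OF l, of d] i by simp
  then show ?thesis by blast
qed

lemma christoffel:
  assumes c: "c \<in> A" "z \<in> chart_img c"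
  shows "G c z (christoffel A g c z a b) d = Koszul c z a b d / 2"
proof -
  have "linear (\<lambda>d. Koszul c z a b d / 2)"
    using Koszul_linear[OF c, of a b] by (auto simp: linear_iff)
  then obtain w where w: "\<forall>d. G c z w d = Koszul c z a b d / 2" using G_represents[OF c] by blast
  have "christoffel A g c z a b = (THE w. \<forall>d. G c z w d = Koszul c z a b d / 2)"
    by (simp add: christoffel_def Let_def Koszul_def)
  also have "\<dots> = w"
    by (rule the_equality) (use w in simp, rule G_nondegenerate[OF c], metis w)
  finally show ?thesis using w by simp
qed

text \<open>Differentiates the identity \<open>G\<^sub>c(a, b) = G\<^sub>d(T a, T b)\<close>, in which the base point, and with it \<open>T\<close>, varies.
  The two terms with the second derivative of the change of coordinates are the reason why Christoffel
  symbols are not a tensor.\<close>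

lemma Dv_G_change:
  assumes c: "c \<in> charts_at A x" "d \<in> charts_at A x"
  defines "z \<equiv> chart_map c x" and "y \<equiv> chart_map d x"
  defines "T \<equiv> Dv (rep c d id) z" and "T2 \<equiv> D2v (rep c d id) z"
  shows "Dv (\<lambda>q. G c q a b) z w = Dv (\<lambda>q. G d q (T a) (T b)) y (T w) + G d y (T2 w a) (T b) + G d y (T a) (T2 w b)"
proof -
  let ?R = "rep c d id" and ?U = "rep_dom c d id"
  have cA: "c \<in> A" "d \<in> A" and xd: "x \<in> chart_dom c" "x \<in> chart_dom d" using c by (auto simp: charts_at_iff)
  note R = rep_C2[OF Ck_map_id cA]
  have z: "z \<in> ?U" using map_in_rep_dom[OF cA(1) xd(1), of id] xd by (simp add: z_def)
  note DR = Ck_on_2_has_derivative[OF R(1) z]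
  have Rz: "?R z = y" using rep_at[OF cA(1) xd(1), of d id] by (simp add: z_def y_def)
  have in_img: "?R q \<in> chart_img d" if "q \<in> ?U" for q
    using that cA by (auto simp: mem_rep_dom rep_def)
  have eq: "G d (?R q) (Dv ?R q a) (Dv ?R q b) = G c q a b" if q: "q \<in> ?U" for q
  proof -
    obtain x' where x': "x' \<in> chart_dom c" "x' \<in> chart_dom d" "q = chart_map c x'"
      using q by (auto simp: rep_dom_def)
    then show ?thesis
      using G_change[of c x' d a b] cA rep_at[OF cA(1) x'(1), of d id] by (simp add: charts_at_iff)
  qed
  note Gl = G_linear_left[OF cA(2)] and Gr = G_linear_right[OF cA(2)]
  have base: "((\<lambda>q. G d (?R q) e e') has_derivative (\<lambda>w. Dv (\<lambda>q. G d q e e') y (T w))) (at z)" for e e'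
    using diff_chain_at[OF DR(1) Ck_on_2_has_derivative(1)[OF G_C2[OF cA(2)] in_img[OF z]]]
    by (simp only: o_def Rz T_def)
  have 1: "((\<lambda>q. G d (?R q) (Dv ?R q a) e') has_derivative
      (\<lambda>w. Dv (\<lambda>q. G d q (T a) e') y (T w) + G d y (T2 w a) e')) (at z)" for e'
    using has_derivative_apply[OF R(2) z, where L = "\<lambda>q e. G d (?R q) e e'" and h = "\<lambda>q. Dv ?R q a",
        OF Gl[OF in_img] base DR(2)]
    by (simp add: Rz T_def T2_def)
  have 2: "((\<lambda>q. G d (?R q) (Dv ?R q a) (Dv ?R q b)) has_derivative
      (\<lambda>w. Dv (\<lambda>q. G d q (T a) (T b)) y (T w) + G d y (T2 w a) (T b) + G d y (T a) (T2 w b))) (at z)"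
    using has_derivative_apply[OF R(2) z, where L = "\<lambda>q e. G d (?R q) (Dv ?R q a) e" and h = "\<lambda>q. Dv ?R q b",
        OF Gr[OF in_img] 1 DR(2)]
    by (simp add: Rz T_def T2_def)
  have "((\<lambda>q. G c q a b) has_derivative
      (\<lambda>w. Dv (\<lambda>q. G d q (T a) (T b)) y (T w) + G d y (T2 w a) (T b) + G d y (T a) (T2 w b))) (at z)"
    by (rule has_derivative_transform_open[OF 2 R(2) z eq])
  from fun_cong[OF Dv_eqI[OF this]] show ?thesis .
qed

text \<open>The transformation law of the Christoffel symbols. In the Koszul expression, four of the six terms with
  \<open>T2\<close> cancel because \<open>T2\<close> is symmetric, and \<open>2 G(T2(a, b), T e)\<close> remains.\<close>

lemma christoffel_change:
  assumes c: "c \<in> charts_at A x" "d \<in> charts_at A x"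
  defines "z \<equiv> chart_map c x" and "y \<equiv> chart_map d x"
  defines "T \<equiv> Dv (rep c d id) z" and "T2 \<equiv> D2v (rep c d id) z"
  shows "T (christoffel A g c z a b) = T2 a b + christoffel A g d y (T a) (T b)"
proof -
  have cA: "c \<in> A" "d \<in> A" and xd: "x \<in> chart_dom c" "x \<in> chart_dom d" using c by (auto simp: charts_at_iff)
  have zi: "z \<in> chart_img c" and yi: "y \<in> chart_img d" using xd by (auto simp: z_def y_def)
  have zU: "z \<in> rep_dom c d id" using map_in_rep_dom[OF cA(1) xd(1), of id] xd by (simp add: z_def)
  note R = rep_C2[OF Ck_map_id cA]
  have sym: "T2 u v = T2 v u" for u v
    unfolding T2_def by (rule D2v_symmetric[OF R zU])
  have dG: "Dv (\<lambda>q. G c q a b) z w = Dv (\<lambda>q. G d q (T a) (T b)) y (T w) + G d y (T2 w a) (T b) + G d y (T a) (T2 w b)"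
    for a b w unfolding z_def y_def T_def T2_def by (rule Dv_G_change[OF c])
  have K: "Koszul c z a b e = Koszul d y (T a) (T b) (T e) + 2 * G d y (T2 a b) (T e)" for e
    unfolding Koszul_def dG
    using sym[of a b] sym[of a e] sym[of b e] G_sym[OF cA(2) yi] by (simp add: algebra_simps)
  show ?thesis
  proof (rule G_nondegenerate[OF cA(2) yi])
    fix e
    define e' where "e' = Dv (rep d c id) y e"
    have e: "e = T e'"
      unfolding e'_def T_def z_def y_def by (rule trans_inverse[OF c(2,1), symmetric])
    have "G d y (T (christoffel A g c z a b)) e = G c z (christoffel A g c z a b) e'"
      unfolding e using G_change[OF c] by (simp add: z_def y_def T_def)
    also have "\<dots> = G d y (T2 a b) (T e') + Koszul d y (T a) (T b) (T e') / 2"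
      by (simp add: christoffel[OF cA(1) zi] K)
    also have "\<dots> = G d y (T2 a b + christoffel A g d y (T a) (T b)) e"
      unfolding linear_add[OF G_linear_left[OF cA(2) yi]] christoffel[OF cA(2) yi] e ..
    finally show "G d y (T (christoffel A g c z a b)) e = G d y (T2 a b + christoffel A g d y (T a) (T b)) e" .
  qed
qed

text \<open>The second differential read in charts \<open>c\<close> and \<open>d\<close>; the next two lemmas say that it transforms like a tensor.\<close>

definition second_rep :: "('m \<Rightarrow> 'm) \<Rightarrow> ('m, 'e) chart \<Rightarrow> ('m, 'e) chart \<Rightarrow> 'm \<Rightarrow> 'e \<Rightarrow> 'e \<Rightarrow> 'e" where
  "second_rep f c d x a b = D2v (rep c d f) (chart_map c x) a b
     + christoffel A g d (chart_map d (f x)) (Dv (rep c d f) (chart_map c x) a) (Dv (rep c d f) (chart_map c x) b)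
     - Dv (rep c d f) (chart_map c x) (christoffel A g c (chart_map c x) a b)"

text \<open>The term \<open>D\<^sup>2S(DF a, DF b)\<close> that a change of coordinates \<open>S\<close> in the target produces in the second
  derivative is exactly the correction in the law for the Christoffel symbols of the target.\<close>

lemma second_rep_change_target:
  assumes f: "Ck_map 2 A f" and c: "c \<in> charts_at A x" and d: "d \<in> charts_at A (f x)" "d' \<in> charts_at A (f x)"
  shows "Dv (rep d d' id) (chart_map d (f x)) (second_rep f c d x a b) = second_rep f c d' x a b"
proof -
  let ?T = "Dv (rep d d' id) (chart_map d (f x))"
  have T: "linear ?T" by (rule linear_trans[OF d])
  have cA: "c \<in> A" "d \<in> A" "d' \<in> A" "x \<in> chart_dom c" "f x \<in> chart_dom d" "id (f x) \<in> chart_dom d'"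
    using c d by (auto simp: charts_at_iff)
  have rc1: "?T (Dv (rep c d f) (chart_map c x) a) = Dv (rep c d' f) (chart_map c x) a" for a
    using rep_compose(1)[OF f Ck_map_id, of c d d' x a] cA by simp
  have rc2: "D2v (rep c d' f) (chart_map c x) a b =
      D2v (rep d d' id) (chart_map d (f x)) (Dv (rep c d f) (chart_map c x) a) (Dv (rep c d f) (chart_map c x) b)
      + ?T (D2v (rep c d f) (chart_map c x) a b)"
    using rep_compose(2)[OF f Ck_map_id, of c d d' x b a] cA by simp
  show ?thesis
    unfolding second_rep_def linear_diff[OF T] linear_add[OF T] christoffel_change[OF d] rc1 rc2 by simp
qed

text \<open>Here the term \<open>DF(D\<^sup>2T(a, b))\<close> from the second derivative is compensated by the Christoffel symbols of
  the source.\<close>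

lemma second_rep_change_source:
  assumes f: "Ck_map 2 A f" and c: "c \<in> charts_at A x" "c' \<in> charts_at A x" and d: "d \<in> charts_at A (f x)"
  shows "second_rep f c' d x (Dv (rep c c' id) (chart_map c x) a) (Dv (rep c c' id) (chart_map c x) b) = second_rep f c d x a b"
proof -
  have cA: "c \<in> A" "c' \<in> A" "d \<in> A" "x \<in> chart_dom c" "id x \<in> chart_dom c'" "f (id x) \<in> chart_dom d"
    using c d by (auto simp: charts_at_iff)
  let ?T = "Dv (rep c c' id) (chart_map c x)" and ?F = "Dv (rep c' d f) (chart_map c' x)"
  have rc1: "?F (?T a) = Dv (rep c d f) (chart_map c x) a" for a
    using rep_compose(1)[OF Ck_map_id f, of c c' d x a] cA by simp
  have rc2: "D2v (rep c d f) (chart_map c x) a b =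
      D2v (rep c' d f) (chart_map c' x) (?T a) (?T b) + ?F (D2v (rep c c' id) (chart_map c x) a b)"
    using rep_compose(2)[OF Ck_map_id f, of c c' d x b a] cA by simp
  have l: "linear ?F" by (rule linear_Dv_rep[OF f c(2) d])
  have "?F (?T (christoffel A g c (chart_map c x) a b))
      = ?F (D2v (rep c c' id) (chart_map c x) a b) + ?F (christoffel A g c' (chart_map c' x) (?T a) (?T b))"
    using christoffel_change[OF c, of a b] linear_add[OF l] by simp
  then show ?thesis
    unfolding second_rep_def rc1 rc2 by simp
qed

lemma second_differential_coord:
  assumes f: "Ck_map 2 A f" and u: "u \<in> tangent_space A x" and v: "v \<in> tangent_space A x"
    and c: "c \<in> charts_at A x" and d: "d \<in> charts_at A (f x)"
  shows "second_differential A g f x u v \<in> tangent_space A (f x)"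
    and "second_differential A g f x u v d = second_rep f c d x (u c) (v c)"
proof -
  let ?c = "some_chart A x" and ?d = "some_chart A (f x)"
  have s: "?c \<in> charts_at A x" "?d \<in> charts_at A (f x)" by (rule some_chart_at)+
  have "rep ?c ?d f (chart_map ?c x) = chart_map ?d (f x)"
    using rep_at s by (auto simp: charts_at_iff)
  then have df: "second_differential A g f x u v = tv ?d (f x) (second_rep f ?c ?d x (u ?c) (v ?c))"
    by (simp add: second_differential_def second_rep_def Let_def)
  then show "second_differential A g f x u v \<in> tangent_space A (f x)" by (simp add: tv_tangent s)
  have uv: "u ?c = Dv (rep c ?c id) (chart_map c x) (u c)" "v ?c = Dv (rep c ?c id) (chart_map c x) (v c)"
    by (rule tangent_coord[OF u c s(1)], rule tangent_coord[OF v c s(1)])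
  show "second_differential A g f x u v d = second_rep f c d x (u c) (v c)"
    unfolding df tv_coord[OF d] second_rep_change_target[OF f s(1) s(2) d]
    unfolding uv by (rule second_rep_change_source[OF f c s(1) d])
qed

end

section \<open>Bounds for the derivatives of a diffeomorphism\<close>

lemma continuous_on_compact_bounded:
  fixes h :: "'a::topological_space \<Rightarrow> 'b::real_normed_vector"
  assumes "compact Z" "continuous_on Z h"
  shows "\<exists>C. \<forall>z\<in>Z. norm (h z) \<le> C"
  using compact_imp_bounded[OF compact_continuous_image[OF assms(2,1)]] by (auto simp: bounded_iff)

context riemannian
begin

lemma G_bounded:
  assumes c: "c \<in> A" and Z: "compact Z" "Z \<subseteq> chart_img c"
  shows "\<exists>C\<ge>0. \<forall>z\<in>Z. \<forall>a b. \<bar>G c z a b\<bar> \<le> C * norm a * norm b"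
proof -
  have cont: "\<exists>C. \<forall>z\<in>Z. norm (G c z i j) \<le> C" for i j
    by (rule continuous_on_compact_bounded[OF Z(1)])
      (rule continuous_on_subset[OF Ck_on_2_continuous(1)[OF G_C2[OF c]] Z(2)])
  have 1: "\<exists>C\<ge>0. \<forall>z\<in>Z. \<forall>a. norm (G c z a j) \<le> C * 1 * norm a" for j
    by (rule linear_bound_on_basis[where B = "\<lambda>z a. G c z a j" and r = "\<lambda>_. 1"])
      (use cont Z(2) G_linear_left[OF c] in auto)
  have "\<exists>C\<ge>0. \<forall>w\<in>Z \<times> UNIV. \<forall>b. norm (G c (fst w) (snd w) b) \<le> C * norm (snd w) * norm b"
    by (rule linear_bound_on_basis[where B = "\<lambda>w b. G c (fst w) (snd w) b" and r = "\<lambda>w. norm (snd w)"])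
      (use 1 Z(2) G_linear_right[OF c] in \<open>auto, metis\<close>)
  then show ?thesis by force
qed

text \<open>The lower bound is the minimum of the continuous positive function \<open>(z, a) \<mapsto> G\<^sub>z(a, a)\<close> on the compact set
  \<open>Z \<times> sphere 0 1\<close>; it extends to all \<open>a\<close> by homogeneity.\<close>

lemma G_comparable:
  assumes c: "c \<in> A" and Z: "compact Z" "Z \<subseteq> chart_img c"
  shows "\<exists>m>0. \<exists>C>0. \<forall>z\<in>Z. \<forall>a. m * norm a \<le> sqrt (G c z a a) \<and> sqrt (G c z a a) \<le> C * norm a"
proof -
  obtain C where C: "C \<ge> 0" "\<And>z a b. z \<in> Z \<Longrightarrow> \<bar>G c z a b\<bar> \<le> C * norm a * norm b"
    using G_bounded[OF assms] by blast
  have upper: "sqrt (G c z a a) \<le> sqrt (C + 1) * norm a" if "z \<in> Z" for z a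
  proof -
    have "G c z a a \<le> C * norm a * norm a" using C(2)[OF that, of a a] by linarith
    also have "\<dots> \<le> (C + 1) * (norm a)\<^sup>2" by (simp add: power2_eq_square algebra_simps)
    finally have "sqrt (G c z a a) \<le> sqrt ((C + 1) * (norm a)\<^sup>2)" by (rule real_sqrt_le_mono)
    then show ?thesis by (simp add: real_sqrt_mult)
  qed
  have "\<exists>m>0. \<forall>z\<in>Z. \<forall>a\<in>sphere 0 1. m \<le> G c z a a"
  proof (cases "Z = {}")
    case True
    then show ?thesis by (auto intro: exI[of _ 1])
  next
    case False
    have "continuous_on (Z \<times> sphere 0 1) (\<lambda>w. \<Sum>i\<in>Basis. \<Sum>j\<in>Basis. (snd w \<bullet> i) * ((snd w \<bullet> j) * G c (fst w) i j))"
      by (intro continuous_intros continuous_on_compose2[OF continuous_on_subset[OF Ck_on_2_continuous(1)[OF G_C2[OF c]] Z(2)]]) auto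
    then have ct: "continuous_on (Z \<times> sphere 0 1) (\<lambda>w. G c (fst w) (snd w) (snd w))"
      by (rule continuous_on_eq) (use Z(2) in \<open>auto simp: G_expand[OF c]\<close>)
    obtain i :: 'e where "i \<in> Basis" using nonempty_Basis by blast
    then have ne: "Z \<times> sphere (0::'e) 1 \<noteq> {}" using False by (auto intro: norm_Basis)
    obtain w where w: "w \<in> Z \<times> sphere 0 1"
      "\<And>w'. w' \<in> Z \<times> sphere 0 1 \<Longrightarrow> G c (fst w) (snd w) (snd w) \<le> G c (fst w') (snd w') (snd w')"
      using continuous_attains_inf[OF compact_Times[OF Z(1) compact_sphere] ne ct] by blast
    have "0 < G c (fst w) (snd w) (snd w)"
      using w(1) Z by (intro G_pos[OF c]) auto
    then show ?thesis using w(2) by (intro exI[of _ "G c (fst w) (snd w) (snd w)"]) force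
  qed
  then obtain m where m: "m > 0" "\<And>z a. z \<in> Z \<Longrightarrow> norm a = 1 \<Longrightarrow> m \<le> G c z a a" by auto
  have lower: "sqrt m * norm a \<le> sqrt (G c z a a)" if z: "z \<in> Z" for z a
  proof (cases "a = 0")
    case True
    then show ?thesis using G_nonneg[OF c, of z a] z Z by auto
  next
    case False
    have zi: "z \<in> chart_img c" using z Z by blast
    let ?u = "(1 / norm a) *\<^sub>R a"
    have "m \<le> G c z ?u ?u" using False by (intro m z) simp
    also have "\<dots> = G c z a a / (norm a)\<^sup>2"
      using linear_scale[OF G_linear_left[OF c zi], of "1 / norm a" a ?u] linear_scale[OF G_linear_right[OF c zi], of a "1 / norm a" a]
      by (simp add: power2_eq_square)
    finally have "m * (norm a)\<^sup>2 \<le> G c z a a" using False by (simp add: field_simps)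
    from real_sqrt_le_mono[OF this] show ?thesis by (simp add: real_sqrt_mult)
  qed
  show ?thesis
    using upper lower m(1) C(1) by (intro exI[of _ "sqrt m"] conjI exI[of _ "sqrt (C + 1)"]) auto
qed

text \<open>Pairing \<open>w = \<Gamma>(a, b)\<close> with itself gives \<open>m\<^sup>2 \<parallel>w\<parallel>\<^sup>2 \<le> G(w, w) \<le> 3/2 C \<parallel>a\<parallel> \<parallel>b\<parallel> \<parallel>w\<parallel>\<close>, where \<open>C\<close> bounds the
  derivatives of the metric.\<close>

lemma christoffel_bounded:
  assumes c: "c \<in> A" and Z: "compact Z" "Z \<subseteq> chart_img c"
  shows "\<exists>C\<ge>0. \<forall>z\<in>Z. \<forall>a b. norm (christoffel A g c z a b) \<le> C * norm a * norm b"
proof -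
  let ?D = "\<lambda>z a b d. Dv (\<lambda>y. G c y b d) z a"
  have cont: "\<exists>C. \<forall>z\<in>Z. norm (?D z k i j) \<le> C" for i j k
    by (rule continuous_on_compact_bounded[OF Z(1)])
      (rule continuous_on_subset[OF Ck_on_2_continuous(2)[OF G_C2[OF c]] Z(2)])
  have 1: "\<exists>C\<ge>0. \<forall>z\<in>Z. \<forall>a. norm (?D z a i j) \<le> C * 1 * norm a" for i j
    by (rule linear_bound_on_basis[where B = "\<lambda>z a. ?D z a i j" and r = "\<lambda>_. 1"])
      (use cont Z(2) Dv_G_linear[OF c] in auto)
  have 2: "\<exists>C\<ge>0. \<forall>w\<in>Z \<times> UNIV. \<forall>b. norm (?D (fst w) (snd w) b j) \<le> C * norm (snd w) * norm b" for j
    by (rule linear_bound_on_basis[where B = "\<lambda>w b. ?D (fst w) (snd w) b j" and r = "\<lambda>w. norm (snd w)"])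
      (use 1[of _ j] Z(2) Dv_G_linear[OF c] in \<open>auto, metis\<close>)
  have "\<exists>C\<ge>0. \<forall>w\<in>(Z \<times> UNIV) \<times> UNIV. \<forall>d. norm (?D (fst (fst w)) (snd (fst w)) (snd w) d)
      \<le> C * (norm (snd (fst w)) * norm (snd w)) * norm d"
  proof (rule linear_bound_on_basis[where B = "\<lambda>w d. ?D (fst (fst w)) (snd (fst w)) (snd w) d"
        and r = "\<lambda>w. norm (snd (fst w)) * norm (snd w)"])
    fix j :: 'e
    obtain C where "\<forall>w\<in>Z \<times> UNIV. \<forall>b. norm (?D (fst w) (snd w) b j) \<le> C * norm (snd w) * norm b"
      using 2[of j] by blast
    then show "\<exists>C. \<forall>w\<in>(Z \<times> UNIV) \<times> UNIV. norm (?D (fst (fst w)) (snd (fst w)) (snd w) j)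
        \<le> C * (norm (snd (fst w)) * norm (snd w))"
      by (intro exI[of _ C]) (auto simp: mult.assoc)
  qed (use Z(2) Dv_G_linear[OF c] in auto)
  then obtain C where C: "C \<ge> 0" "\<And>w d. w \<in> (Z \<times> UNIV) \<times> UNIV \<Longrightarrow>
      norm (?D (fst (fst w)) (snd (fst w)) (snd w) d) \<le> C * (norm (snd (fst w)) * norm (snd w)) * norm d"
    by blast
  have CD: "\<bar>?D z a b d\<bar> \<le> C * (norm a * norm b) * norm d" if "z \<in> Z" for z a b d
    using C(2)[of "((z, a), b)" d] that by simp
  obtain m where m: "m > 0" "\<And>z a. z \<in> Z \<Longrightarrow> m * norm a \<le> sqrt (G c z a a)"
    using G_comparable[OF c Z] by blast
  have "norm (christoffel A g c z a b) \<le> 3 / 2 * C / m\<^sup>2 * norm a * norm b" if z: "z \<in> Z" for z a b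
  proof (cases "christoffel A g c z a b = 0")
    case True
    then show ?thesis using C(1) by simp
  next
    case False
    define w where "w = christoffel A g c z a b"
    have w: "norm w > 0" using False by (simp add: w_def)
    have zi: "z \<in> chart_img c" using z Z by blast
    have "(m * norm w)\<^sup>2 \<le> (sqrt (G c z w w))\<^sup>2"
      using m z by (intro power_mono) auto
    also have "\<dots> = G c z w w" using G_nonneg[OF c zi] by simp
    also have "\<dots> = Koszul c z a b w / 2" unfolding w_def by (rule christoffel[OF c zi])
    also have "\<dots> \<le> (3 / 2 * C * norm a * norm b) * norm w"
    proof -
      have half3: "(r + s - t) / 2 \<le> 3 / 2 * X" if "\<bar>r\<bar> \<le> X" "\<bar>s\<bar> \<le> X" "\<bar>t\<bar> \<le> X" for r s t X :: real
        using abs_le_D1[OF that(1)] abs_le_D1[OF that(2)] abs_le_D2[OF that(3)] by simp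
      have "\<bar>?D z a b w\<bar> \<le> C * norm a * norm b * norm w" "\<bar>?D z b a w\<bar> \<le> C * norm a * norm b * norm w"
        "\<bar>?D z w a b\<bar> \<le> C * norm a * norm b * norm w"
        using CD[OF z, where a = a and b = b and d = w] CD[OF z, where a = b and b = a and d = w]
          CD[OF z, where a = w and b = a and d = b] by (simp_all add: mult_ac)
      then have "Koszul c z a b w / 2 \<le> 3 / 2 * (C * norm a * norm b * norm w)"
        unfolding Koszul_def by (rule half3)
      then show ?thesis by (simp add: mult_ac)
    qed
    finally have "(m\<^sup>2 * norm w) * norm w \<le> (3 / 2 * C * norm a * norm b) * norm w"
      by (simp add: power2_eq_square mult_ac)
    then have "m\<^sup>2 * norm w \<le> 3 / 2 * C * norm a * norm b" using w by simp
    then show ?thesis using m(1) by (simp add: w_def field_simps)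
  qed
  then show ?thesis using C(1) by (intro exI[of _ "3 / 2 * C / m\<^sup>2"]) auto
qed

lemma rep_derivatives_bounded:
  assumes f: "Ck_map 2 A f" and c: "c \<in> A" "d \<in> A" and Z: "compact Z" "Z \<subseteq> rep_dom c d f"
  shows "\<exists>C\<ge>0. \<forall>z\<in>Z. \<forall>a. norm (Dv (rep c d f) z a) \<le> C * norm a"
    and "\<exists>C\<ge>0. \<forall>z\<in>Z. \<forall>a b. norm (D2v (rep c d f) z a b) \<le> C * norm a * norm b"
proof -
  note F = rep_C2[OF f c]
  have cont: "\<exists>C. \<forall>z\<in>Z. norm (Dv (rep c d f) z i) \<le> C" for i
    by (rule continuous_on_compact_bounded[OF Z(1)])
      (rule continuous_on_subset[OF Ck_on_2_continuous(2)[OF F(1)] Z(2)])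
  have "\<exists>C\<ge>0. \<forall>z\<in>Z. \<forall>a. norm (Dv (rep c d f) z a) \<le> C * 1 * norm a"
    by (rule linear_bound_on_basis[where B = "\<lambda>z a. Dv (rep c d f) z a" and r = "\<lambda>_. 1"])
      (use cont Z(2) Ck_on_2_has_derivative(3)[OF F(1)] in auto)
  then show "\<exists>C\<ge>0. \<forall>z\<in>Z. \<forall>a. norm (Dv (rep c d f) z a) \<le> C * norm a" by simp
  have cont: "\<exists>C. \<forall>z\<in>Z. norm (D2v (rep c d f) z i j) \<le> C" if ne: "Z \<noteq> {}" for i j
  proof (rule continuous_on_compact_bounded[OF Z(1)])
    obtain z where "z \<in> rep_dom c d f" using ne Z(2) by blast
    from continuous_on_subset[OF Ck_on_2D(3)[OF F(1) this] Z(2)]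
    show "continuous_on Z (\<lambda>z. D2v (rep c d f) z i j)" .
  qed
  then have cont: "\<exists>C. \<forall>z\<in>Z. norm (D2v (rep c d f) z i j) \<le> C" for i j by (cases "Z = {}") auto
  have 1: "\<exists>C\<ge>0. \<forall>z\<in>Z. \<forall>a. norm (D2v (rep c d f) z a j) \<le> C * 1 * norm a" for j
    by (rule linear_bound_on_basis[where B = "\<lambda>z a. D2v (rep c d f) z a j" and r = "\<lambda>_. 1"])
      (use cont Z(2) Ck_on_2_has_derivative(4)[OF F(1)] in auto)
  have "\<exists>C\<ge>0. \<forall>w\<in>Z \<times> UNIV. \<forall>b. norm (D2v (rep c d f) (fst w) (snd w) b) \<le> C * norm (snd w) * norm b"
    by (rule linear_bound_on_basis[where B = "\<lambda>w b. D2v (rep c d f) (fst w) (snd w) b" and r = "\<lambda>w. norm (snd w)"])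
      (use 1 Z(2) linear_D2v[OF F(1) _ F(2)] in \<open>auto, metis\<close>)
  then show "\<exists>C\<ge>0. \<forall>z\<in>Z. \<forall>a b. norm (D2v (rep c d f) z a b) \<le> C * norm a * norm b" by force
qed

text \<open>Charts \<open>c\<close>, \<open>d\<close> that remain usable near \<open>x\<close>, with the coordinates of \<open>y\<close> and \<open>f y\<close> confined to compact sets.\<close>

lemma chart_ball_image:
  assumes f: "Ck_map 2 A f" and c: "c \<in> charts_at A x" and d: "d \<in> charts_at A (f x)"
  obtains Z W U where "compact Z" "Z \<subseteq> rep_dom c d f" "compact W" "W \<subseteq> chart_img d"
    "open U" "x \<in> U" "\<And>y. y \<in> U \<Longrightarrow> c \<in> charts_at A y \<and> d \<in> charts_at A (f y) \<and> chart_map c y \<in> Z \<and> chart_map d (f y) \<in> W"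
proof -
  have cA: "c \<in> A" "d \<in> A" "x \<in> chart_dom c" "f x \<in> chart_dom d" using c d by (auto simp: charts_at_iff)
  note F = rep_C2[OF f cA(1,2)]
  obtain r where r: "r > 0" "cball (chart_map d (f x)) r \<subseteq> chart_img d"
    using open_contains_cball[of "chart_img d"] open_chart(2)[OF cA(2)] cA(4) by blast
  define S' where "S' = rep_dom c d f \<inter> rep c d f -` ball (chart_map d (f x)) r"
  have S': "open S'"
    unfolding S'_def by (rule continuous_open_preimage[OF Ck_on_2_continuous(1)[OF F(1)] F(2) open_ball])
  have "chart_map c x \<in> S'"
    using map_in_rep_dom[of c x f d] rep_at[of c x d f] cA r by (simp add: S'_def)
  then obtain s where s: "s > 0" "cball (chart_map c x) s \<subseteq> S'" using S' open_contains_cball by blast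
  define U where "U = chart_dom c \<inter> chart_map c -` ball (chart_map c x) s"
  have U: "open U"
    unfolding U_def by (rule continuous_open_preimage[OF chart_continuous(1) open_chart(1) open_ball]) (rule cA)+
  show ?thesis
  proof (rule that[of "cball (chart_map c x) s" "cball (chart_map d (f x)) r" U])
    fix y assume y: "y \<in> U"
    then have yc: "y \<in> chart_dom c" "chart_map c y \<in> cball (chart_map c x) s" by (auto simp: U_def)
    then have yS: "chart_map c y \<in> S'" using s by blast
    then have fd: "f y \<in> chart_dom d"
      using mem_rep_dom[OF cA(1)] chart_inv_map[OF cA(1) yc(1)] unfolding S'_def by auto
    have "chart_map d (f y) \<in> cball (chart_map d (f x)) r"
      using yS rep_at[OF cA(1) yc(1), of d f] unfolding S'_def by auto
    then show "c \<in> charts_at A y \<and> d \<in> charts_at A (f y) \<and> chart_map c y \<in> cball (chart_map c x) s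
        \<and> chart_map d (f y) \<in> cball (chart_map d (f x)) r"
      using yc fd cA by (simp add: charts_at_iff)
  qed (use U s r cA in \<open>auto simp: S'_def U_def\<close>)
qed

text \<open>Bounds for operator norms in a form without suprema, meaningful before their finiteness is known.\<close>

definition derivative_bound :: "('m \<Rightarrow> 'm) \<Rightarrow> 'm \<Rightarrow> real \<Rightarrow> bool" where
  "derivative_bound f x B \<longleftrightarrow> 0 \<le> B \<and>
     (\<forall>v\<in>tangent_space A x. tnorm g (f x) (differential A f x v) \<le> B * tnorm g x v) \<and>
     (\<forall>u\<in>tangent_space A x. \<forall>v\<in>tangent_space A x.
        tnorm g (f x) (second_differential A g f x u v) \<le> B * (tnorm g x u * tnorm g x v))"

lemma derivative_boundD:
  assumes "derivative_bound f x B"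
  shows "0 \<le> B" "v \<in> tangent_space A x \<Longrightarrow> tnorm g (f x) (differential A f x v) \<le> B * tnorm g x v"
    "u \<in> tangent_space A x \<Longrightarrow> v \<in> tangent_space A x \<Longrightarrow>
       tnorm g (f x) (second_differential A g f x u v) \<le> B * (tnorm g x u * tnorm g x v)"
  using assms by (auto simp only: derivative_bound_def)

lemma derivative_bound_mono:
  assumes B: "derivative_bound f x B" and le: "B \<le> B'"
  shows "derivative_bound f x B'"
  unfolding derivative_bound_def
proof (intro conjI ballI)
  show "0 \<le> B'" using derivative_boundD(1)[OF B] le by linarith
  fix v assume v: "v \<in> tangent_space A x"
  show "tnorm g (f x) (differential A f x v) \<le> B' * tnorm g x v"
    using derivative_boundD(2)[OF B v] mult_right_mono[OF le tnorm_nonneg[OF v]] by linarith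
  fix u assume u: "u \<in> tangent_space A x"
  show "tnorm g (f x) (second_differential A g f x v u) \<le> B' * (tnorm g x v * tnorm g x u)"
    using derivative_boundD(3)[OF B v u]
      mult_right_mono[OF le mult_nonneg_nonneg[OF tnorm_nonneg[OF v] tnorm_nonneg[OF u]]] by linarith
qed

lemma derivative_bound_local:
  assumes f: "Ck_map 2 A f"
  obtains U B where "open U" "x0 \<in> U" "\<And>x. x \<in> U \<Longrightarrow> derivative_bound f x B"
proof -
  let ?c = "some_chart A x0" and ?d = "some_chart A (f x0)"
  obtain Z W U where ZW: "compact Z" "Z \<subseteq> rep_dom ?c ?d f" "compact W" "W \<subseteq> chart_img ?d" "open U" "x0 \<in> U"
    and U: "\<And>y. y \<in> U \<Longrightarrow> ?c \<in> charts_at A y \<and> ?d \<in> charts_at A (f y) \<and> chart_map ?c y \<in> Z \<and> chart_map ?d (f y) \<in> W"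
    using chart_ball_image[OF f some_chart_at some_chart_at] by metis
  have cA: "?c \<in> A" "?d \<in> A" using some_chart_at by (auto simp: charts_at_iff)
  have Zi: "Z \<subseteq> chart_img ?c" using ZW(2) mem_rep_dom[OF cA(1)] by blast
  obtain m where m: "m > 0" "\<And>z a. z \<in> Z \<Longrightarrow> m * norm a \<le> sqrt (G ?c z a a)"
    using G_comparable[OF cA(1) ZW(1) Zi] by blast
  obtain C where C: "C > 0" "\<And>z a. z \<in> W \<Longrightarrow> sqrt (G ?d z a a) \<le> C * norm a"
    using G_comparable[OF cA(2) ZW(3,4)] by blast
  obtain C1 where C1: "C1 \<ge> 0" "\<And>z a. z \<in> Z \<Longrightarrow> norm (Dv (rep ?c ?d f) z a) \<le> C1 * norm a"
    using rep_derivatives_bounded(1)[OF f cA ZW(1,2)] by blast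
  obtain C2 where C2: "C2 \<ge> 0" "\<And>z a b. z \<in> Z \<Longrightarrow> norm (D2v (rep ?c ?d f) z a b) \<le> C2 * norm a * norm b"
    using rep_derivatives_bounded(2)[OF f cA ZW(1,2)] by blast
  obtain C3 where C3: "C3 \<ge> 0" "\<And>z a b. z \<in> Z \<Longrightarrow> norm (christoffel A g ?c z a b) \<le> C3 * norm a * norm b"
    using christoffel_bounded[OF cA(1) ZW(1) Zi] by blast
  obtain C4 where C4: "C4 \<ge> 0" "\<And>z a b. z \<in> W \<Longrightarrow> norm (christoffel A g ?d z a b) \<le> C4 * norm a * norm b"
    using christoffel_bounded[OF cA(2) ZW(3,4)] by blast
  define B1 where "B1 = C * C1 / m"
  define B2 where "B2 = C * (C2 + C4 * C1 * C1 + C1 * C3) / m\<^sup>2"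
  have nv: "norm (v ?c) \<le> tnorm g x v / m" if "x \<in> U" "v \<in> tangent_space A x" for x v
    using m(2)[of "chart_map ?c x" "v ?c"] U[OF that(1)] tnorm_coord[OF that(2), of ?c] m(1)
    by (simp add: field_simps)
  show ?thesis
  proof (rule that[of U "B1 + B2"])
    have B: "0 \<le> B1" "0 \<le> B2" using C C1 C2 C3 C4 m by (auto simp: B1_def B2_def intro!: divide_nonneg_nonneg mult_nonneg_nonneg add_nonneg_nonneg)
    fix x assume x: "x \<in> U"
    note Ux = U[OF x]
    let ?z = "chart_map ?c x"
    have tn: "tnorm g (f x) w \<le> C * norm (w ?d)" if "w \<in> tangent_space A (f x)" for w
      using tnorm_coord[OF that, of ?d] C(2)[of "chart_map ?d (f x)" "w ?d"] Ux by simp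
    show "derivative_bound f x (B1 + B2)"
      unfolding derivative_bound_def
    proof (intro conjI ballI)
      show "0 \<le> B1 + B2" using B by simp
      fix v assume v: "v \<in> tangent_space A x"
      note dc = differential_coord[OF f v conjunct1[OF Ux] conjunct1[OF conjunct2[OF Ux]]]
      have "tnorm g (f x) (differential A f x v) \<le> C * norm (Dv (rep ?c ?d f) ?z (v ?c))"
        using tn[OF dc(1)] dc(2) by simp
      also have "\<dots> \<le> C * (C1 * (tnorm g x v / m))"
        using C C1 nv[OF x v] Ux by (intro mult_left_mono order.trans[OF C1(2)]) auto
      also have "\<dots> = B1 * tnorm g x v" by (simp add: B1_def)
      also have "\<dots> \<le> (B1 + B2) * tnorm g x v" using B tnorm_nonneg[OF v] by (intro mult_right_mono) auto
      finally show "tnorm g (f x) (differential A f x v) \<le> (B1 + B2) * tnorm g x v" .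
    next
      fix u v assume u: "u \<in> tangent_space A x" and v: "v \<in> tangent_space A x"
      note sc = second_differential_coord[OF f u v conjunct1[OF Ux] conjunct1[OF conjunct2[OF Ux]]]
      let ?a = "u ?c" and ?b = "v ?c"
      have zZ: "?z \<in> Z" "chart_map ?d (f x) \<in> W" using Ux by auto
      have "norm (second_rep f ?c ?d x ?a ?b) \<le> norm (D2v (rep ?c ?d f) ?z ?a ?b)
          + norm (christoffel A g ?d (chart_map ?d (f x)) (Dv (rep ?c ?d f) ?z ?a) (Dv (rep ?c ?d f) ?z ?b))
          + norm (Dv (rep ?c ?d f) ?z (christoffel A g ?c ?z ?a ?b))"
        unfolding second_rep_def by (intro order.trans[OF norm_triangle_ineq4] add_right_mono norm_triangle_ineq)
      also have "\<dots> \<le> C2 * norm ?a * norm ?b + C4 * (C1 * norm ?a) * (C1 * norm ?b) + C1 * (C3 * norm ?a * norm ?b)"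
      proof (intro add_mono C2 zZ)
        show "norm (christoffel A g ?d (chart_map ?d (f x)) (Dv (rep ?c ?d f) ?z ?a) (Dv (rep ?c ?d f) ?z ?b))
            \<le> C4 * (C1 * norm ?a) * (C1 * norm ?b)"
          using C4(1) C1(1) by (intro order.trans[OF C4(2)[OF zZ(2)]] mult_mono mult_left_mono C1(2) zZ mult_nonneg_nonneg) auto
        show "norm (Dv (rep ?c ?d f) ?z (christoffel A g ?c ?z ?a ?b)) \<le> C1 * (C3 * norm ?a * norm ?b)"
          using C1(1) by (intro order.trans[OF C1(2)[OF zZ(1)]] mult_left_mono C3 zZ)
      qed
      also have "\<dots> = (C2 + C4 * C1 * C1 + C1 * C3) * (norm ?a * norm ?b)" by (simp add: algebra_simps)
      also have "\<dots> \<le> (C2 + C4 * C1 * C1 + C1 * C3) * ((tnorm g x u / m) * (tnorm g x v / m))"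
        using C1(1) C2(1) C3(1) C4(1) nv[OF x u] nv[OF x v] tnorm_nonneg[OF u] m(1)
        by (intro mult_left_mono mult_mono add_nonneg_nonneg mult_nonneg_nonneg divide_nonneg_pos) auto
      finally have n: "norm (second_rep f ?c ?d x ?a ?b)
          \<le> (C2 + C4 * C1 * C1 + C1 * C3) * ((tnorm g x u / m) * (tnorm g x v / m))" .
      have "tnorm g (f x) (second_differential A g f x u v) \<le> C * norm (second_rep f ?c ?d x ?a ?b)"
        using tn[OF sc(1)] sc(2) by simp
      also have "\<dots> \<le> C * ((C2 + C4 * C1 * C1 + C1 * C3) * ((tnorm g x u / m) * (tnorm g x v / m)))"
        using n C(1) by (intro mult_left_mono) auto
      also have "\<dots> = B2 * (tnorm g x u * tnorm g x v)" by (simp add: B2_def power2_eq_square)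
      also have "\<dots> \<le> (B1 + B2) * (tnorm g x u * tnorm g x v)"
        using B tnorm_nonneg[OF v] tnorm_nonneg[OF u] by (intro mult_right_mono) auto
      finally show "tnorm g (f x) (second_differential A g f x u v) \<le> (B1 + B2) * (tnorm g x u * tnorm g x v)" .
    qed
  qed (use ZW in auto)
qed

end

locale compact_riemannian = riemannian A g
  for A :: "('m::{t2_space, second_countable_topology}, 'e::euclidean_space) chart set" and g :: "('m, 'e) metric" +
  assumes compact: "compact (UNIV :: 'm set)"
begin

lemma derivative_bound_global:
  assumes f: "Ck_map 2 A f"
  obtains B where "\<And>x. derivative_bound f x B"
proof -
  have "\<exists>U B. open U \<and> x0 \<in> U \<and> (\<forall>x\<in>U. derivative_bound f x B)" for x0
    using derivative_bound_local[OF f, of x0] by metis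
  then obtain U B where UB: "\<And>x0. open (U x0)" "\<And>x0. x0 \<in> U x0" "\<And>x0 x. x \<in> U x0 \<Longrightarrow> derivative_bound f x (B x0)"
    by metis
  obtain D where D: "finite D" "UNIV \<subseteq> (\<Union>x\<in>D. U x)"
    by (rule compactE_image[OF compact, of UNIV U]) (use UB(1,2) in blast)+
  obtain K where K: "\<And>x0. x0 \<in> D \<Longrightarrow> B x0 \<le> K"
    using finite_family_bounded[OF D(1), of "UNIV :: unit set" "\<lambda>x _. B x"] by auto
  have "derivative_bound f x K" for x
  proof -
    obtain x0 where "x0 \<in> D" "x \<in> U x0" using D(2) by blast
    then show ?thesis by (intro derivative_bound_mono[OF UB(3)] K)
  qed
  then show ?thesis by (rule that)
qed

text \<open>The first summand of the \<open>C\<^sup>2\<close> norm, used as a Lipschitz constant of \<open>f\<close> (see \<open>pdist_image_le\<close>).\<close>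

definition Lip :: "('m \<Rightarrow> 'm) \<Rightarrow> real" where
  "Lip f = (SUP x. differential_norm A g f x)"

lemma differential_le_Lip:
  assumes f: "Ck_map 2 A f" and v: "v \<in> tangent_space A x"
  shows "tnorm g (f x) (differential A f x v) \<le> Lip f * tnorm g x v"
proof (cases "v = zero_tvec")
  case True
  obtain B where "tnorm g (f x) (differential A f x v) \<le> B * tnorm g x v"
    using derivative_bound_global[OF f] derivative_boundD(2) v by metis
  moreover have "tnorm g x v = 0"
    using tnorm_coord[OF v some_chart_at] linear_0[OF G_linear_left, of "some_chart A x" "chart_map (some_chart A x) x" 0] some_chart_at[of x]
    by (simp add: True charts_at_iff)
  ultimately show ?thesis by simp
next
  case False
  obtain B where B: "\<And>x. derivative_bound f x B" using derivative_bound_global[OF f] by metis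
  have r: "tnorm g (f x) (differential A f x v) / tnorm g x v \<le> B" if "v \<in> tangent_space A x - {zero_tvec}" for x v
    using derivative_boundD(2)[OF B, of v x] that tnorm_pos[OF that] by (simp add: divide_le_eq)
  have "tnorm g (f x) (differential A f x v) / tnorm g x v \<le> differential_norm A g f x"
    unfolding differential_norm_def using r v False by (intro cSUP_upper bdd_aboveI2[of _ _ B]) auto
  also have "\<dots> \<le> Lip f"
    unfolding Lip_def
  proof (intro cSUP_upper bdd_aboveI2[of _ _ B])
    show "differential_norm A g f x \<le> B" for x
      unfolding differential_norm_def using r tangent_nonzero by (intro cSUP_least) auto
  qed auto
  finally show ?thesis
    using tnorm_pos[of v x] v False by (simp add: divide_le_eq)
qed

text \<open>The second summand of the \<open>C\<^sup>2\<close> norm is nonnegative: being the supremum of a bounded set, it is at least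
  one of the quotients, which are all nonnegative.\<close>

lemma Lip_le_C2_norm:
  assumes f: "Ck_map 2 A f"
  shows "Lip f \<le> C2_norm A g f"
proof -
  obtain B where B: "\<And>x. derivative_bound f x B" using derivative_bound_global[OF f] by metis
  let ?S = "\<lambda>x. (tangent_space A x - {zero_tvec}) \<times> (tangent_space A x - {zero_tvec})"
  let ?q = "\<lambda>x (u, v). tnorm g (f x) (second_differential A g f x u v) / (tnorm g x u * tnorm g x v)"
  have r: "?q x w \<le> B" if w0: "w \<in> ?S x" for x w
  proof -
    obtain u v where w: "w = (u, v)" "u \<in> tangent_space A x - {zero_tvec}" "v \<in> tangent_space A x - {zero_tvec}"
      using w0 by blast
    then have "0 < tnorm g x u * tnorm g x v" using tnorm_pos by (intro mult_pos_pos) blast+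
    then show ?thesis using derivative_boundD(3)[OF B, of u x v] w by (simp add: divide_le_eq)
  qed
  have ne: "?S x \<noteq> {}" for x using tangent_nonzero by blast
  fix x :: 'm
  obtain w where w: "w \<in> ?S x" using ne by blast
  have "second_differential A g f x u v \<in> tangent_space A (f x)" if "u \<in> tangent_space A x" "v \<in> tangent_space A x" for u v
    using second_differential_coord(1)[OF f that some_chart_at some_chart_at] .
  then have "0 \<le> ?q x w" using w by (auto intro!: divide_nonneg_nonneg mult_nonneg_nonneg tnorm_nonneg)
  also have "\<dots> \<le> second_differential_norm A g f x"
    unfolding second_differential_norm_def using r w by (intro cSUP_upper bdd_aboveI2[of _ _ B]) auto
  also have "\<dots> \<le> (SUP x. second_differential_norm A g f x)"
  proof (intro cSUP_upper bdd_aboveI2[of _ _ B])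
    show "second_differential_norm A g f x \<le> B" for x
      unfolding second_differential_norm_def using r ne by (intro cSUP_least) auto
  qed auto
  finally show ?thesis by (simp add: C2_norm_def Lip_def)
qed

end

context riemannian
begin

section \<open>Truncated distances in charts\<close>

abbreviation ch :: "'m \<Rightarrow> ('m, 'e) chart" where "ch q \<equiv> some_chart A q"
abbreviation ctr :: "'m \<Rightarrow> 'e" where "ctr q \<equiv> chart_map (ch q) q"

abbreviation offset :: "'m \<Rightarrow> 'm \<Rightarrow> 'e" where "offset q x \<equiv> chart_map (ch q) x - ctr q"

text \<open>The Riemannian norm at \<open>q\<close> in the coordinates of the chart at \<open>q\<close>. Measuring the coordinate distance to \<open>q\<close>
  with this norm rather than the Euclidean one makes its infinitesimal growth under \<open>f\<close> equal to the
  quotient \<open>\<parallel>D\<^sub>qf v\<parallel> / \<parallel>v\<parallel>\<close> in the expansion hypothesis.\<close>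

definition center_norm :: "'m \<Rightarrow> 'e \<Rightarrow> real" where
  "center_norm q a = sqrt (G (ch q) (ctr q) a a)"

abbreviation direction :: "'m \<Rightarrow> 'm \<Rightarrow> 'e" where
  "direction q x \<equiv> (1 / center_norm q (offset q x)) *\<^sub>R offset q x"

lemma ch: "ch q \<in> A" "q \<in> chart_dom (ch q)" "ctr q \<in> chart_img (ch q)"
  using some_chart_at[of q] by (auto simp: charts_at_iff)

lemma center_norm_0: "center_norm q 0 = 0"
  by (simp add: center_norm_def linear_0[OF G_linear_left[OF ch(1,3)]])

lemma center_norm_nonneg: "0 \<le> center_norm q a"
  unfolding center_norm_def using G_nonneg[OF ch(1,3)] by simp

lemma center_norm_scale: "center_norm q (r *\<^sub>R a) = \<bar>r\<bar> * center_norm q a"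
  using linear_scale[OF G_linear_left[OF ch(1,3)], of q r a "r *\<^sub>R a"] linear_scale[OF G_linear_right[OF ch(1,3)], of q a r a]
  by (simp add: center_norm_def real_sqrt_mult mult.assoc[symmetric] power2_eq_square[symmetric])

lemma center_norm_comparable:
  obtains m C where "m > 0" "C > 0" "\<And>a. m * norm a \<le> center_norm q a" "\<And>a. center_norm q a \<le> C * norm a"
  using G_comparable[of "ch q" "{ctr q}"] ch[of q] unfolding center_norm_def by (auto intro: that)

lemma center_norm_eq_0: "center_norm q a = 0 \<longleftrightarrow> a = 0"
proof -
  obtain m C where m: "m > 0" "\<And>a. m * norm a \<le> center_norm q a" using center_norm_comparable by metis
  show ?thesis using m(2)[of a] m(1) center_norm_0 by (auto simp: mult_le_0_iff)
qed

lemma center_norm_continuous: "continuous_on UNIV (center_norm q)"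
  unfolding center_norm_def[abs_def] G_expand[OF ch(1,3)] by (intro continuous_intros)

lemma tnorm_tv_center: "tnorm g q (tv (ch q) q a) = center_norm q a"
  using tnorm_coord[OF tv_tangent[OF some_chart_at] some_chart_at] tv_self[OF some_chart_at]
  by (simp add: center_norm_def)

text \<open>The closed ball of radius \<open>r\<close> for \<open>center_norm q\<close> lies in the chart. Passing through a Euclidean ball that is
  also contained in the chart provides a set which is visibly convex and compact.\<close>

definition admissible :: "'m \<Rightarrow> real \<Rightarrow> bool" where
  "admissible q r \<longleftrightarrow> r > 0 \<and> (\<exists>R. (\<forall>a. center_norm q a \<le> r \<longrightarrow> norm a \<le> R) \<and> cball (ctr q) R \<subseteq> chart_img (ch q))"

lemma admissible_mono: "admissible q r \<Longrightarrow> 0 < r' \<Longrightarrow> r' \<le> r \<Longrightarrow> admissible q r'"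
  unfolding admissible_def by (meson order.trans)

lemma admissible_exists: "\<exists>r. admissible q r"
proof -
  obtain m C where m: "m > 0" "\<And>a. m * norm a \<le> center_norm q a" using center_norm_comparable by metis
  obtain R where R: "R > 0" "cball (ctr q) R \<subseteq> chart_img (ch q)"
    using open_contains_cball[of "chart_img (ch q)"] open_chart(2)[OF ch(1)] ch(3) by blast
  have "norm a \<le> R" if "center_norm q a \<le> m * R" for a
  proof -
    have "m * norm a \<le> m * R" using m(2)[of a] that by linarith
    then show ?thesis using m(1) by simp
  qed
  then have "admissible q (m * R)" unfolding admissible_def using m R by auto
  then show ?thesis ..
qed

definition pdist :: "'m \<Rightarrow> real \<Rightarrow> 'm \<Rightarrow> real" where
  "pdist q r x = (if x \<in> chart_dom (ch q) then min r (center_norm q (offset q x)) else r)"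

lemma pdist_nonneg: "0 < r \<Longrightarrow> 0 \<le> pdist q r x"
  by (simp add: pdist_def center_norm_nonneg)

lemma pdist_le: "pdist q r x \<le> r"
  by (simp add: pdist_def)

lemma pdist_lessD:
  assumes "pdist q r x < r"
  shows "x \<in> chart_dom (ch q)" "center_norm q (offset q x) = pdist q r x"
  using assms by (auto simp: pdist_def min_def split: if_splits)

lemma pdist_self: "0 < r \<Longrightarrow> pdist q r q = 0"
  by (simp add: pdist_def ch center_norm_0)

lemma pdist_eq_0: "0 < r \<Longrightarrow> pdist q r x = 0 \<longleftrightarrow> x = q"
proof
  assume r: "0 < r" and "pdist q r x = 0"
  then have x: "x \<in> chart_dom (ch q)" "center_norm q (offset q x) = 0"
    using pdist_lessD[of q r x] by auto
  then have "chart_map (ch q) x = ctr q" by (simp add: center_norm_eq_0)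
  then show "x = q" using chart_inv_map[OF ch(1) x(1)] chart_inv_map[OF ch(1,2)] by metis
qed (simp add: pdist_self)

text \<open>Outside the compact ball of radius \<open>r\<close> the function is constant, and
  inside the chart domain it is a minimum of continuous functions. These two open sets cover the manifold.\<close>

lemma pdist_continuous:
  assumes "admissible q r"
  shows "continuous_on UNIV (pdist q r)"
proof -
  let ?c = "ch q"
  obtain R where R: "\<And>a. center_norm q a \<le> r \<Longrightarrow> norm a \<le> R" "cball (ctr q) R \<subseteq> chart_img ?c" "r > 0"
    using assms unfolding admissible_def by blast
  define W where "W = {w. center_norm q (w - ctr q) \<le> r}"
  have Wsub: "W \<subseteq> cball (ctr q) R"
  proof
    fix w assume "w \<in> W"
    then have "norm (w - ctr q) \<le> R" unfolding W_def by (intro R(1)) simp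
    then show "w \<in> cball (ctr q) R" by (simp add: dist_norm norm_minus_commute)
  qed
  have cn: "continuous_on UNIV (\<lambda>w. center_norm q (w - ctr q))"
    by (rule continuous_on_compose2[OF center_norm_continuous]) (auto intro!: continuous_intros)
  have "closed W"
    unfolding W_def by (rule closed_Collect_le[OF cn]) (rule continuous_on_const)
  then have cW: "compact W"
    using Wsub by (meson bounded_cball bounded_subset compact_eq_bounded_closed)
  have "compact (chart_inv ?c ` W)"
    by (rule compact_continuous_image[OF continuous_on_subset[OF chart_continuous(2)[OF ch(1)]] cW]) (use Wsub R in blast)
  then have o2: "open (- chart_inv ?c ` W)" using compact_imp_closed by blast
  have cont1: "continuous_on (chart_dom ?c) (pdist q r)"
  proof -
    have "continuous_on (chart_dom ?c) (\<lambda>x. min r (center_norm q (chart_map ?c x - ctr q)))"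
      by (intro continuous_intros continuous_on_compose2[OF center_norm_continuous] chart_continuous ch) auto
    then show ?thesis by (rule continuous_on_eq) (simp add: pdist_def)
  qed
  have cont2: "continuous_on (- chart_inv ?c ` W) (pdist q r)"
  proof -
    have "pdist q r x = r" if x: "x \<in> - chart_inv ?c ` W" for x
    proof (rule ccontr)
      assume "pdist q r x \<noteq> r"
      then have "pdist q r x < r" using pdist_le[of q r x] by simp
      from pdist_lessD[OF this] have "x \<in> chart_dom ?c" "chart_map ?c x \<in> W"
        using \<open>pdist q r x < r\<close> by (auto simp: W_def)
      then have "x \<in> chart_inv ?c ` W" using chart_inv_map[OF ch(1)] by (metis imageI)
      with x show False by blast
    qed
    then show ?thesis by (intro continuous_on_eq[OF continuous_on_const[of _ r]]) auto
  qed
  have "chart_dom ?c \<union> - chart_inv ?c ` W = UNIV"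
    using chart_inv_dom[of _ ?c] Wsub R(2) by blast
  then show ?thesis
    using continuous_on_open_Un[OF open_chart(1)[OF ch(1)] o2 cont1 cont2] by simp
qed

lemma Dv_rep_center_le:
  assumes f: "Ck_map 2 A f" and x: "c \<in> charts_at A x" "d \<in> charts_at A (f x)"
    and m: "m > 0" "m * norm (Dv (rep c d f) (chart_map c x) a) \<le> sqrt (G d (chart_map d (f x)) (Dv (rep c d f) (chart_map c x) a) (Dv (rep c d f) (chart_map c x) a))"
    and CZ: "sqrt (G c (chart_map c x) a a) \<le> CZ * norm a"
    and L: "\<And>v. v \<in> tangent_space A x \<Longrightarrow> tnorm g (f x) (differential A f x v) \<le> L * tnorm g x v" "0 \<le> L"
  shows "norm (Dv (rep c d f) (chart_map c x) a) \<le> L * CZ / m * norm a"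
proof -
  let ?v = "tv c x a"
  note v = tv_tangent[OF x(1), of a]
  note dc = differential_coord[OF f v x]
  have "m * norm (Dv (rep c d f) (chart_map c x) a) \<le> tnorm g (f x) (differential A f x ?v)"
    using m(2) tnorm_coord[OF dc(1) x(2)] unfolding dc(2) tv_self[OF x(1)] by simp
  also have "\<dots> \<le> L * tnorm g x ?v" by (rule L(1)[OF v])
  also have "\<dots> = L * sqrt (G c (chart_map c x) a a)"
    by (simp add: tnorm_coord[OF v x(1)] tv_self[OF x(1)])
  also have "\<dots> \<le> L * (CZ * norm a)" by (intro mult_left_mono CZ L)
  finally show ?thesis using m(1) by (simp add: field_simps)
qed

end

context compact_riemannian
begin

lemma Lip_nonneg: "Ck_map 2 A f \<Longrightarrow> 0 \<le> Lip f"
proof -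
  assume f: "Ck_map 2 A f"
  fix x :: 'm
  obtain v where v: "v \<in> tangent_space A x - {zero_tvec}" using tangent_nonzero by blast
  have "0 \<le> tnorm g (f x) (differential A f x v)"
    using v by (intro tnorm_nonneg differential_coord(1)[OF f _ some_chart_at some_chart_at]) auto
  also have "\<dots> \<le> Lip f * tnorm g x v" using v by (intro differential_le_Lip[OF f]) auto
  finally show "0 \<le> Lip f" using tnorm_pos[OF v] by (simp add: zero_le_mult_iff)
qed

text \<open>The Lipschitz estimate for \<open>f\<close> in terms of truncated distances. The image of the coordinate segment from
  \<open>x0\<close> to \<open>x1\<close> has bounded speed as long as it stays in the ball around \<open>q\<close>; at the first time when its
  distance from \<open>q\<close> reaches a level \<open>l\<close>, the level is at most the bound. A map with large derivatives may throw
  \<open>x1\<close> out of the chart, which is why the distance has to be truncated. The constant depends on the charts,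
  not on \<open>f\<close>.\<close>

lemma pdist_image_le:
  assumes c: "c \<in> A" and Z: "compact Z" "convex Z" "Z \<subseteq> chart_img c" and admissible: "admissible q r"
  obtains C where "C > 0"
    "\<And>f x0 x1. Ck_map 2 A f \<Longrightarrow> x0 \<in> chart_dom c \<Longrightarrow> x1 \<in> chart_dom c \<Longrightarrow> chart_map c x0 \<in> Z \<Longrightarrow>
       chart_map c x1 \<in> Z \<Longrightarrow> f x0 = q \<Longrightarrow> pdist q r (f x1) \<le> C * Lip f * norm (chart_map c x1 - chart_map c x0)"
proof -
  let ?d = "ch q"
  obtain R where R: "\<And>a. center_norm q a \<le> r \<Longrightarrow> norm a \<le> R" "cball (ctr q) R \<subseteq> chart_img ?d" "r > 0"
    using admissible unfolding admissible_def by blast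
  obtain CZ where CZ: "CZ > 0" "\<And>z a. z \<in> Z \<Longrightarrow> sqrt (G c z a a) \<le> CZ * norm a"
    using G_comparable[OF c Z(1,3)] by blast
  obtain m where m: "m > 0" "\<And>z a. z \<in> cball (ctr q) R \<Longrightarrow> m * norm a \<le> sqrt (G ?d z a a)"
    using G_comparable[OF ch(1) compact_cball R(2)] by blast
  obtain \<beta> where b: "\<beta> > 0" "\<And>a. center_norm q a \<le> \<beta> * norm a" using center_norm_comparable by metis
  show ?thesis
  proof (rule that[of "\<beta> * (CZ / m)"])
    show "\<beta> * (CZ / m) > 0" using b CZ m by simp
    fix f x0 x1
    assume f: "Ck_map 2 A f" and x: "x0 \<in> chart_dom c" "x1 \<in> chart_dom c" "chart_map c x0 \<in> Z" "chart_map c x1 \<in> Z"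
      and q: "f x0 = q"
    define z0 z1 where "z0 = chart_map c x0" and "z1 = chart_map c x1"
    let ?e = "z1 - z0"
    define L where "L = \<beta> * (Lip f * CZ / m * norm ?e)"
    have L0: "0 \<le> L" using b CZ m Lip_nonneg[OF f] by (simp add: L_def)
    define z where "z t = z0 + t *\<^sub>R ?e" for t :: real
    have zZ: "z t \<in> Z" if "t \<in> {0..1}" for t
    proof -
      have "(1 - t) *\<^sub>R z0 + t *\<^sub>R z1 \<in> Z"
        using Z(2) x that unfolding z0_def z1_def by (intro convexD) auto
      then show ?thesis by (simp add: z_def algebra_simps)
    qed
    define k where "k t = pdist q r (f (chart_inv c (z t)))" for t
    have z01: "z 0 = z0" "z 1 = z1" by (simp_all add: z_def)
    have k0: "k 0 = 0" using R(3) by (simp add: k_def z01 z0_def chart_inv_map[OF c x(1)] q pdist_self)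
    have k1: "k 1 = pdist q r (f x1)" by (simp add: k_def z01 z1_def chart_inv_map[OF c x(2)])
    have kc: "continuous_on {0..1} k"
    proof -
      have "continuous_on {0..1} z" unfolding z_def by (intro continuous_intros)
      then have "continuous_on {0..1} (\<lambda>t. chart_inv c (z t))"
        by (rule continuous_on_compose2[OF chart_continuous(2)[OF c]]) (use zZ Z in auto)
      then have "continuous_on {0..1} (\<lambda>t. f (chart_inv c (z t)))"
        by (rule continuous_on_compose2[where t = UNIV, rotated]) (use f in \<open>auto simp: Ck_map_def\<close>)
      then show ?thesis
        unfolding k_def by (rule continuous_on_compose2[OF pdist_continuous[OF admissible]]) auto
    qed
    have "k 1 \<le> L"
    proof (rule ccontr)
      assume "\<not> k 1 \<le> L"
      (* A level strictly between L and the final value, hence below the truncation level r. *)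
      define l where "l = (L + k 1) / 2"
      have l: "L < l" "l < k 1" using \<open>\<not> k 1 \<le> L\<close> by (auto simp: l_def)
      have lr: "l < r" using l(2) pdist_le[of q r] by (simp add: k_def less_le_trans)
      let ?S = "{t\<in>{0..1}. k t = l}"
      have ivt: "\<exists>s. 0 \<le> s \<and> s \<le> t \<and> k s = l" if "t \<in> {0..1}" "l \<le> k t" for t
        using IVT'[of k 0 l t] k0 that l L0 continuous_on_subset[OF kc, of "{0..t}"] by auto
      have "?S \<noteq> {}" using ivt[of 1] l by force
      moreover have "compact ?S"
      proof -
        have "closed ?S"
          using continuous_closed_preimage[OF kc closed_atLeastAtMost closed_singleton[of l]]
          by (simp add: vimage_def Int_def)
        from compact_Int_closed[OF compact_Icc[of 0 1] this] show ?thesis by (simp add: Int_absorb1 subset_eq)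
      qed
      ultimately obtain t1 where t1: "t1 \<in> {0..1}" "k t1 = l" "\<And>t. t \<in> {0..1} \<Longrightarrow> k t = l \<Longrightarrow> t1 \<le> t"
        using compact_attains_inf[of ?S] by auto
      (* Before the first time t1 at which k equals l, the values of k stay below l. *)
      have kl: "k t \<le> l" if tt: "t \<in> {0..t1}" for t
      proof (rule ccontr)
        assume "\<not> k t \<le> l"
        then obtain s where s: "0 \<le> s" "s \<le> t" "k s = l" using ivt[of t] tt t1(1) by auto
        then have "t1 \<le> s" using t1(3)[of s] tt t1(1) by auto
        then have "s = t" using tt s by auto
        then show False using s \<open>\<not> k t \<le> l\<close> by simp
      qed
      let ?F = "rep c ?d f"
      let ?w = "\<lambda>t. ?F (z t)"
      have pt: "f (chart_inv c (z t)) \<in> chart_dom ?d" "center_norm q (?w t - ctr q) = k t" "?w t \<in> cball (ctr q) R"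
        "z t \<in> rep_dom c ?d f"
        if "t \<in> {0..t1}" for t
      proof -
        have "pdist q r (f (chart_inv c (z t))) < r" using kl[OF that] lr by (simp add: k_def)
        note p = pdist_lessD[OF this]
        show 1: "f (chart_inv c (z t)) \<in> chart_dom ?d" by (rule p)
        show 2: "center_norm q (?w t - ctr q) = k t" using p(2) by (simp add: rep_def k_def)
        have "norm (?w t - ctr q) \<le> R" using 2 kl[OF that] lr by (intro R(1)) simp
        then show "?w t \<in> cball (ctr q) R" by (simp add: dist_norm norm_minus_commute)
        have "z t \<in> chart_img c" using zZ[of t] that t1(1) Z by auto
        then show "z t \<in> rep_dom c ?d f" using 1 by (simp add: mem_rep_dom[OF c])
      qed
      note F = rep_C2[OF f c ch(1)[of q]]
      (* Up to time t1 the image curve ?w lies in the ball around q, and its speed is at most Lip f * CZ / m * norm ?e. *)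
      have der: "(?w has_derivative (\<lambda>h. h *\<^sub>R Dv ?F (z t) ?e)) (at t within {0..t1})" if "t \<in> {0..t1}" for t
      proof -
        note dF = Ck_on_2_has_derivative[OF F(1) pt(4)[OF that]]
        have "(z has_derivative (\<lambda>h. h *\<^sub>R ?e)) (at t)"
          unfolding z_def by (auto intro!: derivative_eq_intros)
        from diff_chain_at[OF this dF(1)]
        have "(?w has_derivative (\<lambda>h. Dv ?F (z t) (h *\<^sub>R ?e))) (at t)" by (simp add: o_def)
        then show ?thesis
          by (simp only: linear_scale[OF dF(3)] has_derivative_at_withinI)
      qed
      have bd: "norm (Dv ?F (z t) ?e) \<le> Lip f * CZ / m * norm ?e" if "t \<in> {0..t1}" for t
      proof -
        let ?y = "chart_inv c (z t)"
        have zi: "z t \<in> chart_img c" "z t \<in> Z" using zZ[of t] that t1(1) Z by auto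
        have y: "c \<in> charts_at A ?y" "chart_map c ?y = z t"
          using c chart_inv_dom[OF zi(1)] chart_map_inv[OF zi(1)] by (auto simp: charts_at_iff)
        have d: "?d \<in> charts_at A (f ?y)" "chart_map ?d (f ?y) = ?w t"
          using pt(1)[OF that] ch(1) by (auto simp: charts_at_iff rep_def)
        show ?thesis
          using Dv_rep_center_le[OF f y(1) d(1) m(1), of ?e CZ "Lip f"] m(2)[OF pt(3)[OF that]] CZ(2)[OF zi(2)]
            differential_le_Lip[OF f] Lip_nonneg[OF f] by (simp add: y d)
      qed
      have "norm (?w t1 - ?w 0) \<le> (Lip f * CZ / m * norm ?e) * norm (t1 - 0)"
      proof (rule differentiable_bound[OF convex_closed_interval[of 0 t1, folded cbox_interval] _ _])
        show "(?w has_derivative (\<lambda>h. h *\<^sub>R Dv ?F (z t) ?e)) (at t within cbox 0 t1)" if "t \<in> cbox 0 t1" for t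
          using der[of t] that by (simp add: cbox_interval)
        show "onorm (\<lambda>h. h *\<^sub>R Dv ?F (z t) ?e) \<le> Lip f * CZ / m * norm ?e" if "t \<in> cbox 0 t1" for t
        proof (rule onorm_le)
          fix h :: real
          have "\<bar>h\<bar> * norm (Dv ?F (z t) ?e) \<le> \<bar>h\<bar> * (Lip f * CZ / m * norm ?e)"
            using that by (intro mult_left_mono bd) (auto simp: cbox_interval)
          then show "norm (h *\<^sub>R Dv ?F (z t) ?e) \<le> Lip f * CZ / m * norm ?e * norm h"
            by (simp add: mult_ac)
        qed
      qed (use t1 in \<open>auto simp: cbox_interval\<close>)
      also have "\<dots> \<le> (Lip f * CZ / m * norm ?e) * 1"
        using t1(1) CZ m Lip_nonneg[OF f] by (intro mult_left_mono) auto
      finally have w1: "norm (?w t1 - ?w 0) \<le> Lip f * CZ / m * norm ?e" by simp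
      have w0: "?w 0 = ctr q" by (simp add: z01 z0_def rep_at[OF c x(1)] q)
      have "l = center_norm q (?w t1 - ctr q)" using pt(2)[of t1] t1 by simp
      also have "\<dots> \<le> \<beta> * norm (?w t1 - ?w 0)" using b(2) w0 by simp
      also have "\<dots> \<le> L" unfolding L_def using b(1) w1 by (intro mult_left_mono) auto
      finally show False using l by simp
    qed
    then show "pdist q r (f x1) \<le> \<beta> * (CZ / m) * Lip f * norm (chart_map c x1 - chart_map c x0)"
      by (simp add: k1 L_def z0_def z1_def mult_ac)
  qed
qed


lemma Ck_diffeoD:
  assumes "Ck_diffeo 2 A f"
  shows "Ck_map 2 A f" "Ck_map 2 A (inv f)" "bij f"
  using assms by (auto simp: Ck_diffeo_def)

lemma infinite_manifold: "infinite (UNIV :: 'm set)"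
proof
  fix q :: 'm
  assume "finite (UNIV :: 'm set)"
  then have "finite (chart_dom (ch q))" by (rule finite_subset[OF subset_UNIV])
  then have "finite (chart_img (ch q))" by (rule finite_imageI)
  from finite_imp_not_open[OF this] show False using open_chart(2)[OF ch(1), of q] ch(3)[of q] by blast
qed

text \<open>A lower bound for \<open>Lip f\<close> that holds for all diffeomorphisms. Cover the manifold by \<open>N\<close> coordinate balls and
  fix \<open>N + 1\<close> points. The preimages under \<open>f\<close> of two of these points lie in a common ball, so \<open>f\<close> spreads this ball
  over a distance bounded from below.\<close>

lemma Lip_ge:
  obtains c where "c > 0" "\<And>f. Ck_diffeo 2 A f \<Longrightarrow> c \<le> Lip f"
proof -
  have "\<exists>s>0. cball (ctr x) s \<subseteq> chart_img (ch x)" for x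
    using open_contains_cball[of "chart_img (ch x)"] open_chart(2)[OF ch(1)] ch(3) by blast
  then obtain s where s: "\<And>x. s x > 0" "\<And>x. cball (ctr x) (s x) \<subseteq> chart_img (ch x)" by metis
  define U where "U x = chart_dom (ch x) \<inter> chart_map (ch x) -` ball (ctr x) (s x)" for x
  have U: "open (U x)" for x
    unfolding U_def by (rule continuous_open_preimage[OF chart_continuous(1) open_chart(1) open_ball]) (rule ch)+
  have xU: "x \<in> U x" for x using s ch by (simp add: U_def)
  obtain D where D: "finite D" "UNIV \<subseteq> (\<Union>x\<in>D. U x)"
    by (rule compactE_image[OF compact, of UNIV U]) (use U xU in blast)+
  obtain Q :: "'m set" where Q: "finite Q" "card Q = Suc (card D)"
    using infinite_arbitrarily_large[OF infinite_manifold] by blast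
  obtain r where r: "\<And>q. admissible q (r q)" using admissible_exists by metis
  have r0: "r q > 0" for q using r[of q] by (simp add: admissible_def)
  define \<delta> where "\<delta> = Min (insert 1 ((\<lambda>(q, q'). pdist q (r q) q') ` {(q, q'). q \<in> Q \<and> q' \<in> Q \<and> q \<noteq> q'}))"
  have fin: "finite {(q, q'). q \<in> Q \<and> q' \<in> Q \<and> q \<noteq> q'}"
    by (rule finite_subset[of _ "Q \<times> Q"]) (use Q in auto)
  have pd0: "pdist q (r q) q' > 0" if "q \<noteq> q'" for q q'
    using pdist_nonneg[OF r0[of q], of q q'] pdist_eq_0[OF r0[of q], of q q'] that by (auto simp: order_le_less)
  have d0: "\<delta> > 0" unfolding \<delta>_def using fin pd0 by (subst Min_gr_iff) auto
  have dle: "\<delta> \<le> pdist q (r q) q'" if "q \<in> Q" "q' \<in> Q" "q \<noteq> q'" for q q'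
    unfolding \<delta>_def using fin that by (intro Min_le) auto
  have "\<exists>C>0. \<forall>f x0 x1. Ck_map 2 A f \<longrightarrow> x0 \<in> U x \<longrightarrow> x1 \<in> U x \<longrightarrow> f x0 = q \<longrightarrow> pdist q (r q) (f x1) \<le> C * Lip f" for x q
  proof -
    obtain C where C: "C > 0" "\<And>f x0 x1. Ck_map 2 A f \<Longrightarrow> x0 \<in> chart_dom (ch x) \<Longrightarrow> x1 \<in> chart_dom (ch x) \<Longrightarrow>
        chart_map (ch x) x0 \<in> cball (ctr x) (s x) \<Longrightarrow> chart_map (ch x) x1 \<in> cball (ctr x) (s x) \<Longrightarrow> f x0 = q \<Longrightarrow>
        pdist q (r q) (f x1) \<le> C * Lip f * norm (chart_map (ch x) x1 - chart_map (ch x) x0)"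
      using pdist_image_le[OF ch(1) compact_cball convex_cball s(2) r] by metis
    have "pdist q (r q) (f x1) \<le> C * (2 * s x) * Lip f"
      if f: "Ck_map 2 A f" and x: "x0 \<in> U x" "x1 \<in> U x" and q: "f x0 = q" for f x0 x1
    proof -
      have "pdist q (r q) (f x1) \<le> C * Lip f * norm (chart_map (ch x) x1 - chart_map (ch x) x0)"
        using x q by (intro C(2) f) (auto simp: U_def)
      also have "\<dots> \<le> C * Lip f * (2 * s x)"
      proof (intro mult_left_mono)
        have "dist (chart_map (ch x) x1) (chart_map (ch x) x0) \<le> dist (ctr x) (chart_map (ch x) x1) + dist (ctr x) (chart_map (ch x) x0)"
          by (rule dist_triangle3)
        then show "norm (chart_map (ch x) x1 - chart_map (ch x) x0) \<le> 2 * s x"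
          using x by (simp add: U_def dist_norm)
      qed (use C Lip_nonneg[OF f] in auto)
      finally show ?thesis by (simp add: mult_ac)
    qed
    then show ?thesis using C(1) s(1)[of x] by (intro exI[of _ "C * (2 * s x)"]) auto
  qed
  then obtain C where C: "\<And>x q. C x q > 0" "\<And>x q f x0 x1. Ck_map 2 A f \<Longrightarrow> x0 \<in> U x \<Longrightarrow> x1 \<in> U x \<Longrightarrow> f x0 = q \<Longrightarrow>
      pdist q (r q) (f x1) \<le> C x q * Lip f"
    by metis
  obtain K where K1: "1 \<le> K" and K: "\<And>x q. x \<in> D \<Longrightarrow> q \<in> Q \<Longrightarrow> C x q \<le> K"
    using finite_family_bounded[OF D(1) Q(1)] by metis
  have K0: "K > 0" using K1 by simp
  show ?thesis
  proof (rule that[of "\<delta> / K"])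
    show "\<delta> / K > 0" using d0 K0 by simp
    fix f assume f: "Ck_diffeo 2 A f"
    note f' = Ck_diffeoD[OF f]
    have "\<exists>x\<in>D. inv f q \<in> U x" for q using D(2) by blast
    then obtain h where h: "\<And>q. h q \<in> D" "\<And>q. inv f q \<in> U (h q)" by metis
    have "card (h ` Q) \<le> card D" using h D by (intro card_mono) auto
    then have "\<not> inj_on h Q" using Q by (intro pigeonhole) simp
    then obtain q q' where q: "q \<in> Q" "q' \<in> Q" "q \<noteq> q'" "h q = h q'" by (auto simp: inj_on_def)
    have inv: "f (inv f y) = y" for y using f'(3) by (simp add: bij_is_surj surj_f_inv_f)
    have "\<delta> \<le> pdist q (r q) (f (inv f q'))" using dle q by (simp add: inv)
    also have "\<dots> \<le> C (h q) q * Lip f"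
      using h(2)[of q] h(2)[of q'] q by (intro C(2)[OF f'(1), of "inv f q"]) (simp_all add: inv)
    also have "\<dots> \<le> K * Lip f" using K h q Lip_nonneg[OF f'(1)] by (intro mult_right_mono) auto
    finally show "\<delta> / K \<le> Lip f" using K0 by (simp add: field_simps)
  qed
qed

section \<open>The distance to a finite set\<close>

text \<open>Truncation makes this a minimum of continuous functions on the whole manifold. Close to a point of \<open>F\<close> it
  is the Riemannian norm of the coordinate difference.\<close>

definition pdist_set :: "'m set \<Rightarrow> real \<Rightarrow> 'm \<Rightarrow> real" where
  "pdist_set F r x = Min ((\<lambda>q. pdist q r x) ` F)"

lemma continuous_on_Min_image:
  fixes h :: "'i \<Rightarrow> 'a::topological_space \<Rightarrow> real"
  assumes "finite F" "F \<noteq> {}" "\<And>q. q \<in> F \<Longrightarrow> continuous_on S (h q)"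
  shows "continuous_on S (\<lambda>x. Min ((\<lambda>q. h q x) ` F))"
  using assms
proof (induction rule: finite_ne_induct)
  case (insert q F)
  then have "continuous_on S (\<lambda>x. min (h q x) (Min ((\<lambda>q. h q x) ` F)))"
    by (intro continuous_on_min) auto
  then show ?case using insert by simp
qed simp

end

locale finite_invariant_set = compact_riemannian A g
  for A :: "('m::{t2_space, second_countable_topology}, 'e::euclidean_space) chart set" and g :: "('m, 'e) metric" +
  fixes F :: "'m set" and r :: real
  assumes finite_F: "finite F" and F_ne: "F \<noteq> {}" and admissible_F: "\<And>q. q \<in> F \<Longrightarrow> admissible q r" and r_pos: "0 < r"
begin

abbreviation dist_F :: "'m \<Rightarrow> real" where "dist_F \<equiv> pdist_set F r"

lemma dist_F_continuous: "continuous_on UNIV dist_F"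
  unfolding pdist_set_def using finite_F F_ne pdist_continuous[OF admissible_F] by (intro continuous_on_Min_image) auto

lemma dist_F_attained: "\<exists>q\<in>F. dist_F x = pdist q r x"
proof -
  have "Min ((\<lambda>q. pdist q r x) ` F) \<in> (\<lambda>q. pdist q r x) ` F"
    using finite_F F_ne by (intro Min_in) auto
  then show ?thesis unfolding pdist_set_def by blast
qed

lemma dist_F_le: "q \<in> F \<Longrightarrow> dist_F x \<le> pdist q r x"
  unfolding pdist_set_def using finite_F by (intro Min_le) auto

lemma dist_F_le_r: "dist_F x \<le> r"
  using dist_F_attained[of x] pdist_le by metis

lemma dist_F_nonneg: "0 \<le> dist_F x"
  using dist_F_attained[of x] pdist_nonneg[OF r_pos] by metis

lemma dist_F_eq_0: "dist_F x = 0 \<longleftrightarrow> x \<in> F"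
proof
  assume "dist_F x = 0"
  then show "x \<in> F" using dist_F_attained[of x] pdist_eq_0[OF r_pos] by metis
next
  assume "x \<in> F"
  then show "dist_F x = 0" using dist_F_le[of x x] pdist_self[OF r_pos] dist_F_nonneg[of x] by simp
qed

lemma dist_F_pos: "x \<notin> F \<Longrightarrow> 0 < dist_F x"
  using dist_F_eq_0 dist_F_nonneg by (metis less_eq_real_def)

text \<open>The Lipschitz estimate, applied to segments in the charts at the points of \<open>F\<close>. The factor \<open>max 1 (Lip f)\<close>
  covers the points whose distance is truncated.\<close>

lemma dist_F_image_le:
  obtains C where "C \<ge> 1"
    "\<And>f x. Ck_map 2 A f \<Longrightarrow> f ` F \<subseteq> F \<Longrightarrow> dist_F (f x) \<le> C * max 1 (Lip f) * dist_F x"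
proof -
  have "\<exists>C>0. \<forall>f x. Ck_map 2 A f \<longrightarrow> f q = q' \<longrightarrow> pdist q r x < r \<longrightarrow> pdist q' r (f x) \<le> C * Lip f * pdist q r x"
    if q: "q \<in> F" "q' \<in> F" for q q'
  proof -
    obtain R where R: "\<And>a. center_norm q a \<le> r \<Longrightarrow> norm a \<le> R" "cball (ctr q) R \<subseteq> chart_img (ch q)"
      using admissible_F[OF q(1)] unfolding admissible_def by blast
    obtain C where C: "C > 0" "\<And>f x0 x1. Ck_map 2 A f \<Longrightarrow> x0 \<in> chart_dom (ch q) \<Longrightarrow> x1 \<in> chart_dom (ch q) \<Longrightarrow>
        chart_map (ch q) x0 \<in> cball (ctr q) R \<Longrightarrow> chart_map (ch q) x1 \<in> cball (ctr q) R \<Longrightarrow> f x0 = q' \<Longrightarrow>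
        pdist q' r (f x1) \<le> C * Lip f * norm (chart_map (ch q) x1 - chart_map (ch q) x0)"
      using pdist_image_le[OF ch(1) compact_cball convex_cball R(2) admissible_F[OF q(2)]] by metis
    obtain m where m: "m > 0" "\<And>a. m * norm a \<le> center_norm q a" using center_norm_comparable by metis
    have R0: "0 \<le> R" using R(1)[of 0] center_norm_0 r_pos by simp
    have "pdist q' r (f x) \<le> C / m * Lip f * pdist q r x" if f: "Ck_map 2 A f" "f q = q'" and x: "pdist q r x < r" for f x
    proof -
      note p = pdist_lessD[OF x]
      have "norm (offset q x) \<le> R" using p(2) x by (intro R(1)) simp
      then have "pdist q' r (f x) \<le> C * Lip f * norm (offset q x)"
        using f p ch[of q] R0 by (intro C(2)) (auto simp: dist_norm norm_minus_commute)
      also have "\<dots> \<le> C * Lip f * (pdist q r x / m)"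
        using m(2)[of "offset q x"] p(2) m(1) C(1) Lip_nonneg[OF f(1)]
        by (intro mult_left_mono) (auto simp: field_simps)
      finally show ?thesis by simp
    qed
    then show ?thesis using C(1) m(1) by (intro exI[of _ "C / m"]) auto
  qed
  then obtain C where C: "\<And>q q'. q \<in> F \<Longrightarrow> q' \<in> F \<Longrightarrow> C q q' > 0"
    "\<And>q q' f x. q \<in> F \<Longrightarrow> q' \<in> F \<Longrightarrow> Ck_map 2 A f \<Longrightarrow> f q = q' \<Longrightarrow> pdist q r x < r \<Longrightarrow> pdist q' r (f x) \<le> C q q' * Lip f * pdist q r x"
    by metis
  obtain K where K1: "1 \<le> K" and K: "\<And>q q'. q \<in> F \<Longrightarrow> q' \<in> F \<Longrightarrow> C q q' \<le> K"
    using finite_family_bounded[OF finite_F finite_F] by metis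
  show ?thesis
  proof (rule that[OF K1])
    fix f x assume f: "Ck_map 2 A f" "f ` F \<subseteq> F"
    obtain q where q: "q \<in> F" "dist_F x = pdist q r x" using dist_F_attained by blast
    have fq: "f q \<in> F" using f q by blast
    have KL: "1 * 1 \<le> K * max 1 (Lip f)" using K1 by (intro mult_mono) auto
    show "dist_F (f x) \<le> K * max 1 (Lip f) * dist_F x"
    proof (cases "pdist q r x < r")
      case True
      have "dist_F (f x) \<le> pdist (f q) r (f x)" by (rule dist_F_le[OF fq])
      also have "\<dots> \<le> C q (f q) * Lip f * pdist q r x" by (rule C(2)[OF q(1) fq f(1) refl True])
      also have "\<dots> \<le> K * max 1 (Lip f) * pdist q r x"
        using K[OF q(1) fq] C(1)[OF q(1) fq] K1 Lip_nonneg[OF f(1)] pdist_nonneg[OF r_pos]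
        by (intro mult_right_mono mult_mono) auto
      finally show ?thesis using q by simp
    next
      case False
      then have "dist_F x = r" using q pdist_le[of q r x] by simp
      have "dist_F (f x) \<le> 1 * r" using dist_F_le_r by simp
      also have "\<dots> \<le> K * max 1 (Lip f) * r" using KL r_pos by (intro mult_right_mono) auto
      finally show ?thesis unfolding \<open>dist_F x = r\<close> .
    qed
  qed
qed

end

section \<open>Random compositions\<close>

locale random_maps = sequence_space \<nu>
  for \<nu> :: "('m::{t2_space, second_countable_topology} \<Rightarrow> 'm) measure" +
  assumes eval_measurable: "(\<lambda>f. f x) \<in> measurable \<nu> borel"
    and comp_measurable: "(\<lambda>(f, h). f \<circ> h) \<in> measurable (\<nu> \<Otimes>\<^sub>M \<nu>) \<nu>"
    and id_in_space: "id \<in> space \<nu>"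
begin

lemma comp_measurable'[measurable (raw)]:
  assumes "a \<in> measurable N \<nu>" "b \<in> measurable N \<nu>"
  shows "(\<lambda>t. a t \<circ> b t) \<in> measurable N \<nu>"
  using measurable_compose[OF measurable_Pair[OF assms] comp_measurable] by simp

lemma random_iterate_measurable[measurable]: "(\<lambda>\<omega>. random_iterate \<omega> n) \<in> measurable S \<nu>"
proof (induction n)
  case 0
  show ?case using id_in_space by (simp add: measurable_const del: id_apply eq_id_iff) 
next
  case (Suc n)
  show ?case
    unfolding random_iterate.simps by (rule comp_measurable'[OF _ Suc]) simp
qed

lemma random_iterate_in_space: "\<omega> \<in> space S \<Longrightarrow> random_iterate \<omega> n \<in> space \<nu>"
  by (rule measurable_space[OF random_iterate_measurable])

lemma orbit_measurable: "(\<lambda>\<omega>. random_iterate \<omega> n y) \<in> measurable S borel"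
  by (rule measurable_compose[OF random_iterate_measurable eval_measurable])

lemma random_iterate_case_nat: "random_iterate (case_nat s \<omega>) (Suc n) = random_iterate \<omega> n \<circ> s"
  by (induction n) (auto simp: fun_eq_iff)

lemma random_iterate_comb_seq_le: "k \<le> n \<Longrightarrow> random_iterate (comb_seq n \<omega> \<omega>') k = random_iterate \<omega> k"
  by (induction k) (auto simp: comb_seq_less)

lemma random_iterate_comb_seq_add:
  "random_iterate (comb_seq n \<omega> \<omega>') (n + m) = random_iterate \<omega>' m \<circ> random_iterate \<omega> n"
  by (induction m) (simp_all add: random_iterate_comb_seq_le comb_seq_add[of n _ _ m for m] comp_assoc add.commute)

text \<open>The Markov property at time 1: the maps applied after \<open>f\<^sub>0\<close> are independent of \<open>f\<^sub>0\<close> and have the original law,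
  so conditioning on \<open>f\<^sub>0\<close> moves the starting point to \<open>f\<^sub>0 y\<close>.\<close>

lemma first_step:
  fixes u :: "'m \<Rightarrow> ennreal"
  assumes u: "(\<lambda>f. u (f y)) \<in> borel_measurable \<nu>"
  shows "(\<integral>\<^sup>+\<omega>. u (random_iterate \<omega> (Suc n) y) \<partial>S) = (\<integral>\<^sup>+f. \<integral>\<^sup>+\<omega>. u (random_iterate \<omega> n (f y)) \<partial>S \<partial>\<nu>)"
proof -
  note [measurable] = u
  have m: "(\<lambda>\<omega>. u (random_iterate \<omega> k y)) \<in> borel_measurable S" for k
    by (rule measurable_compose[OF random_iterate_measurable u])
  have m2: "(\<lambda>x. u ((random_iterate (snd x) n \<circ> fst x) y)) \<in> borel_measurable (\<nu> \<Otimes>\<^sub>M S)"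
    by (rule measurable_compose[OF _ u]) measurable
  have "(\<integral>\<^sup>+\<omega>. u (random_iterate \<omega> (Suc n) y) \<partial>S)
      = (\<integral>\<^sup>+\<omega>. u (random_iterate \<omega> (Suc n) y) \<partial>distr (\<nu> \<Otimes>\<^sub>M S) S (\<lambda>(s, \<omega>). case_nat s \<omega>))"
    by (simp only: PiM_iter)
  also have "\<dots> = (\<integral>\<^sup>+x. u (random_iterate (case_nat (fst x) (snd x)) (Suc n) y) \<partial>(\<nu> \<Otimes>\<^sub>M S))"
    by (subst nn_integral_distr) (use m[of "Suc n"] in \<open>auto simp: split_beta' simp del: random_iterate.simps\<close>)
  also have "\<dots> = (\<integral>\<^sup>+x. u ((random_iterate (snd x) n \<circ> fst x) y) \<partial>(\<nu> \<Otimes>\<^sub>M S))"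
    by (simp only: random_iterate_case_nat)
  also have "\<dots> = (\<integral>\<^sup>+f. \<integral>\<^sup>+\<omega>. u (random_iterate \<omega> n (f y)) \<partial>S \<partial>\<nu>)"
    using P.nn_integral_fst[OF m2] by simp
  finally show ?thesis .
qed

text \<open>Links the convolution powers, in which the new factor is applied last, to the random compositions. Cutting
  the sequence at time \<open>n\<close> exhibits the last map as independent of the previous ones.\<close>

lemma conv_power_eq_distr: "conv_power \<nu> n = distr S \<nu> (\<lambda>\<omega>. random_iterate \<omega> n)"
proof (induction n)
  case 0
  show ?case using P.distr_const[OF id_in_space] by (simp only: random_iterate.simps conv_power.simps)
next
  case (Suc n)
  have pr: "prob_space (distr S \<nu> (\<lambda>\<omega>. random_iterate \<omega> n))"
    by (rule P.prob_space_distr) simp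
  have sf: "sigma_finite_measure (distr S \<nu> (\<lambda>\<omega>. random_iterate \<omega> n))"
    using pr by (simp add: prob_space_imp_sigma_finite)
  have nu: "\<nu> = distr S \<nu> (\<lambda>\<omega>. \<omega> 0)"
    using PiM_component[of 0] by simp
  interpret SS: pair_sigma_finite S S ..
  have m2: "(\<lambda>x. (snd x 0) \<circ> random_iterate (fst x) n) \<in> measurable (S \<Otimes>\<^sub>M S) \<nu>"
    by (rule comp_measurable') simp_all
  have "distr S \<nu> (\<lambda>\<omega>. random_iterate \<omega> (Suc n))
     = distr (distr (S \<Otimes>\<^sub>M S) S (\<lambda>(\<omega>, \<omega>'). comb_seq n \<omega> \<omega>')) \<nu> (\<lambda>\<omega>. random_iterate \<omega> (Suc n))"
    by (simp only: PiM_comb_seq)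
  also have "\<dots> = distr (S \<Otimes>\<^sub>M S) \<nu> (\<lambda>x. random_iterate (comb_seq n (fst x) (snd x)) (Suc n))"
    by (subst distr_distr) (auto simp: comp_def split_beta' simp del: random_iterate.simps)
  also have "\<dots> = distr (S \<Otimes>\<^sub>M S) \<nu> (\<lambda>x. (snd x 0) \<circ> random_iterate (fst x) n)"
    using random_iterate_comb_seq_add[of n _ _ 1]
    by (intro distr_cong refl) (simp add: random_iterate_comb_seq_le comb_seq_def)
  also have "\<dots> = distr (distr (S \<Otimes>\<^sub>M S) (S \<Otimes>\<^sub>M S) (\<lambda>(x, y). (y, x))) \<nu> (\<lambda>x. (snd x 0) \<circ> random_iterate (fst x) n)"
    by (simp only: SS.distr_pair_swap[symmetric])
  also have "\<dots> = distr (S \<Otimes>\<^sub>M S) \<nu> (\<lambda>x. (fst x 0) \<circ> random_iterate (snd x) n)"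
    by (subst distr_distr[OF m2]) (auto simp: comp_def split_beta')
  also have "\<dots> = distr (distr (S \<Otimes>\<^sub>M S) (\<nu> \<Otimes>\<^sub>M \<nu>) (\<lambda>(\<omega>, \<omega>'). (\<omega> 0, random_iterate \<omega>' n))) \<nu> (\<lambda>(f, h). f \<circ> h)"
    by (subst distr_distr[OF comp_measurable]) (auto simp: comp_def split_beta')
  also have "distr (S \<Otimes>\<^sub>M S) (\<nu> \<Otimes>\<^sub>M \<nu>) (\<lambda>(\<omega>, \<omega>'). (\<omega> 0, random_iterate \<omega>' n))
     = distr S \<nu> (\<lambda>\<omega>. \<omega> 0) \<Otimes>\<^sub>M distr S \<nu> (\<lambda>\<omega>. random_iterate \<omega> n)"
    by (rule pair_measure_distr[symmetric, OF _ _ sf]) auto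
  finally show ?case
    by (simp only: conv_power.simps Suc nu[symmetric])
qed

lemma measure_conv_dirac:
  assumes "K \<in> sets borel"
  shows "measure (conv_dirac (conv_power \<nu> n) y) K = measure S {\<omega>\<in>space S. random_iterate \<omega> n y \<in> K}"
proof -
  have "conv_dirac (conv_power \<nu> n) y = distr S borel (\<lambda>\<omega>. random_iterate \<omega> n y)"
    unfolding conv_dirac_def conv_power_eq_distr
    by (subst distr_distr[OF eval_measurable random_iterate_measurable]) (simp add: comp_def)
  then show ?thesis
    by (simp add: measure_distr[OF orbit_measurable assms] vimage_def Int_def conj_commute)
qed


end

section \<open>Inequalities for powers\<close>

lemma powr_add_le:
  fixes a b p :: real
  assumes "0 \<le> a" "0 \<le> b" "0 \<le> p"
  shows "(a + b) powr p \<le> 2 powr p * (a powr p + b powr p)"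
proof -
  have "(a + b) powr p \<le> (2 * max a b) powr p" using assms by (intro powr_mono2) auto
  also have "\<dots> = 2 powr p * max a b powr p" using assms by (simp add: powr_mult)
  also have "\<dots> \<le> 2 powr p * (a powr p + b powr p)"
    by (intro mult_left_mono) (auto simp: max_def)
  finally show ?thesis .
qed

lemma powr_add_le_add_powr:
  fixes a b s :: real
  assumes "0 \<le> a" "0 \<le> b" "0 < s" "s \<le> 1"
  shows "(a + b) powr s \<le> a powr s + b powr s"
proof (cases "a + b = 0")
  case False
  have *: "x / (a + b) \<le> (x / (a + b)) powr s" if "0 \<le> x" "x \<le> a + b" for x
    using powr_mono'[of s 1 "x / (a + b)"] that assms False by (simp add: divide_le_eq_1 powr_one)
  have "1 = a / (a + b) + b / (a + b)"
    using False by (simp add: add_divide_distrib[symmetric])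
  also have "\<dots> \<le> (a / (a + b)) powr s + (b / (a + b)) powr s"
    by (intro add_mono *) (use assms in auto)
  also have "\<dots> = (a powr s + b powr s) / (a + b) powr s"
    using assms by (simp add: powr_divide add_divide_distrib)
  finally show ?thesis
    using False assms by (simp add: field_simps)
qed (use assms in auto)

text \<open>The graph of a power with exponent \<open>p > 1\<close> lies above its tangents. This is Young's inequality for \<open>b\<close> and
  \<open>a\<^sup>p\<^sup>-\<^sup>1\<close>, and it includes the boundary case \<open>a = 0\<close>.\<close>

lemma powr_tangent_le:
  fixes a b p :: real
  assumes "0 \<le> a" "0 \<le> b" "1 < p"
  shows "a powr p + p * a powr (p - 1) * (b - a) \<le> b powr p"
proof -
  define q where "q = p / (p - 1)"
  have q: "q > 1" "1 / p + 1 / q = 1"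
    using assms by (auto simp: q_def field_simps)
  have "b * a powr (p - 1) \<le> b powr p / p + (a powr (p - 1)) powr q / q"
    using assms q by (intro Youngs_inequality) auto
  also have "(a powr (p - 1)) powr q = a powr p"
    using assms by (simp add: powr_powr q_def)
  finally have "p * (b * a powr (p - 1)) \<le> p * (b powr p / p + a powr p / q)"
    using assms by (intro mult_left_mono) auto
  also have "\<dots> = b powr p + (p - 1) * a powr p"
    using assms by (simp add: q_def field_simps)
  finally have "p * (b * a powr (p - 1)) \<le> b powr p + (p - 1) * a powr p" .
  moreover have "a powr (p - 1) * a = a powr p"
    using assms by (cases "a = 0") (auto simp: powr_diff)
  ultimately show ?thesis
    by (simp add: algebra_simps)
qed

text \<open>The tangent inequality at \<open>x + h\<close> involves the slope \<open>(x + h)\<^sup>p\<^sup>-\<^sup>1\<close>; for \<open>p \<le> 2\<close> the power \<open>p - 1\<close> is subadditive, so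
  replacing the slope by \<open>x\<^sup>p\<^sup>-\<^sup>1\<close> costs at most \<open>\<bar>h\<bar>\<^sup>p\<^sup>-\<^sup>1\<close>.\<close>

lemma powr_add_le_taylor:
  fixes x h p :: real
  assumes "0 \<le> x" "0 \<le> x + h" "1 < p" "p \<le> 2"
  shows "(x + h) powr p \<le> x powr p + p * x powr (p - 1) * h + p * \<bar>h\<bar> powr p"
proof -
  have hp: "\<bar>h\<bar> powr (p - 1) * \<bar>h\<bar> = \<bar>h\<bar> powr p"
    by (cases "h = 0") (auto simp: powr_diff)
  have t: "(x + h) powr p \<le> x powr p + p * ((x + h) powr (p - 1) * h)"
    using powr_tangent_le[of "x + h" x p] assms by (simp add: algebra_simps)
  have "(x + h) powr (p - 1) * h \<le> x powr (p - 1) * h + \<bar>h\<bar> powr (p - 1) * \<bar>h\<bar>"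
  proof (cases "h \<ge> 0")
    case True
    then have "(x + h) powr (p - 1) \<le> x powr (p - 1) + h powr (p - 1)"
      using assms by (intro powr_add_le_add_powr) auto
    from mult_right_mono[OF this True] show ?thesis
      using True by (simp add: algebra_simps)
  next
    case False
    then have "((x + h) + (- h)) powr (p - 1) \<le> (x + h) powr (p - 1) + (- h) powr (p - 1)"
      using assms by (intro powr_add_le_add_powr) auto
    then have "x powr (p - 1) - (- h) powr (p - 1) \<le> (x + h) powr (p - 1)" by simp
    from mult_right_mono_neg[OF this, of h] show ?thesis
      using False by (simp add: algebra_simps)
  qed
  then have "p * ((x + h) powr (p - 1) * h) \<le> p * (x powr (p - 1) * h + \<bar>h\<bar> powr p)"
    using assms hp by (intro mult_left_mono) auto
  with t show ?thesis by (simp add: algebra_simps)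
qed

lemma (in prob_space) integrable_of_powr:
  fixes \<xi> :: "'a \<Rightarrow> real"
  assumes "\<xi> \<in> borel_measurable M" "integrable M (\<lambda>f. \<bar>\<xi> f\<bar> powr p)" "0 < q" "q \<le> p"
  shows "integrable M (\<lambda>f. \<bar>\<xi> f\<bar> powr q)"
proof (rule Bochner_Integration.integrable_bound)
  show "integrable M (\<lambda>f. 1 + \<bar>\<xi> f\<bar> powr p)" using assms by simp
  show "(\<lambda>f. \<bar>\<xi> f\<bar> powr q) \<in> borel_measurable M" using assms by simp
  have "t powr q \<le> 1 + t powr p" if "t \<ge> 0" for t :: real
  proof (cases "t \<ge> 1")
    case True
    then show ?thesis using powr_mono[of q p t] assms by simp
  next
    case False
    then have "t powr q \<le> 1 powr q" using that assms by (intro powr_mono2) auto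
    then show ?thesis by (simp add: add_increasing2)
  qed
  then show "AE x in M. norm (\<bar>\<xi> x\<bar> powr q) \<le> norm (1 + \<bar>\<xi> x\<bar> powr p)"
    by (auto simp: abs_of_nonneg)
qed

text \<open>From a drift to the drift of a power. Where \<open>x > R\<close>, the linear term of the expansion above contributes
  \<open>- c p x\<^sup>p\<^sup>-\<^sup>1\<close>; where \<open>x \<le> R\<close>, the linear term is bounded, and the additive constant absorbs it.\<close>

lemma (in prob_space) drift_powr:
  fixes v \<xi> :: "'a \<Rightarrow> real" and x p :: real
  assumes [measurable]: "v \<in> borel_measurable M" "\<xi> \<in> borel_measurable M"
    and x: "0 \<le> x" and v: "\<And>f. f \<in> space M \<Longrightarrow> 0 \<le> v f"
    and dom: "\<And>f. f \<in> space M \<Longrightarrow> \<bar>v f - x\<bar> \<le> \<xi> f"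
    and p: "1 < p" "p \<le> 2" and int: "integrable M (\<lambda>f. \<bar>\<xi> f\<bar> powr p)"
    and c: "0 \<le> c" and R: "0 \<le> R" and drift: "x > R \<Longrightarrow> (\<integral>f. v f - x \<partial>M) \<le> - c"
  shows "integrable M (\<lambda>f. v f powr p)"
    and "(\<integral>f. v f powr p \<partial>M) \<le> x powr p - c * p * x powr (p - 1)
       + (p * (\<integral>f. \<bar>\<xi> f\<bar> powr p \<partial>M) + p * R powr (p - 1) * ((\<integral>f. \<bar>\<xi> f\<bar> \<partial>M) + c))"
proof -
  have int1: "integrable M (\<lambda>f. \<bar>\<xi> f\<bar>)"
    using integrable_of_powr[OF _ int, of 1] p by simp
  have intd: "integrable M (\<lambda>f. v f - x)"
    by (rule Bochner_Integration.integrable_bound[OF int1]) (use dom in \<open>force intro!: AE_I2\<close>)+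
  have intd2: "integrable M (\<lambda>f. \<bar>v f - x\<bar> powr p)"
    by (rule Bochner_Integration.integrable_bound[OF int])
      (use dom p in \<open>force intro!: AE_I2 powr_mono2\<close>)+
  let ?r = "\<lambda>f. x powr p + p * x powr (p - 1) * (v f - x) + p * \<bar>v f - x\<bar> powr p"
  have intr: "integrable M ?r" using intd intd2 by simp
  have le: "v f powr p \<le> ?r f" if "f \<in> space M" for f
    using powr_add_le_taylor[of x "v f - x" p] x v[OF that] p by simp
  show I: "integrable M (\<lambda>f. v f powr p)"
    by (rule Bochner_Integration.integrable_bound[OF intr])
      (use le in \<open>auto intro!: AE_I2 order.trans[OF le abs_ge_self]\<close>)
  have "(\<integral>f. v f powr p \<partial>M) \<le> (\<integral>f. ?r f \<partial>M)"
    by (intro integral_mono I intr le)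
  also have "\<dots> = x powr p + p * x powr (p - 1) * (\<integral>f. v f - x \<partial>M) + p * (\<integral>f. \<bar>v f - x\<bar> powr p \<partial>M)"
    using intd intd2 by (simp add: prob_space)
  also have "(\<integral>f. \<bar>v f - x\<bar> powr p \<partial>M) \<le> (\<integral>f. \<bar>\<xi> f\<bar> powr p \<partial>M)"
    by (intro integral_mono intd2 int powr_mono2) (use dom p in force)+
  finally have 1: "(\<integral>f. v f powr p \<partial>M) \<le> x powr p + p * (x powr (p - 1) * (\<integral>f. v f - x \<partial>M))
     + p * (\<integral>f. \<bar>\<xi> f\<bar> powr p \<partial>M)"
    using p by simp
  have xi0: "0 \<le> (\<integral>f. \<bar>\<xi> f\<bar> \<partial>M)" by simp
  have "x powr (p - 1) * (\<integral>f. v f - x \<partial>M) \<le> - c * x powr (p - 1) + R powr (p - 1) * ((\<integral>f. \<bar>\<xi> f\<bar> \<partial>M) + c)"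
  proof (cases "x > R")
    case True
    from mult_left_mono[OF drift[OF this], of "x powr (p - 1)"]
    have "x powr (p - 1) * (\<integral>f. v f - x \<partial>M) \<le> - c * x powr (p - 1)" by (simp add: mult.commute)
    moreover have "0 \<le> R powr (p - 1) * ((\<integral>f. \<bar>\<xi> f\<bar> \<partial>M) + c)"
      using c xi0 by simp
    ultimately show ?thesis by simp
  next
    case False
    have "(\<integral>f. v f - x \<partial>M) \<le> (\<integral>f. \<bar>\<xi> f\<bar> \<partial>M)"
      by (intro integral_mono intd int1) (use dom in force)
    then have "x powr (p - 1) * ((\<integral>f. v f - x \<partial>M) + c) \<le> x powr (p - 1) * ((\<integral>f. \<bar>\<xi> f\<bar> \<partial>M) + c)"
      by (intro mult_left_mono) auto
    also have "\<dots> \<le> R powr (p - 1) * ((\<integral>f. \<bar>\<xi> f\<bar> \<partial>M) + c)"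
      using False x p c xi0 by (intro mult_right_mono powr_mono2) auto
    finally show ?thesis by (simp add: algebra_simps)
  qed
  from mult_left_mono[OF this, of p] p 1
  show "(\<integral>f. v f powr p \<partial>M) \<le> x powr p - c * p * x powr (p - 1)
       + (p * (\<integral>f. \<bar>\<xi> f\<bar> powr p \<partial>M) + p * R powr (p - 1) * ((\<integral>f. \<bar>\<xi> f\<bar> \<partial>M) + c))"
    by (simp add: algebra_simps)
qed


lemma inverse_powr_tail_small:
  fixes p e :: real
  assumes "1 < p" "0 < e"
  obtains N :: nat where "N \<ge> 1" "\<And>n. (\<Sum>j<n. 1 / real (N + j) powr p) \<le> e"
proof -
  have s: "summable (\<lambda>i. 1 / real i powr p)"
    using assms summable_real_powr_iff[of "-p"] by (simp add: powr_minus_divide)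
  obtain N0 where N0: "\<And>n. n \<ge> N0 \<Longrightarrow> norm (\<Sum>i. 1 / real (i + n) powr p) < e"
    using suminf_exist_split[OF \<open>0 < e\<close> s] by blast
  have "(\<Sum>j<n. 1 / real (Suc N0 + j) powr p) \<le> (\<Sum>j. 1 / real (j + Suc N0) powr p)" for n
    unfolding add.commute[of "Suc N0"]
    by (rule sum_le_suminf[OF summable_ignore_initial_segment[OF s]]) auto
  also have "(\<Sum>j. 1 / real (j + Suc N0) powr p) \<le> e"
    using N0[of "Suc N0"] by (simp del: of_nat_Suc of_nat_add)
  finally show ?thesis
    by (intro that[of "Suc N0"]) auto
qed

section \<open>Tightness from a drift inequality\<close>

context random_maps
begin

text \<open>One step of \<open>P W\<^sub>j \<le> W\<^sub>j\<^sub>+\<^sub>1 + b / L\<^sup>p\<close> with \<open>L = T + c j\<close>. If \<open>\<psi>(y) \<ge> L + c\<close>, the right-hand side is at least 1.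
  Otherwise the drift inequality reduces the claim to \<open>\<psi>\<^sup>p (1 - (L / (L + c))\<^sup>p) \<le> c p \<psi>\<^sup>p\<^sup>-\<^sup>1\<close>, which holds because the
  factor in parentheses is at most \<open>p c / (L + c)\<close> by Bernoulli's inequality, and \<open>\<psi> \<le> L + c\<close>.\<close>

lemma tightness_step:
  fixes \<psi> :: "'m \<Rightarrow> real"
  assumes nonneg: "0 \<le> \<psi> y" "\<And>f. f \<in> space \<nu> \<Longrightarrow> 0 \<le> \<psi> (f y)"
    and p: "1 < p" and c: "0 < c" and b: "0 \<le> b"
    and int: "integrable \<nu> (\<lambda>f. \<psi> (f y) powr p)"
    and drift: "(\<integral>f. \<psi> (f y) powr p \<partial>\<nu>) \<le> \<psi> y powr p - c * p * \<psi> y powr (p - 1) + b"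
    and L: "0 < L"
  shows "(\<integral>\<^sup>+f. ennreal (min 1 ((\<psi> (f y) / L) powr p)) \<partial>\<nu>)
    \<le> ennreal (min 1 ((\<psi> y / (L + c)) powr p) + b / L powr p)"
proof (cases "\<psi> y \<ge> L + c")
  case True
  then have "1 \<le> \<psi> y / (L + c)" using L c by (simp add: le_divide_eq)
  then have "min 1 ((\<psi> y / (L + c)) powr p) = 1"
    using p by (simp add: ge_one_powr_ge_zero)
  moreover have "(\<integral>\<^sup>+f. ennreal (min 1 ((\<psi> (f y) / L) powr p)) \<partial>\<nu>) \<le> (\<integral>\<^sup>+f. 1 \<partial>\<nu>)"
    by (intro nn_integral_mono) simp
  ultimately show ?thesis
    using b by (simp add: M.emeasure_space_1 order.trans[of _ 1])
next
  case False
  define x where "x = \<psi> y"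
  have x: "0 \<le> x" "x \<le> L + c" using False nonneg by (auto simp: x_def)
  have min_eq: "min 1 ((x / (L + c)) powr p) = x powr p / (L + c) powr p"
    using x p L c powr_mono2[of p x "L + c"] by (subst min_absorb2) (auto simp: powr_divide divide_le_eq_1)
  have "1 + p * (L / (L + c) - 1) \<le> (L / (L + c)) powr p"
    using powr_tangent_le[of 1 "L / (L + c)" p] p L c by simp
  moreover have "L / (L + c) - 1 = - (c / (L + c))"
    using L c by (simp add: field_simps)
  ultimately have B: "1 - p * c / (L + c) \<le> L powr p / (L + c) powr p"
    using L c by (simp add: powr_divide)
  have xp: "x powr p = x powr (p - 1) * x"
    using x p by (cases "x = 0") (auto simp: powr_diff)
  have "x powr p * (1 - L powr p / (L + c) powr p) \<le> x powr p * (p * c / (L + c))"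
    using B by (intro mult_left_mono) auto
  also have "\<dots> = p * c * x powr (p - 1) * (x / (L + c))" by (simp add: xp)
  also have "\<dots> \<le> p * c * x powr (p - 1) * 1"
    using x p L c by (intro mult_left_mono) auto
  finally have *: "x powr p - c * p * x powr (p - 1) + b \<le> L powr p * (x powr p / (L + c) powr p) + b"
    by (simp add: algebra_simps)
  have "(\<integral>\<^sup>+f. ennreal (min 1 ((\<psi> (f y) / L) powr p)) \<partial>\<nu>) \<le> (\<integral>\<^sup>+f. ennreal (\<psi> (f y) powr p / L powr p) \<partial>\<nu>)"
    using nonneg L by (intro nn_integral_mono ennreal_leI) (simp add: powr_divide)
  also have "\<dots> = ennreal (\<integral>f. \<psi> (f y) powr p / L powr p \<partial>\<nu>)"
    by (rule nn_integral_eq_integral) (use int in auto)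
  also have "(\<integral>f. \<psi> (f y) powr p / L powr p \<partial>\<nu>) \<le> (x powr p - c * p * x powr (p - 1) + b) / L powr p"
    using drift L by (simp add: x_def divide_right_mono)
  also have "\<dots> \<le> (L powr p * (x powr p / (L + c) powr p) + b) / L powr p"
    using * L by (intro divide_right_mono) auto
  also have "\<dots> = min 1 ((x / (L + c)) powr p) + b / L powr p"
    unfolding min_eq using L by (simp add: add_divide_distrib)
  finally show ?thesis by (simp add: x_def ennreal_leI)
qed

lemma tightness:
  fixes \<psi> :: "'m \<Rightarrow> real"
  assumes inv: "\<And>f y. f \<in> space \<nu> \<Longrightarrow> y \<in> E \<Longrightarrow> f y \<in> E"
    and nonneg: "\<And>y. y \<in> E \<Longrightarrow> 0 \<le> \<psi> y"
    and p: "1 < p" and c: "0 < c" and b: "0 \<le> b"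
    and meas: "\<And>y. y \<in> E \<Longrightarrow> (\<lambda>f. \<psi> (f y)) \<in> borel_measurable \<nu>"
    and int: "\<And>y. y \<in> E \<Longrightarrow> integrable \<nu> (\<lambda>f. \<psi> (f y) powr p)"
    and drift: "\<And>y. y \<in> E \<Longrightarrow> (\<integral>f. \<psi> (f y) powr p \<partial>\<nu>) \<le> \<psi> y powr p - c * p * \<psi> y powr (p - 1) + b"
    and T: "0 < T" and y: "y \<in> E"
  shows "(\<integral>\<^sup>+\<omega>. ennreal (min 1 ((\<psi> (random_iterate \<omega> n y) / T) powr p)) \<partial>S)
    \<le> ennreal (min 1 ((\<psi> y / (T + c * real n)) powr p) + (\<Sum>j<n. b / (T + c * real j) powr p))"
  using y
proof (induction n arbitrary: y)
  case 0
  then show ?case by (simp add: P.emeasure_space_1)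
next
  case (Suc n)
  note [measurable] = meas[OF Suc.prems]
  let ?s = "\<Sum>j<n. b / (T + c * real j) powr p"
  have s0: "0 \<le> ?s" using b by (intro sum_nonneg) auto
  have L: "0 < T + c * real n" using T c by (simp add: add_pos_nonneg)
  have split: "ennreal (min 1 (t powr p) + ?s) = ennreal (min 1 (t powr p)) + ennreal ?s" for t
    by (rule ennreal_plus) (use s0 in auto)
  have "(\<integral>\<^sup>+\<omega>. ennreal (min 1 ((\<psi> (random_iterate \<omega> (Suc n) y) / T) powr p)) \<partial>S)
      = (\<integral>\<^sup>+f. \<integral>\<^sup>+\<omega>. ennreal (min 1 ((\<psi> (random_iterate \<omega> n (f y)) / T) powr p)) \<partial>S \<partial>\<nu>)"
    by (rule first_step) measurable
  also have "\<dots> \<le> (\<integral>\<^sup>+f. ennreal (min 1 ((\<psi> (f y) / (T + c * real n)) powr p) + ?s) \<partial>\<nu>)"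
    by (rule nn_integral_mono, rule Suc.IH, rule inv[OF _ Suc.prems])
  also have "\<dots> = (\<integral>\<^sup>+f. ennreal (min 1 ((\<psi> (f y) / (T + c * real n)) powr p)) + ennreal ?s \<partial>\<nu>)"
    by (subst split) (rule refl)
  also have "\<dots> = (\<integral>\<^sup>+f. ennreal (min 1 ((\<psi> (f y) / (T + c * real n)) powr p)) \<partial>\<nu>) + ennreal ?s"
    by (subst nn_integral_add) (auto simp: M.emeasure_space_1)
  also have "\<dots> \<le> ennreal (min 1 ((\<psi> y / (T + c * real n + c)) powr p) + b / (T + c * real n) powr p) + ennreal ?s"
    by (intro add_right_mono tightness_step nonneg inv[OF _ Suc.prems] Suc.prems p c b int drift L)
  also have "\<dots> = ennreal (min 1 ((\<psi> y / (T + c * real n + c)) powr p) + b / (T + c * real n) powr p + ?s)"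
    using s0 b by (subst ennreal_plus[symmetric]) auto
  finally show ?case by (simp add: algebra_simps)
qed

text \<open>The error term does not depend on the starting point \<open>y\<close>, which enters only through the term that tends
  to 0. Both parts of the theorem rest on this uniformity.\<close>

lemma uniform_tightness:
  fixes \<psi> :: "'m \<Rightarrow> real"
  assumes inv: "\<And>f y. f \<in> space \<nu> \<Longrightarrow> y \<in> E \<Longrightarrow> f y \<in> E"
    and nonneg: "\<And>y. y \<in> E \<Longrightarrow> 0 \<le> \<psi> y"
    and p: "1 < p" and c: "0 < c" and b: "0 \<le> b"
    and meas: "\<And>y. y \<in> E \<Longrightarrow> (\<lambda>f. \<psi> (f y)) \<in> borel_measurable \<nu>"
    and int: "\<And>y. y \<in> E \<Longrightarrow> integrable \<nu> (\<lambda>f. \<psi> (f y) powr p)"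
    and drift: "\<And>y. y \<in> E \<Longrightarrow> (\<integral>f. \<psi> (f y) powr p \<partial>\<nu>) \<le> \<psi> y powr p - c * p * \<psi> y powr (p - 1) + b"
    and e: "0 < e"
  obtains T where "0 < T"
    "\<And>K y n. K \<in> sets borel \<Longrightarrow> (\<And>z. z \<in> E \<Longrightarrow> \<psi> z < T \<Longrightarrow> z \<in> K) \<Longrightarrow> y \<in> E \<Longrightarrow>
       measure S {\<omega>\<in>space S. random_iterate \<omega> n y \<notin> K} \<le> (\<psi> y / (T + c * real n)) powr p + e"
proof -
  have cp: "0 < c powr p" using c by simp
  obtain N :: nat where N: "N \<ge> 1" "\<And>n. (\<Sum>j<n. 1 / real (N + j) powr p) \<le> e / ((b + 1) / c powr p)"
  proof -
    have "0 < e / ((b + 1) / c powr p)" using e b cp by simp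
    from inverse_powr_tail_small[OF p this] that show thesis by blast
  qed
  (* With this T the error terms are multiples of the terms with index at least N of the series of 1 / i^p. *)
  define T where "T = c * real N"
  have T: "0 < T" using c N by (simp add: T_def)
  have tail: "(\<Sum>j<n. b / (T + c * real j) powr p) \<le> e" for n
  proof -
    have "b / (T + c * real j) powr p = b / c powr p * (1 / real (N + j) powr p)" for j :: nat
    proof -
      have "T + c * real j = c * real (N + j)" by (simp add: T_def algebra_simps)
      then show ?thesis using c by (simp add: powr_mult)
    qed
    then have "(\<Sum>j<n. b / (T + c * real j) powr p) = b / c powr p * (\<Sum>j<n. 1 / real (N + j) powr p)"
      by (simp only: sum_distrib_left)
    also have "\<dots> \<le> (b + 1) / c powr p * (e / ((b + 1) / c powr p))"
      using b cp N by (intro mult_mono divide_right_mono) (auto intro: sum_nonneg)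
    also have "\<dots> = e" using b cp by simp
    finally show ?thesis .
  qed
  show ?thesis
  proof (rule that[OF T])
    fix K y n
    assume K: "K \<in> sets borel" "\<And>z. z \<in> E \<Longrightarrow> \<psi> z < T \<Longrightarrow> z \<in> K" and y: "y \<in> E"
    let ?A = "{\<omega>\<in>space S. random_iterate \<omega> n y \<notin> K}"
    have A: "?A \<in> sets S"
      using orbit_measurable[of n y] K(1) by measurable
    have E: "random_iterate \<omega> n y \<in> E" if "\<omega> \<in> space S" for \<omega>
      using inv[OF random_iterate_in_space[OF that] y] .
    have "ennreal (measure S ?A) = (\<integral>\<^sup>+\<omega>. indicator ?A \<omega> \<partial>S)"
      using A by (simp add: P.emeasure_eq_measure)
    also have "\<dots> \<le> (\<integral>\<^sup>+\<omega>. ennreal (min 1 ((\<psi> (random_iterate \<omega> n y) / T) powr p)) \<partial>S)"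
    proof (intro nn_integral_mono)
      fix \<omega> assume \<omega>: "\<omega> \<in> space S"
      show "indicator ?A \<omega> \<le> ennreal (min 1 ((\<psi> (random_iterate \<omega> n y) / T) powr p))"
      proof (cases "\<omega> \<in> ?A")
        case True
        then have "\<psi> (random_iterate \<omega> n y) \<ge> T"
          using K(2)[OF E[OF \<omega>]] by force
        then have "1 \<le> (\<psi> (random_iterate \<omega> n y) / T) powr p"
          using T p by (intro ge_one_powr_ge_zero) (auto simp: le_divide_eq)
        then show ?thesis by (simp add: indicator_def)
      qed simp
    qed
    also have "\<dots> \<le> ennreal (min 1 ((\<psi> y / (T + c * real n)) powr p) + (\<Sum>j<n. b / (T + c * real j) powr p))"
      by (rule tightness[where E = E and \<psi> = \<psi> and p = p and c = c and b = b, OF _ _ p c b _ _ _ T y]; fact)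
    also have "\<dots> \<le> ennreal ((\<psi> y / (T + c * real n)) powr p + e)"
      by (intro ennreal_leI add_mono tail) simp
    finally show "measure S ?A \<le> (\<psi> y / (T + c * real n)) powr p + e"
      using e by (subst (asm) ennreal_le_iff) (auto simp: add_nonneg_nonneg)
  qed
qed

section \<open>Frequencies of visits\<close>

definition cylinder :: "nat \<Rightarrow> (nat \<Rightarrow> 'm \<Rightarrow> 'm) set \<Rightarrow> bool" where
  "cylinder n C \<longleftrightarrow> C \<in> sets S \<and>
     (\<forall>\<omega>\<in>space S. \<forall>\<omega>'\<in>space S. (\<forall>i<n. \<omega> i = \<omega>' i) \<longrightarrow> (\<omega> \<in> C \<longleftrightarrow> \<omega>' \<in> C))"

lemma cylinder_mono: "cylinder n C \<Longrightarrow> n \<le> m \<Longrightarrow> cylinder m C"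
  unfolding cylinder_def by (meson order_less_le_trans)

text \<open>The events that can be approximated in probability by events depending on finitely many coordinates form
  a \<open>\<sigma>\<close>-algebra; a countable union is first replaced by a finite one.\<close>

lemma approx_by_cylinder:
  assumes "A \<in> sets S" "0 < e"
  shows "\<exists>n C. cylinder n C \<and> measure S ((A - C) \<union> (C - A)) < e"
proof -
  have "A \<in> sigma_sets (\<Pi>\<^sub>E i\<in>UNIV. space \<nu>) {{f \<in> \<Pi>\<^sub>E i\<in>UNIV. space \<nu>. f i \<in> B} |i B. i \<in> (UNIV::nat set) \<and> B \<in> sets \<nu>}"
    using assms(1) by (simp only: sets_PiM_single)
  then have "A \<in> sets S \<and> (\<forall>e>0. \<exists>n C. cylinder n C \<and> measure S ((A - C) \<union> (C - A)) < e)"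
  proof (induction rule: sigma_sets.induct)
    case (Basic a)
    then obtain i B where a: "a = {f \<in> space S. f i \<in> B}" "B \<in> sets \<nu>"
      by (auto simp: space_PiM)
    have "a \<in> sets S" unfolding a(1) using a(2) by measurable
    then have "cylinder (Suc i) a"
      unfolding cylinder_def by (auto simp: a(1))
    then show ?case
      using \<open>a \<in> sets S\<close> by (auto intro!: exI[of _ "Suc i"] exI[of _ a])
  next
    case Empty
    have "cylinder 0 {}" by (auto simp: cylinder_def)
    then show ?case by (auto intro!: exI[of _ "{}"])
  next
    case (Compl a)
    have sp: "(\<Pi>\<^sub>E i\<in>UNIV. space \<nu>) = space S" by (simp add: space_PiM)
    show ?case unfolding sp
    proof (intro conjI allI impI)
      show "space S - a \<in> sets S" using Compl by auto
      fix e :: real assume "0 < e"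
      then obtain n C where C: "cylinder n C" "measure S ((a - C) \<union> (C - a)) < e"
        using Compl by blast
      have sub: "a \<subseteq> space S" "C \<subseteq> space S"
        using Compl C(1) sets.sets_into_space[of _ S] unfolding cylinder_def by auto
      have "(space S - a - (space S - C)) \<union> (space S - C - (space S - a)) = (a - C) \<union> (C - a)"
        using sub by auto
      moreover have "cylinder n (space S - C)"
      proof -
        have "space S - C \<in> sets S" using C(1) by (simp add: cylinder_def sets.compl_sets)
        moreover have "\<omega> \<in> space S - C \<longleftrightarrow> \<omega>' \<in> space S - C"
          if "\<omega> \<in> space S" "\<omega>' \<in> space S" "\<forall>i<n. \<omega> i = \<omega>' i" for \<omega> \<omega>'
          using C(1) that unfolding cylinder_def Diff_iff by blast
        ultimately show ?thesis unfolding cylinder_def by blast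
      qed
      ultimately show "\<exists>n D. cylinder n D \<and> measure S ((space S - a - D) \<union> (D - (space S - a))) < e"
        using C(2) by (intro exI[of _ n] exI[of _ "space S - C"]) simp
    qed
  next
    case (Union a)
    have a: "a i \<in> sets S" for i using Union by auto
    show ?case
    proof (intro conjI allI impI)
      show "(\<Union>i. a i) \<in> sets S" using a by auto
      fix e :: real assume e: "0 < e"
      have "(\<lambda>m. measure S (\<Union>i<m. a i)) \<longlonglongrightarrow> measure S (\<Union>m. \<Union>i<m. a i)"
        by (rule P.finite_Lim_measure_incseq) (use a in \<open>auto simp: incseq_def intro: less_le_trans\<close>)
      moreover have "(\<Union>m. \<Union>i<m. a i) = (\<Union>i. a i)" by auto
      ultimately have lim: "(\<lambda>m. measure S (\<Union>i<m. a i)) \<longlonglongrightarrow> measure S (\<Union>i. a i)" by simp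
      obtain m where m: "\<bar>measure S (\<Union>i<m. a i) - measure S (\<Union>i. a i)\<bar> < e / 2"
        using LIMSEQ_D[OF lim, of "e / 2"] e by auto
      define r where "r = e / (2 * (real m + 1))"
      have r: "r > 0" using e by (simp add: r_def)
      have "\<exists>n C. cylinder n C \<and> measure S ((a i - C) \<union> (C - a i)) < r" for i
        using Union r by blast
      then obtain N C where C: "\<And>i. cylinder (N i) (C i)" "\<And>i. measure S ((a i - C i) \<union> (C i - a i)) < r"
        by metis
      have Cs: "C i \<in> sets S" for i using C(1)[of i] by (simp add: cylinder_def)
      define M where "M = (\<Sum>i<m. N i)"
      have "cylinder (N i) (C i)" "N i \<le> M" if "i < m" for i
        using that C(1) by (auto simp: M_def intro!: member_le_sum)
      then have cm: "cylinder M (C i)" if "i < m" for i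
        using that cylinder_mono by blast
      have cyl: "cylinder M (\<Union>i<m. C i)"
      proof -
        have "(\<Union>i<m. C i) \<in> sets S" using Cs by auto
        with cm show ?thesis unfolding cylinder_def by blast
      qed
      let ?A = "\<Union>i. a i" and ?D = "\<Union>i<m. C i" and ?Am = "\<Union>i<m. a i"
      have "measure S ((?A - ?D) \<union> (?D - ?A)) \<le> measure S ((?A - ?Am) \<union> (\<Union>i<m. (a i - C i) \<union> (C i - a i)))"
        by (intro P.finite_measure_mono) (use a Cs in auto)
      also have "\<dots> \<le> measure S (?A - ?Am) + measure S (\<Union>i<m. (a i - C i) \<union> (C i - a i))"
        by (intro measure_Un_le) (use a Cs in auto)
      also have "measure S (?A - ?Am) = measure S ?A - measure S ?Am"
        by (intro P.finite_measure_Diff) (use a in auto)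
      also have "\<dots> < e / 2" using m by linarith
      also have "measure S (\<Union>i<m. (a i - C i) \<union> (C i - a i)) \<le> (\<Sum>i<m. measure S ((a i - C i) \<union> (C i - a i)))"
        by (intro P.finite_measure_subadditive_finite) (use a Cs in auto)
      also have "\<dots> \<le> (\<Sum>i<m. r)" using C(2) by (intro sum_mono less_imp_le) auto
      also have "\<dots> \<le> e / 2"
        using e by (simp add: r_def field_simps)
      finally show "\<exists>n D. cylinder n D \<and> measure S ((?A - D) \<union> (D - ?A)) < e"
        using cyl by (intro exI[of _ M] exI[of _ ?D]) simp
    qed
  qed
  then show ?thesis using assms(2) by blast
qed

definition rarely_visits :: "'m set \<Rightarrow> 'm \<Rightarrow> real \<Rightarrow> (nat \<Rightarrow> 'm \<Rightarrow> 'm) set" where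
  "rarely_visits K y r = {\<omega>\<in>space S. \<exists>N. \<forall>n\<ge>N. real (card {k\<in>{1..n}. random_iterate \<omega> k y \<in> K}) \<le> r * real n}"

lemma card_visits: "real (card {k\<in>{1..n}. P k}) = (\<Sum>k\<in>{1..n::nat}. indicator {k. P k} k)"
proof -
  have "{k\<in>{1..n}. P k} = {1..n} \<inter> {k. P k}" by auto
  then have "real (card {k\<in>{1..n}. P k}) = (\<Sum>k\<in>{1..n} \<inter> {k. P k}. 1)" by simp
  also have "\<dots> = (\<Sum>k\<in>{1..n}. if k \<in> {k. P k} then 1 else 0)"
    by (rule sum.inter_restrict) simp
  finally show ?thesis by (simp add: indicator_def of_bool_def)
qed

lemma card_visits_measurable:
  assumes K: "K \<in> sets borel"
  shows "(\<lambda>\<omega>. real (card {k\<in>{1..n}. random_iterate \<omega> k y \<in> K})) \<in> borel_measurable S"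
proof -
  have "(\<lambda>\<omega>. indicator K (random_iterate \<omega> k y) :: real) \<in> borel_measurable S" for k
    by (rule measurable_compose[OF orbit_measurable]) (use K in simp)
  moreover have "indicator {k. random_iterate \<omega> k y \<in> K} k = (indicator K (random_iterate \<omega> k y) :: real)" for k \<omega>
    by (simp add: indicator_def)
  ultimately show ?thesis
    unfolding card_visits by simp
qed

lemma rarely_visits_sets:
  assumes K: "K \<in> sets borel"
  shows "rarely_visits K y r \<in> sets S"
  using card_visits_measurable[OF K] unfolding rarely_visits_def by measurable

text \<open>Markov's inequality for the number of times at which the orbit is outside \<open>K\<close>. Its expectation up to time \<open>n\<close>
  is at most \<open>n0 + n e / 4\<close>, so that at a large time \<open>n\<close> it reaches \<open>e n\<close> with probability at most 1/2.\<close>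

lemma rarely_visits_prob_le:
  assumes K: "K \<in> sets borel" and e: "0 < e"
    and ev: "\<And>n. n \<ge> n0 \<Longrightarrow> measure S {\<omega>\<in>space S. random_iterate \<omega> n y \<notin> K} \<le> e / 4"
  shows "measure S (rarely_visits K y (1 - e)) \<le> 1 / 2"
proof -
  let ?v = "\<lambda>n \<omega>. real (card {k\<in>{1..n}. random_iterate \<omega> k y \<in> K})"
  let ?g = "\<lambda>k \<omega>. indicator (- K) (random_iterate \<omega> k y) :: real"
  note [measurable] = card_visits_measurable[OF K]
  define B where "B N = {\<omega>\<in>space S. \<forall>n\<ge>N. ?v n \<omega> \<le> (1 - e) * real n}" for N
  have B[measurable]: "B N \<in> sets S" for N unfolding B_def by measurable
  have gm: "(\<lambda>\<omega>. ?g k \<omega>) \<in> borel_measurable S" for k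
    by (rule measurable_compose[OF orbit_measurable]) (use K in simp)
  have gi: "integrable S (\<lambda>\<omega>. ?g k \<omega>)" for k
    by (rule P.integrable_const_bound[of _ 1]) (use gm in auto)
  have gint: "(\<integral>\<omega>. ?g k \<omega> \<partial>S) = measure S {\<omega>\<in>space S. random_iterate \<omega> k y \<notin> K}" for k
  proof -
    have "(\<integral>\<omega>. ?g k \<omega> \<partial>S) = (\<integral>\<omega>. indicator {\<omega>\<in>space S. random_iterate \<omega> k y \<notin> K} \<omega> \<partial>S)"
      by (intro Bochner_Integration.integral_cong) (auto simp: indicator_def)
    also have "\<dots> = measure S {\<omega>\<in>space S. random_iterate \<omega> k y \<notin> K}"
      using orbit_measurable[of k y] K by (subst Bochner_Integration.integral_indicator) (auto intro!: arg_cong[of _ _ "measure S"])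
    finally show ?thesis .
  qed
  have vg: "real n - ?v n \<omega> = (\<Sum>k=1..n. ?g k \<omega>)" for n \<omega>
  proof -
    have "real n = (\<Sum>k=1..n. 1)" by simp
    then have "real n - ?v n \<omega> = (\<Sum>k=1..n. 1 - indicator {k. random_iterate \<omega> k y \<in> K} k)"
      unfolding card_visits by (simp only: sum_subtractf)
    also have "\<dots> = (\<Sum>k=1..n. ?g k \<omega>)"
      by (intro sum.cong) (auto simp: indicator_def)
    finally show ?thesis .
  qed
  have BN: "measure S (B N) \<le> 1 / 2" for N
  proof -
    obtain n1 :: nat where n1: "real n1 \<ge> 4 * real n0 / e" using real_arch_simple by blast
    define n where "n = Max {N, n0, n1, 1}"
    have n: "n \<ge> N" "n \<ge> n0" "n \<ge> n1" "n \<ge> 1" by (auto simp: n_def)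
    have pos: "0 < e * real n" using e n by simp
    have n0: "real n0 \<le> e * real n / 4"
    proof -
      have "4 * real n0 / e \<le> real n" using n1 n by linarith
      then show ?thesis using e by (simp add: field_simps)
    qed
    have "B N \<subseteq> {\<omega>\<in>space S. (\<Sum>k=1..n. ?g k \<omega>) \<ge> e * real n}"
      using n(1) unfolding B_def vg[symmetric] by (auto simp: algebra_simps)
    then have "measure S (B N) \<le> measure S {\<omega>\<in>space S. (\<Sum>k=1..n. ?g k \<omega>) \<ge> e * real n}"
      by (rule P.finite_measure_mono[OF _ borel_measurable_le[OF borel_measurable_const borel_measurable_sum[OF gm]]])
    also have "\<dots> \<le> (\<integral>\<omega>. (\<Sum>k=1..n. ?g k \<omega>) \<partial>S) / (e * real n)"
      using gi pos by (intro integral_Markov_inequality_measure[where A = "space S"]) (auto intro!: sum_nonneg)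
    also have "(\<integral>\<omega>. (\<Sum>k=1..n. ?g k \<omega>) \<partial>S) = (\<Sum>k=1..n. measure S {\<omega>\<in>space S. random_iterate \<omega> k y \<notin> K})"
      using gi by (simp add: Bochner_Integration.integral_sum gint)
    also have "\<dots> \<le> (\<Sum>k=1..n. indicator {..<n0} k + e / 4)"
    proof (intro sum_mono)
      fix k show "measure S {\<omega>\<in>space S. random_iterate \<omega> k y \<notin> K} \<le> indicator {..<n0} k + e / 4"
        using ev[of k] e order.trans[OF P.prob_le_1, of "1 + e / 4"] by (cases "k < n0") auto
    qed
    also have "\<dots> = real (card ({1..n} \<inter> {..<n0})) + real n * (e / 4)"
      using card_visits[of n "\<lambda>k. k < n0"] by (simp add: sum.distrib lessThan_def Int_def)
    also have "real (card ({1..n} \<inter> {..<n0})) \<le> real (card {..<n0})"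
      by (intro of_nat_mono card_mono) auto
    finally have "measure S (B N) \<le> (real n0 + real n * (e / 4)) / (e * real n)"
      using pos by (simp add: divide_right_mono)
    also have "\<dots> \<le> (e * real n / 2) / (e * real n)"
      using pos n0 by (intro divide_right_mono) (auto simp: algebra_simps)
    also have "\<dots> = 1 / 2" using e n by simp
    finally show ?thesis .
  qed
  have "(\<lambda>N. measure S (B N)) \<longlonglongrightarrow> measure S (\<Union>N. B N)"
  proof (rule P.finite_Lim_measure_incseq)
    show "range B \<subseteq> sets S" using B by blast
    have "B N \<subseteq> B N'" if "N \<le> N'" for N N'
      unfolding B_def using that order.trans by blast
    then show "incseq B" unfolding incseq_def by blast
  qed
  moreover have "(\<Union>N. B N) = rarely_visits K y (1 - e)"
    by (auto simp: B_def rarely_visits_def)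
  ultimately have "(\<lambda>N. measure S (B N)) \<longlonglongrightarrow> measure S (rarely_visits K y (1 - e))" by simp
  then show ?thesis
    by (rule LIMSEQ_le_const2) (use BN in blast)
qed

text \<open>The first \<open>n\<close> steps change the frequency at time \<open>m\<close> by \<open>O(n / m)\<close>. Giving up \<open>e / 2\<close> absorbs this.\<close>

lemma rarely_visits_shift:
  assumes \<omega>: "comb_seq n \<omega> \<omega>' \<in> rarely_visits K x (1 - e)" "\<omega>' \<in> space S" and e: "0 < e"
  shows "\<omega>' \<in> rarely_visits K (random_iterate \<omega> n x) (1 - e / 2)"
proof -
  obtain N where N: "\<And>m. m \<ge> N \<Longrightarrow> real (card {k\<in>{1..m}. random_iterate (comb_seq n \<omega> \<omega>') k x \<in> K}) \<le> (1 - e) * real m"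
    using \<omega>(1) by (auto simp: rarely_visits_def)
  obtain n1 :: nat where n1: "real n1 \<ge> 2 * real n / e" using real_arch_simple by blast
  have "real (card {k\<in>{1..m}. random_iterate \<omega>' k (random_iterate \<omega> n x) \<in> K}) \<le> (1 - e / 2) * real m"
    if m: "m \<ge> max N n1" for m
  proof -
    have "2 * real n / e \<le> real m" using n1 m by linarith
    then have nm: "real n \<le> e / 2 * real m" using e by (simp add: field_simps)
    have "card {k\<in>{1..m}. random_iterate \<omega>' k (random_iterate \<omega> n x) \<in> K}
        = card ((+) n ` {k\<in>{1..m}. random_iterate \<omega>' k (random_iterate \<omega> n x) \<in> K})"
      by (rule card_image[symmetric]) simp
    also have "\<dots> \<le> card {k\<in>{1..n + m}. random_iterate (comb_seq n \<omega> \<omega>') k x \<in> K}"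
      by (intro card_mono) (auto simp: random_iterate_comb_seq_add)
    finally have "real (card {k\<in>{1..m}. random_iterate \<omega>' k (random_iterate \<omega> n x) \<in> K}) \<le> (1 - e) * real (n + m)"
      using N[of "n + m"] m by linarith
    also have "\<dots> = (1 - e) * real m + (real n - e * real n)" by (simp add: algebra_simps)
    also have "\<dots> \<le> (1 - e) * real m + real n" using e by simp
    also have "\<dots> \<le> (1 - e) * real m + e / 2 * real m" using nm by simp
    finally show ?thesis by (simp add: algebra_simps)
  qed
  then show ?thesis using \<omega>(2) unfolding rarely_visits_def by blast
qed

text \<open>Conditioning on the first \<open>n\<close> maps: rare visits from \<open>x\<close> entail rare visits from \<open>f\<^sub>\<omega>\<^sup>n(x)\<close> for the shifted sequence,
  and this has probability at most 1/2 for each value of the first maps.\<close>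

lemma rarely_visits_cylinder_le:
  assumes K: "K \<in> sets borel" and e: "0 < e" and C: "cylinder n C"
    and half: "\<And>f. f \<in> space \<nu> \<Longrightarrow> measure S (rarely_visits K (f x) (1 - e / 2)) \<le> 1 / 2"
  shows "measure S (rarely_visits K x (1 - e) \<inter> C) \<le> measure S C / 2"
proof -
  let ?A = "rarely_visits K x (1 - e)"
  have Cs: "C \<in> sets S" using C by (simp add: cylinder_def)
  have A: "?A \<in> sets S" by (rule rarely_visits_sets[OF K])
  have AC: "?A \<inter> C \<in> sets S" using A Cs by auto
  have "ennreal (measure S (?A \<inter> C)) = (\<integral>\<^sup>+\<omega>. indicator (?A \<inter> C) \<omega> \<partial>S)"
    using AC by (simp add: P.emeasure_eq_measure)
  also have "\<dots> = (\<integral>\<^sup>+\<omega>. indicator (?A \<inter> C) \<omega> \<partial>distr (S \<Otimes>\<^sub>M S) S (\<lambda>(\<omega>, \<omega>'). comb_seq n \<omega> \<omega>'))"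
    by (simp only: PiM_comb_seq)
  also have "\<dots> = (\<integral>\<^sup>+z. indicator (?A \<inter> C) (comb_seq n (fst z) (snd z)) \<partial>(S \<Otimes>\<^sub>M S))"
    using AC by (subst nn_integral_distr) (auto simp: split_beta')
  also have "\<dots> = (\<integral>\<^sup>+\<omega>. \<integral>\<^sup>+\<omega>'. indicator (?A \<inter> C) (comb_seq n \<omega> \<omega>') \<partial>S \<partial>S)"
  proof -
    have "(\<lambda>z. indicator (?A \<inter> C) (comb_seq n (fst z) (snd z)) :: ennreal) \<in> borel_measurable (S \<Otimes>\<^sub>M S)"
      using AC by measurable
    from P.nn_integral_fst[OF this] show ?thesis by simp
  qed
  also have "\<dots> \<le> (\<integral>\<^sup>+\<omega>. indicator C \<omega> * ennreal (1 / 2) \<partial>S)"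
  proof (intro nn_integral_mono)
    fix \<omega> assume \<omega>: "\<omega> \<in> space S"
    let ?z = "random_iterate \<omega> n x"
    have "indicator (?A \<inter> C) (comb_seq n \<omega> \<omega>') \<le> (indicator C \<omega> * indicator (rarely_visits K ?z (1 - e / 2)) \<omega>' :: ennreal)"
      if \<omega>': "\<omega>' \<in> space S" for \<omega>'
    proof -
      have "comb_seq n \<omega> \<omega>' \<in> space S"
        using measurable_space[OF measurable_comb_seq, of "(\<omega>, \<omega>')"] \<omega> \<omega>' by (auto simp: space_pair_measure)
      then have "comb_seq n \<omega> \<omega>' \<in> C \<longleftrightarrow> \<omega> \<in> C"
        using C \<omega> unfolding cylinder_def by (metis comb_seq_less)
      moreover have "comb_seq n \<omega> \<omega>' \<in> ?A \<Longrightarrow> \<omega>' \<in> rarely_visits K ?z (1 - e / 2)"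
        using rarely_visits_shift[OF _ \<omega>' e] .
      ultimately show ?thesis by (auto simp: indicator_def)
    qed
    then have "(\<integral>\<^sup>+\<omega>'. indicator (?A \<inter> C) (comb_seq n \<omega> \<omega>') \<partial>S)
        \<le> (\<integral>\<^sup>+\<omega>'. indicator C \<omega> * indicator (rarely_visits K ?z (1 - e / 2)) \<omega>' \<partial>S)"
      by (intro nn_integral_mono)
    also have "\<dots> = indicator C \<omega> * ennreal (measure S (rarely_visits K ?z (1 - e / 2)))"
      using rarely_visits_sets[OF K] by (simp add: nn_integral_cmult P.emeasure_eq_measure)
    also have "\<dots> \<le> indicator C \<omega> * ennreal (1 / 2)"
      by (intro mult_left_mono ennreal_leI half random_iterate_in_space \<omega>) auto
    finally show "(\<integral>\<^sup>+\<omega>'. indicator (?A \<inter> C) (comb_seq n \<omega> \<omega>') \<partial>S) \<le> indicator C \<omega> * ennreal (1 / 2)" .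
  qed
  also have "\<dots> = ennreal (measure S C) * ennreal (1 / 2)"
    using Cs by (simp add: nn_integral_multc P.emeasure_eq_measure)
  also have "\<dots> = ennreal (measure S C / 2)"
    by (subst ennreal_mult[symmetric]) auto
  finally show ?thesis by (subst (asm) ennreal_le_iff) auto
qed

lemma rarely_visits_null:
  assumes K: "K \<in> sets borel" and e: "0 < e"
    and half: "\<And>f. f \<in> space \<nu> \<Longrightarrow> measure S (rarely_visits K (f x) (1 - e / 2)) \<le> 1 / 2"
  shows "measure S (rarely_visits K x (1 - e)) = 0"
proof -
  let ?A = "rarely_visits K x (1 - e)"
  have A: "?A \<in> sets S" by (rule rarely_visits_sets[OF K])
  have "measure S ?A \<le> measure S ?A / 2 + d" if d: "0 < d" for d
  proof -
    obtain n C where C: "cylinder n C" "measure S ((?A - C) \<union> (C - ?A)) < d / 2"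
      using approx_by_cylinder[OF A, of "d / 2"] d by auto
    have Cs: "C \<in> sets S" using C by (simp add: cylinder_def)
    have 1: "measure S (?A - C) < d / 2" "measure S (C - ?A) < d / 2"
      by (rule le_less_trans[OF P.finite_measure_mono C(2)]; use A Cs in auto)+
    have "measure S ?A = measure S (?A \<inter> C) + measure S (?A - C)"
      using P.finite_measure_Union[of "?A \<inter> C" "?A - C"] A Cs by (simp add: Int_Diff_Un Int_Diff_disjoint sets.Diff sets.Int)
    moreover have "measure S (?A \<inter> C) \<le> measure S C / 2"
      by (rule rarely_visits_cylinder_le[OF K e C(1) half])
    moreover have "measure S C \<le> measure S (?A \<union> (C - ?A))"
      by (intro P.finite_measure_mono) (use A Cs in auto)
    moreover have "measure S (?A \<union> (C - ?A)) \<le> measure S ?A + measure S (C - ?A)"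
      by (intro measure_Un_le) (use A Cs in auto)
    ultimately show ?thesis using 1 d by linarith
  qed
  then have "measure S ?A \<le> measure S ?A / 2"
    by (rule field_le_epsilon)
  then show ?thesis using measure_nonneg[of S ?A] by linarith
qed

text \<open>The bound is required from the points \<open>f x\<close>, which include all positions of the orbit of \<open>x\<close> because
  compositions of maps in \<open>space \<nu>\<close> are again there.\<close>

lemma AE_limsup_visits:
  assumes K: "K \<in> sets borel" and e: "0 < e"
    and ev: "\<And>f. f \<in> space \<nu> \<Longrightarrow> \<exists>n0. \<forall>n\<ge>n0. measure S {\<omega>\<in>space S. random_iterate \<omega> n (f x) \<notin> K} \<le> e / 8"
  shows "AE \<omega> in S. limsup (\<lambda>n. ereal (real (card {k \<in> {1..n}. random_iterate \<omega> k x \<in> K}) / real n)) \<ge> ereal (1 - e)"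
proof -
  have "measure S (rarely_visits K (f x) (1 - e / 2)) \<le> 1 / 2" if f: "f \<in> space \<nu>" for f
  proof -
    obtain n0 where "\<And>n. n \<ge> n0 \<Longrightarrow> measure S {\<omega>\<in>space S. random_iterate \<omega> n (f x) \<notin> K} \<le> e / 2 / 4"
      using ev[OF f] by auto
    from rarely_visits_prob_le[OF K _ this] e show ?thesis by simp
  qed
  from rarely_visits_null[OF K e this]
  have "rarely_visits K x (1 - e) \<in> null_sets S"
    using rarely_visits_sets[OF K] by (auto simp: null_sets_def P.emeasure_eq_measure)
  then have "AE \<omega> in S. \<omega> \<notin> rarely_visits K x (1 - e)" by (rule AE_not_in)
  then show ?thesis
  proof (rule AE_mp, intro AE_I2 impI)
    fix \<omega> assume \<omega>: "\<omega> \<in> space S" "\<omega> \<notin> rarely_visits K x (1 - e)"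
    let ?q = "\<lambda>n. ereal (real (card {k \<in> {1..n}. random_iterate \<omega> k x \<in> K}) / real n)"
    have "\<exists>n\<ge>N. ereal (1 - e) \<le> ?q n" for N
    proof -
      from \<omega> obtain n where n: "n \<ge> max N 1" "real (card {k\<in>{1..n}. random_iterate \<omega> k x \<in> K}) > (1 - e) * real n"
        unfolding rarely_visits_def mem_Collect_eq by (meson not_le)
      then show ?thesis by (intro exI[of _ n]) (auto simp: field_simps)
    qed
    then have fr: "ereal (1 - e) \<le> (SUP n\<in>{N..}. ?q n)" for N
      by (meson SUP_upper2 atLeast_iff)
    show "ereal (1 - e) \<le> limsup ?q"
      unfolding limsup_INF_SUP by (intro INF_greatest fr)
  qed
qed

end

section \<open>The dynamics near the finite set\<close>

context finite_invariant_set
begin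

lemma dist_F_near_point:
  assumes p: "p \<in> F" and y: "y \<longlonglongrightarrow> p"
  shows "\<forall>\<^sub>F k in sequentially. y k \<in> chart_dom (ch p) \<and> dist_F (y k) = center_norm p (offset p (y k))"
proof -
  have lim: "(\<lambda>k. pdist q r (y k)) \<longlonglongrightarrow> pdist q r p" if "q \<in> F" for q
    by (rule continuous_on_tendsto_compose[OF pdist_continuous[OF admissible_F[OF that]] y]) auto
  have lp: "(\<lambda>k. pdist p r (y k)) \<longlonglongrightarrow> 0" using lim[OF p] pdist_self[OF r_pos] by simp
  have "\<forall>\<^sub>F k in sequentially. pdist p r (y k) < pdist q r (y k)" if q: "q \<in> F - {p}" for q
  proof -
    have pos: "0 < pdist q r p / 2"
      using q pdist_nonneg[OF r_pos, of q p] pdist_eq_0[OF r_pos, of q p] by (auto simp: order_le_less)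
    have "\<forall>\<^sub>F k in sequentially. pdist p r (y k) < pdist q r p / 2" by (rule order_tendstoD(2)[OF lp pos])
    moreover have "\<forall>\<^sub>F k in sequentially. pdist q r p / 2 < pdist q r (y k)"
      by (rule order_tendstoD(1)[OF lim]) (use q pos in auto)
    ultimately show ?thesis by eventually_elim simp
  qed
  then have "\<forall>\<^sub>F k in sequentially. \<forall>q\<in>F - {p}. pdist p r (y k) < pdist q r (y k)"
    using finite_F by (intro eventually_ball_finite) auto
  moreover have "\<forall>\<^sub>F k in sequentially. pdist p r (y k) < r" using order_tendstoD(2)[OF lp r_pos] .
  ultimately show ?thesis
  proof eventually_elim
    case (elim k)
    obtain q where q: "q \<in> F" "dist_F (y k) = pdist q r (y k)" using dist_F_attained by blast
    have "q = p"
    proof (rule ccontr)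
      assume "q \<noteq> p"
      then have "pdist p r (y k) < pdist q r (y k)" using elim(1) q(1) by blast
      then show False using dist_F_le[OF p, of "y k"] q(2) by simp
    qed
    then show ?case using pdist_lessD[OF elim(2)] q by simp
  qed
qed

text \<open>The infinitesimal growth of the distance to \<open>F\<close>: for \<open>x k = q + h\<close> in the chart, both distances are norms of
  coordinate differences, and \<open>(f(q + h) - f(q)) / \<parallel>h\<parallel>\<close> tends to \<open>Df u\<close> by differentiability.\<close>

lemma dist_F_ratio_limit:
  assumes f: "Ck_map 2 A f" and q: "q \<in> F" "f q \<in> F" and x: "x \<longlonglongrightarrow> q" "\<And>k. x k \<notin> F"
    and u: "(\<lambda>k. direction q (x k)) \<longlonglongrightarrow> u"
  shows "(\<lambda>k. dist_F (f (x k)) / dist_F (x k)) \<longlonglongrightarrow> center_norm (f q) (Dv (rep (ch q) (ch (f q)) f) (ctr q) u)"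
proof -
  let ?c = "ch q" and ?d = "ch (f q)"
  let ?F = "rep ?c ?d f" and ?z = "ctr q"
  define h where "h k = chart_map ?c (x k) - ?z" for k
  define v where "v k = (1 / center_norm q (h k)) *\<^sub>R h k" for k
  have v: "v \<longlonglongrightarrow> u" using u by (simp add: v_def[abs_def] h_def)
  have fc: "continuous_on UNIV f" using f by (simp add: Ck_map_def)
  have fx: "(\<lambda>k. f (x k)) \<longlonglongrightarrow> f q"
    by (rule continuous_on_tendsto_compose[OF fc x(1)]) auto
  note nq = dist_F_near_point[OF q(1) x(1)] and nfq = dist_F_near_point[OF q(2) fx]
  have "(\<lambda>k. chart_map ?c (x k)) \<longlonglongrightarrow> ?z"
    by (rule continuous_on_tendsto_compose[OF chart_continuous(1)[OF ch(1)] x(1) ch(2)])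
      (rule eventually_mono[OF nq], simp)
  then have h0: "h \<longlonglongrightarrow> 0" unfolding h_def by (rule tendsto_eq_intros) auto
  have zU: "?z \<in> rep_dom ?c ?d f" by (rule map_in_rep_dom) (rule ch)+
  note DF = Ck_on_2_has_derivative[OF rep_C2(1)[OF f ch(1) ch(1)] zU]
  have hpos: "\<forall>\<^sub>F k in sequentially. center_norm q (h k) > 0"
    using nq
  proof eventually_elim
    case (elim k)
    then show ?case using dist_F_pos[OF x(2)[of k]] by (simp add: h_def)
  qed
  then have hne: "\<forall>\<^sub>F k in sequentially. h k \<noteq> 0"
    by eventually_elim (auto simp: center_norm_0)
  have "filterlim h (at 0) sequentially"
    using h0 hne by (simp add: filterlim_at)
  moreover have "((\<lambda>e. norm (?F (?z + e) - ?F ?z - Dv ?F ?z e) / norm e) \<longlongrightarrow> 0) (at 0)"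
    using DF(1) by (simp add: has_derivative_at)
  ultimately have "(\<lambda>k. norm (?F (?z + h k) - ?F ?z - Dv ?F ?z (h k)) / norm (h k)) \<longlonglongrightarrow> 0"
    by (rule filterlim_compose[rotated])
  then have "(\<lambda>k. norm (?F (?z + h k) - ?F ?z - Dv ?F ?z (h k)) / norm (h k) * norm (v k)) \<longlonglongrightarrow> 0 * norm u"
    by (intro tendsto_mult tendsto_norm v)
  moreover have "\<forall>\<^sub>F k in sequentially. norm (?F (?z + h k) - ?F ?z - Dv ?F ?z (h k)) / norm (h k) * norm (v k)
      = norm ((1 / center_norm q (h k)) *\<^sub>R (?F (?z + h k) - ?F ?z) - Dv ?F ?z (v k))"
    using hpos hne
  proof eventually_elim
    case (elim k)
    have "(1 / center_norm q (h k)) *\<^sub>R (?F (?z + h k) - ?F ?z) - Dv ?F ?z (v k)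
        = (1 / center_norm q (h k)) *\<^sub>R (?F (?z + h k) - ?F ?z - Dv ?F ?z (h k))"
      by (simp add: v_def linear_scale[OF DF(3)] scaleR_diff_right)
    then show ?case using elim by (simp add: v_def)
  qed
  ultimately have "(\<lambda>k. norm ((1 / center_norm q (h k)) *\<^sub>R (?F (?z + h k) - ?F ?z) - Dv ?F ?z (v k))) \<longlonglongrightarrow> 0 * norm u"
    by (rule Lim_transform_eventually)
  then have "(\<lambda>k. norm ((1 / center_norm q (h k)) *\<^sub>R (?F (?z + h k) - ?F ?z) - Dv ?F ?z (v k))) \<longlonglongrightarrow> 0" by simp
  then have 1: "(\<lambda>k. (1 / center_norm q (h k)) *\<^sub>R (?F (?z + h k) - ?F ?z) - Dv ?F ?z (v k)) \<longlonglongrightarrow> 0"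
    by (rule tendsto_norm_zero_cancel)
  have 2: "(\<lambda>k. Dv ?F ?z (v k)) \<longlonglongrightarrow> Dv ?F ?z u"
    using linear_continuous_at[OF has_derivative_bounded_linear[OF DF(1)], of u] v
    by (simp add: isCont_tendsto_compose)
  have 3: "(\<lambda>k. (1 / center_norm q (h k)) *\<^sub>R (?F (?z + h k) - ?F ?z)) \<longlonglongrightarrow> Dv ?F ?z u"
    using tendsto_add[OF 1 2] by simp
  have "(\<lambda>k. center_norm (f q) ((1 / center_norm q (h k)) *\<^sub>R (?F (?z + h k) - ?F ?z))) \<longlonglongrightarrow> center_norm (f q) (Dv ?F ?z u)"
    by (rule continuous_on_tendsto_compose[OF center_norm_continuous 3]) auto
  moreover have "\<forall>\<^sub>F k in sequentially. center_norm (f q) ((1 / center_norm q (h k)) *\<^sub>R (?F (?z + h k) - ?F ?z)) = dist_F (f (x k)) / dist_F (x k)"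
    using nq nfq hpos
  proof eventually_elim
    case (elim k)
    have "?F (?z + h k) = chart_map ?d (f (x k))" "?F ?z = ctr (f q)"
      using rep_at[OF ch(1), of "x k" q ?d f] rep_at[OF ch(1) ch(2), of q ?d f] elim by (auto simp: h_def)
    then show ?case using elim by (simp add: center_norm_scale h_def)
  qed
  ultimately show ?thesis by (rule Lim_transform_eventually)
qed

text \<open>Compactness: a subsequence approaches one point of the finite set, and a further one does so from a
  limiting direction.\<close>

lemma sequence_approaching_F:
  assumes x: "\<And>k. x k \<notin> F" "\<And>k. dist_F (x k) < r" "(\<lambda>k. dist_F (x k)) \<longlonglongrightarrow> 0"
  obtains q s u where "q \<in> F" "strict_mono (s :: nat \<Rightarrow> nat)" "(\<lambda>k. x (s k)) \<longlonglongrightarrow> q" "center_norm q u = 1"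
    "(\<lambda>k. direction q (x (s k))) \<longlonglongrightarrow> u"
proof -
  have "\<forall>k. \<exists>q. q \<in> F \<and> dist_F (x k) = pdist q r (x k)" using dist_F_attained by blast
  from choice[OF this] obtain qq where qq: "\<And>k. qq k \<in> F" "\<And>k. dist_F (x k) = pdist (qq k) r (x k)" by blast
  obtain q where q: "q \<in> F" "infinite {k. qq k = q}"
  proof -
    have "finite (range qq)" using finite_subset[of "range qq" F] qq finite_F by blast
    from pigeonhole_infinite[OF infinite_UNIV_nat this] obtain k0 where "infinite {k. qq k = qq k0}" by auto
    then show ?thesis using qq(1)[of k0] by (intro that[of "qq k0"]) auto
  qed
  define s1 where "s1 = enumerate {k. qq k = q}"
  have s1: "strict_mono s1" "\<And>k. qq (s1 k) = q"
    using strict_mono_enumerate[OF q(2)] enumerate_in_set[OF q(2)] by (auto simp: s1_def)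
  define h where "h k = offset q (x (s1 k))" for k
  have pq: "pdist q r (x (s1 k)) = dist_F (x (s1 k))" for k using qq(2)[of "s1 k"] s1(2)[of k] by simp
  have nh: "x (s1 k) \<in> chart_dom (ch q)" "center_norm q (h k) = dist_F (x (s1 k))" for k
    using pdist_lessD[of q r "x (s1 k)"] x(2)[of "s1 k"] pq[of k] by (auto simp: h_def)
  have nhpos: "center_norm q (h k) > 0" for k using nh(2) dist_F_pos[OF x(1)] by simp
  have FDs: "(\<lambda>k. dist_F (x (s1 k))) \<longlonglongrightarrow> 0"
    using LIMSEQ_subseq_LIMSEQ[OF x(3) s1(1)] by (simp add: o_def)
  obtain m C where m: "m > 0" "\<And>a. m * norm a \<le> center_norm q a" using center_norm_comparable by metis
  have "h \<longlonglongrightarrow> 0"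
  proof (rule tendsto_norm_zero_cancel, rule tendsto_sandwich[of "\<lambda>_. 0" _ _ "\<lambda>k. dist_F (x (s1 k)) / m"])
    show "(\<lambda>k. dist_F (x (s1 k)) / m) \<longlonglongrightarrow> 0" using tendsto_divide[OF FDs tendsto_const, of m] m(1) by simp
    show "\<forall>\<^sub>F k in sequentially. norm (h k) \<le> dist_F (x (s1 k)) / m"
      using m nh(2) by (intro always_eventually allI) (simp add: pos_le_divide_eq mult.commute flip: nh(2))
  qed auto
  then have "(\<lambda>k. ctr q + h k) \<longlonglongrightarrow> ctr q + 0" by (intro tendsto_intros)
  then have "(\<lambda>k. chart_map (ch q) (x (s1 k))) \<longlonglongrightarrow> ctr q" by (simp add: h_def)
  from continuous_on_tendsto_compose[OF chart_continuous(2)[OF ch(1)] this ch(3)] nh(1)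
  have "(\<lambda>k. chart_inv (ch q) (chart_map (ch q) (x (s1 k)))) \<longlonglongrightarrow> chart_inv (ch q) (ctr q)" by auto
  then have xs: "(\<lambda>k. x (s1 k)) \<longlonglongrightarrow> q"
    by (simp add: chart_inv_map[OF ch(1) nh(1)] chart_inv_map[OF ch(1) ch(2)])
  let ?S = "{a. center_norm q a = 1}"
  have "closed ?S" by (rule closed_Collect_eq[OF center_norm_continuous continuous_on_const])
  moreover have "bounded ?S"
    unfolding bounded_iff
  proof (intro exI[of _ "1 / m"] ballI)
    fix a assume "a \<in> ?S"
    then have "m * norm a \<le> 1" using m(2)[of a] by simp
    then show "norm a \<le> 1 / m" using m(1) by (simp add: field_simps)
  qed
  ultimately have cS: "compact ?S" by (simp add: compact_eq_bounded_closed)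
  have inS: "\<forall>k. (1 / center_norm q (h k)) *\<^sub>R h k \<in> ?S"
  proof
    fix k show "(1 / center_norm q (h k)) *\<^sub>R h k \<in> ?S" using nhpos[of k] by (simp add: center_norm_scale)
  qed
  from cS[unfolded compact_def, rule_format, of "\<lambda>k. (1 / center_norm q (h k)) *\<^sub>R h k", OF spec[OF inS]]
  obtain u s2 where u: "u \<in> ?S" "strict_mono s2" "((\<lambda>k. (1 / center_norm q (h k)) *\<^sub>R h k) \<circ> s2) \<longlonglongrightarrow> u"
    by blast
  show ?thesis
  proof (rule that[of q "s1 \<circ> s2" u])
    show "strict_mono (s1 \<circ> s2)" using s1(1) u(2) by (rule strict_mono_o)
    show "(\<lambda>k. x ((s1 \<circ> s2) k)) \<longlonglongrightarrow> q" using LIMSEQ_subseq_LIMSEQ[OF xs u(2)] by (simp add: o_def)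
    show "(\<lambda>k. direction q (x ((s1 \<circ> s2) k))) \<longlonglongrightarrow> u"
      using u(3) by (simp add: o_def h_def)
  qed (use q u in auto)
qed

lemma tnorm_differential_center:
  assumes f: "Ck_map 2 A f"
  shows "tnorm g (f q) (differential A f q (tv (ch q) q u)) = center_norm (f q) (Dv (rep (ch q) (ch (f q)) f) (ctr q) u)"
  using differential_coord[OF f tv_tangent[OF some_chart_at] some_chart_at some_chart_at, of q u]
    tnorm_coord[OF _ some_chart_at, of "differential A f q (tv (ch q) q u)" "f q"] tv_self[OF some_chart_at, of q u]
  by (simp add: center_norm_def)

definition \<phi> :: "'m \<Rightarrow> real" where "\<phi> x = ln (r / dist_F x)"

lemma \<phi>_nonneg: "0 \<le> \<phi> x"
  using dist_F_le_r[of x] dist_F_nonneg[of x] by (cases "dist_F x = 0") (auto simp: \<phi>_def)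

lemma \<phi>_borel: "\<phi> \<in> borel_measurable borel"
proof -
  have "dist_F \<in> borel_measurable borel" by (rule borel_measurable_continuous_onI[OF dist_F_continuous])
  then show ?thesis unfolding \<phi>_def[abs_def] by measurable
qed

lemma \<phi>_diff: "x \<notin> F \<Longrightarrow> y \<notin> F \<Longrightarrow> \<phi> y - \<phi> x = - ln (dist_F y / dist_F x)"
  using dist_F_pos[of x] dist_F_pos[of y] r_pos by (simp add: \<phi>_def ln_div)

lemma \<phi>_less_iff: "x \<notin> F \<Longrightarrow> \<phi> x < T \<longleftrightarrow> r * exp (- T) < dist_F x"
proof -
  assume "x \<notin> F"
  then have p: "dist_F x > 0" by (rule dist_F_pos)
  have "\<phi> x < T \<longleftrightarrow> r / dist_F x < exp T"
    using p r_pos by (metis \<phi>_def divide_pos_pos exp_gt_zero ln_exp ln_less_cancel_iff)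
  also have "\<dots> \<longleftrightarrow> r * exp (- T) < dist_F x"
    using p by (simp add: exp_minus field_simps)
  finally show ?thesis .
qed

end

lemma (in compact_riemannian) Ck_diffeo_inv: "Ck_diffeo 2 A f \<Longrightarrow> Ck_diffeo 2 A (inv f)"
  by (simp add: Ck_diffeo_def bij_imp_bij_inv inv_inv_eq)

text \<open>The increments of \<open>\<phi>\<close> under \<open>f\<close> are bounded from above through \<open>f\<^sup>-\<^sup>1\<close> and from below through \<open>f\<close>. The lower
  bound on \<open>Lip\<close> is essential: it keeps both logarithms bounded below, so that each one is controlled by
  their sum.\<close>

lemma (in finite_invariant_set) \<phi>_change_le:
  obtains K where "\<And>f x. Ck_diffeo 2 A f \<Longrightarrow> f ` F = F \<Longrightarrow> x \<notin> F \<Longrightarrow>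
    \<bar>\<phi> (f x) - \<phi> x\<bar> \<le> K + (ln (C2_norm A g f) + ln (C2_norm A g (inv f)))"
proof -
  obtain C where C: "C \<ge> 1" "\<And>f x. Ck_map 2 A f \<Longrightarrow> f ` F \<subseteq> F \<Longrightarrow> dist_F (f x) \<le> C * max 1 (Lip f) * dist_F x"
    using dist_F_image_le by metis
  obtain c0 where c0: "c0 > 0" "\<And>f. Ck_diffeo 2 A f \<Longrightarrow> c0 \<le> Lip f" using Lip_ge by metis
  have log: "ln (C * max 1 (Lip f)) \<le> ln C + \<bar>ln c0\<bar> + ln (C2_norm A g f)" "0 \<le> \<bar>ln c0\<bar> + ln (C2_norm A g f)"
    if f: "Ck_diffeo 2 A f" for f
  proof -
    have L: "c0 \<le> Lip f" "Lip f \<le> C2_norm A g f" using c0(2)[OF f] Lip_le_C2_norm[OF Ck_diffeoD(1)[OF f]] .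
    then have "ln (Lip f) \<le> ln (C2_norm A g f)" "ln c0 \<le> ln (Lip f)" using c0(1) by simp_all
    moreover have "ln (max 1 (Lip f)) \<le> ln (Lip f) + \<bar>ln c0\<bar>"
      using calculation by (cases "1 \<le> Lip f") (auto simp: max_def)
    moreover have "ln (C * max 1 (Lip f)) = ln C + ln (max 1 (Lip f))"
      using C(1) by (intro ln_mult_pos) auto
    ultimately show "ln (C * max 1 (Lip f)) \<le> ln C + \<bar>ln c0\<bar> + ln (C2_norm A g f)"
      "0 \<le> \<bar>ln c0\<bar> + ln (C2_norm A g f)" by linarith+
  qed
  have upper: "\<phi> x - \<phi> (f x) \<le> ln C + \<bar>ln c0\<bar> + ln (C2_norm A g f)"
    if f: "Ck_diffeo 2 A f" "f ` F = F" and x: "x \<notin> F" "f x \<notin> F" for f x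
  proof -
    note p = dist_F_pos[OF x(1)] dist_F_pos[OF x(2)]
    have "dist_F (f x) / dist_F x \<le> C * max 1 (Lip f)"
      using C(2)[OF Ck_diffeoD(1)[OF f(1)], of x] f(2) p by (simp add: divide_le_eq)
    then have "ln (dist_F (f x) / dist_F x) \<le> ln (C * max 1 (Lip f))"
      using p C(1) by (subst ln_le_cancel_iff) (auto intro!: mult_pos_pos)
    then show ?thesis using \<phi>_diff[OF x] log[OF f(1)] by linarith
  qed
  show ?thesis
  proof (rule that[of "ln C + 2 * \<bar>ln c0\<bar>"])
    fix f x assume f: "Ck_diffeo 2 A f" "f ` F = F" and x: "x \<notin> F"
    have bij: "bij f" using f(1) by (rule Ck_diffeoD)
    have fx: "f x \<notin> F"
    proof
      assume "f x \<in> F"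
      then obtain y where "y \<in> F" "f x = f y" using f(2) by (metis imageE)
      then show False using x bij_is_inj[OF bij] by (metis injD)
    qed
    have fi: "Ck_diffeo 2 A (inv f)" "inv f ` F = F" "inv f (f x) = x"
      using Ck_diffeo_inv[OF f(1)] image_inv_f_f[OF bij_is_inj[OF bij], of F] f(2) bij_is_inj[OF bij] by auto
    have "\<phi> x - \<phi> (f x) \<le> ln C + \<bar>ln c0\<bar> + ln (C2_norm A g f)" by (rule upper[OF f x fx])
    moreover have "\<phi> (f x) - \<phi> x \<le> ln C + \<bar>ln c0\<bar> + ln (C2_norm A g (inv f))"
      using upper[OF fi(1,2) fx] x fi(3) by simp
    ultimately show "\<bar>\<phi> (f x) - \<phi> x\<bar> \<le> ln C + 2 * \<bar>ln c0\<bar> + (ln (C2_norm A g f) + ln (C2_norm A g (inv f)))"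
      using log(2)[OF f(1)] log(2)[OF fi(1)] by linarith
  qed
qed

section \<open>Drift and recurrence\<close>

text \<open>The function \<open>\<xi>\<close> dominates the increments of \<open>\<phi>\<close>. It stands for the sum of the logarithms of the
  \<open>C\<^sup>2\<close> norms of \<open>f\<close> and \<open>f\<^sup>-\<^sup>1\<close>, up to a constant, and turns the moment condition into a form free of geometry.\<close>

locale expanding_system = random_maps \<nu> + finite_invariant_set A g F r
  for \<nu> :: "('m::{t2_space, second_countable_topology} \<Rightarrow> 'm) measure"
    and A :: "('m, 'e::euclidean_space) chart set" and g :: "('m, 'e) metric" and F :: "'m set" and r :: real +
  fixes \<xi> :: "('m \<Rightarrow> 'm) \<Rightarrow> real" and p c :: real and n0 :: nat
  assumes diffeo: "\<And>f. f \<in> space \<nu> \<Longrightarrow> Ck_diffeo 2 A f"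
    and image_F: "\<And>f. f \<in> space \<nu> \<Longrightarrow> f ` F = F"
    and xi_meas: "\<xi> \<in> borel_measurable \<nu>"
    and xi: "\<And>f x. f \<in> space \<nu> \<Longrightarrow> x \<notin> F \<Longrightarrow> \<bar>\<phi> (f x) - \<phi> x\<bar> \<le> \<xi> f"
    and p: "1 < p" "p \<le> 2" and xi_powr: "integrable \<nu> (\<lambda>f. \<bar>\<xi> f\<bar> powr p)"
    and c: "0 < c" and n0: "1 \<le> n0"
    and expanding: "\<And>q v. q \<in> F \<Longrightarrow> v \<in> tangent_space A q - {zero_tvec} \<Longrightarrow>
      c \<le> (\<integral>f. ln (tnorm g (f q) (differential A f q v) / tnorm g q v) \<partial>conv_power \<nu> n0)"
begin

lemma compl_invariant:
  assumes "f \<in> space \<nu>" "x \<notin> F"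
  shows "f x \<notin> F"
proof
  assume "f x \<in> F"
  then obtain y where "y \<in> F" "f x = f y" using image_F[OF assms(1)] by (metis imageE)
  moreover have "inj f" using Ck_diffeoD(3)[OF diffeo[OF assms(1)]] by (rule bij_is_inj)
  ultimately show False using assms(2) by (metis injD)
qed

lemma iterate_compl: "\<omega> \<in> space S \<Longrightarrow> x \<notin> F \<Longrightarrow> random_iterate \<omega> n x \<notin> F"
  using compl_invariant[OF random_iterate_in_space] .

lemma \<phi>_eval[measurable]: "(\<lambda>f. \<phi> (f x)) \<in> borel_measurable \<nu>"
  by (rule measurable_compose[OF eval_measurable \<phi>_borel])

lemma \<phi>_iterate[measurable]: "(\<lambda>\<omega>. \<phi> (random_iterate \<omega> n x)) \<in> borel_measurable S"
  by (rule measurable_compose[OF orbit_measurable \<phi>_borel])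

definition mean_xi :: real where "mean_xi = (\<integral>f. \<bar>\<xi> f\<bar> \<partial>\<nu>)"

lemma mean_xi_nonneg: "0 \<le> mean_xi" by (simp add: mean_xi_def)

lemma xi_integrable: "integrable \<nu> (\<lambda>f. \<bar>\<xi> f\<bar>)"
  using M.integrable_of_powr[OF xi_meas xi_powr, of 1] p by simp

lemma xi_coordinate:
  shows "integrable S (\<lambda>\<omega>. \<bar>\<xi> (\<omega> i)\<bar>)" "(\<integral>\<omega>. \<bar>\<xi> (\<omega> i)\<bar> \<partial>S) = mean_xi"
proof -
  have d: "distr S \<nu> (\<lambda>\<omega>. \<omega> i) = \<nu>" using PiM_component[of i] by simp
  have m: "(\<lambda>\<omega>. \<omega> i) \<in> measurable S \<nu>" by simp
  show "integrable S (\<lambda>\<omega>. \<bar>\<xi> (\<omega> i)\<bar>)"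
    by (rule integrable_distr[OF m]) (simp only: d xi_integrable)
  show "(\<integral>\<omega>. \<bar>\<xi> (\<omega> i)\<bar> \<partial>S) = mean_xi"
    using integral_distr[OF m, of "\<lambda>f. \<bar>\<xi> f\<bar>"] xi_meas by (simp add: d mean_xi_def)
qed

lemma xi_sum:
  shows "integrable S (\<lambda>\<omega>. \<Sum>i<n. \<bar>\<xi> (\<omega> i)\<bar>)" "(\<integral>\<omega>. (\<Sum>i<n. \<bar>\<xi> (\<omega> i)\<bar>) \<partial>S) = real n * mean_xi"
  using xi_coordinate by (simp_all add: Bochner_Integration.integral_sum)

lemma iterate_bound:
  assumes "\<omega> \<in> space S" "x \<notin> F"
  shows "\<bar>\<phi> (random_iterate \<omega> n x) - \<phi> x\<bar> \<le> (\<Sum>i<n. \<bar>\<xi> (\<omega> i)\<bar>)"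
proof (induction n)
  case (Suc n)
  have "\<omega> n \<in> space \<nu>" using assms(1) by (auto simp: space_PiM)
  from xi[OF this iterate_compl[OF assms, of n]]
  have "\<bar>\<phi> (random_iterate \<omega> (Suc n) x) - \<phi> (random_iterate \<omega> n x)\<bar> \<le> \<bar>\<xi> (\<omega> n)\<bar>" by simp
  with Suc show ?case by simp
qed simp

definition \<Phi> :: "nat \<Rightarrow> 'm \<Rightarrow> real" where
  "\<Phi> n x = (\<integral>\<omega>. \<phi> (random_iterate \<omega> n x) \<partial>S)"

lemma \<Phi>_0: "\<Phi> 0 x = \<phi> x"
  by (simp add: \<Phi>_def P.prob_space)

lemma \<phi>_iterate_integrable:
  assumes "x \<notin> F"
  shows "integrable S (\<lambda>\<omega>. \<phi> (random_iterate \<omega> n x))"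
proof (rule Bochner_Integration.integrable_bound)
  show "integrable S (\<lambda>\<omega>. \<phi> x + (\<Sum>i<n. \<bar>\<xi> (\<omega> i)\<bar>))" using xi_sum(1) by simp
  show "AE \<omega> in S. norm (\<phi> (random_iterate \<omega> n x)) \<le> norm (\<phi> x + (\<Sum>i<n. \<bar>\<xi> (\<omega> i)\<bar>))"
  proof (rule AE_I2)
    fix \<omega> assume "\<omega> \<in> space S"
    from iterate_bound[OF this assms, of n] \<phi>_nonneg[of x] \<phi>_nonneg[of "random_iterate \<omega> n x"]
    show "norm (\<phi> (random_iterate \<omega> n x)) \<le> norm (\<phi> x + (\<Sum>i<n. \<bar>\<xi> (\<omega> i)\<bar>))" by simp
  qed
qed simp

lemma \<Phi>_diff: "x \<notin> F \<Longrightarrow> (\<integral>\<omega>. \<phi> (random_iterate \<omega> n x) - \<phi> x \<partial>S) = \<Phi> n x - \<phi> x"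
  using \<phi>_iterate_integrable by (simp add: \<Phi>_def P.prob_space)

lemma \<Phi>_near:
  assumes "x \<notin> F"
  shows "\<bar>\<Phi> n x - \<phi> x\<bar> \<le> real n * mean_xi"
proof -
  have "\<bar>\<integral>\<omega>. \<phi> (random_iterate \<omega> n x) - \<phi> x \<partial>S\<bar> \<le> (\<integral>\<omega>. \<bar>\<phi> (random_iterate \<omega> n x) - \<phi> x\<bar> \<partial>S)"
    by (rule integral_abs_bound)
  also have "\<dots> \<le> (\<integral>\<omega>. (\<Sum>i<n. \<bar>\<xi> (\<omega> i)\<bar>) \<partial>S)"
    by (intro integral_mono xi_sum(1) iterate_bound[OF _ assms]) (use \<phi>_iterate_integrable[OF assms] in simp_all)
  finally show ?thesis by (simp add: \<Phi>_diff[OF assms] xi_sum(2))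
qed

lemma \<Phi>_nonneg: "0 \<le> \<Phi> n x"
  unfolding \<Phi>_def by (intro integral_nonneg_AE) (simp add: \<phi>_nonneg)

lemma \<Phi>_eval[measurable]: "(\<lambda>f. \<Phi> n (f x)) \<in> borel_measurable \<nu>"
proof -
  have "(\<lambda>z. \<phi> ((random_iterate (snd z) n \<circ> fst z) x)) \<in> borel_measurable (\<nu> \<Otimes>\<^sub>M S)"
    by (rule measurable_compose[OF _ \<phi>_eval]) (rule comp_measurable', simp_all)
  then have "(\<lambda>(f, \<omega>). \<phi> (random_iterate \<omega> n (f x))) \<in> borel_measurable (\<nu> \<Otimes>\<^sub>M S)"
    by (simp add: split_beta')
  then show ?thesis unfolding \<Phi>_def by (rule P.borel_measurable_lebesgue_integral)
qed

lemma \<Phi>_step: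
  assumes x: "x \<notin> F"
  shows "integrable \<nu> (\<lambda>f. \<Phi> n (f x))" "(\<integral>f. \<Phi> n (f x) \<partial>\<nu>) = \<Phi> (Suc n) x"
proof -
  have e: "(\<integral>\<^sup>+\<omega>. ennreal (\<phi> (random_iterate \<omega> n y)) \<partial>S) = ennreal (\<Phi> n y)" if "y \<notin> F" for n y
    unfolding \<Phi>_def by (rule nn_integral_eq_integral[OF \<phi>_iterate_integrable[OF that]]) (simp add: \<phi>_nonneg)
  have "ennreal (\<Phi> (Suc n) x) = (\<integral>\<^sup>+\<omega>. ennreal (\<phi> (random_iterate \<omega> (Suc n) x)) \<partial>S)" by (rule e[OF x, symmetric])
  also have "\<dots> = (\<integral>\<^sup>+f. \<integral>\<^sup>+\<omega>. ennreal (\<phi> (random_iterate \<omega> n (f x))) \<partial>S \<partial>\<nu>)"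
    by (rule first_step) measurable
  also have "\<dots> = (\<integral>\<^sup>+f. ennreal (\<Phi> n (f x)) \<partial>\<nu>)"
    by (rule nn_integral_cong, rule e, rule compl_invariant[OF _ x])
  finally have eq: "(\<integral>\<^sup>+f. ennreal (\<Phi> n (f x)) \<partial>\<nu>) = ennreal (\<Phi> (Suc n) x)" ..
  show "integrable \<nu> (\<lambda>f. \<Phi> n (f x))"
    by (rule integrableI_nonneg) (simp_all add: eq \<Phi>_nonneg)
  show "(\<integral>f. \<Phi> n (f x) \<partial>\<nu>) = \<Phi> (Suc n) x"
    by (subst integral_eq_nn_integral) (simp_all add: eq \<Phi>_nonneg)
qed

text \<open>The domination by \<open>\<xi>\<close> bounds the ratios of distances away from 0, so their limit
  \<open>\<parallel>Df v\<parallel> / \<parallel>v\<parallel>\<close> is positive and one may pass to logarithms.\<close>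

lemma log_expansion_limit:
  assumes q: "q \<in> F" and x: "x \<longlonglongrightarrow> q" "\<And>k. x k \<notin> F" and u1: "center_norm q u = 1"
    and u: "(\<lambda>k. direction q (x k)) \<longlonglongrightarrow> u"
    and f: "f \<in> space \<nu>"
  shows "(\<lambda>k. \<phi> (f (x k)) - \<phi> (x k)) \<longlonglongrightarrow>
    - ln (tnorm g (f q) (differential A f q (tv (ch q) q u)) / tnorm g q (tv (ch q) q u))"
proof -
  have C2: "Ck_map 2 A f" by (rule Ck_diffeoD[OF diffeo[OF f]])
  have fq: "f q \<in> F" using image_F[OF f] q by blast
  let ?l = "center_norm (f q) (Dv (rep (ch q) (ch (f q)) f) (ctr q) u)"
  have lim: "(\<lambda>k. dist_F (f (x k)) / dist_F (x k)) \<longlonglongrightarrow> ?l" by (rule dist_F_ratio_limit[OF C2 q fq x u])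
  have "exp (- \<xi> f) \<le> dist_F (f (x k)) / dist_F (x k)" for k
  proof -
    have pos: "dist_F (f (x k)) / dist_F (x k) > 0" using dist_F_pos[OF x(2)] dist_F_pos[OF compl_invariant[OF f x(2)]] by simp
    have "- \<xi> f \<le> ln (dist_F (f (x k)) / dist_F (x k))"
      using xi[OF f x(2)[of k]] \<phi>_diff[OF x(2) compl_invariant[OF f x(2)], of k k] by linarith
    then show ?thesis using pos by (metis exp_le_cancel_iff exp_ln)
  qed
  then have "exp (- \<xi> f) \<le> ?l" by (intro LIMSEQ_le_const[OF lim]) auto
  then have "?l > 0" using exp_gt_zero[of "- \<xi> f"] by linarith
  then have "(\<lambda>k. - ln (dist_F (f (x k)) / dist_F (x k))) \<longlonglongrightarrow> - ln ?l"
    by (intro tendsto_intros lim) auto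
  moreover have "tnorm g (f q) (differential A f q (tv (ch q) q u)) / tnorm g q (tv (ch q) q u) = ?l"
    by (simp add: tnorm_differential_center[OF C2] tnorm_tv_center u1)
  moreover have "- ln (dist_F (f (x k)) / dist_F (x k)) = \<phi> (f (x k)) - \<phi> (x k)" for k
    using \<phi>_diff[OF x(2) compl_invariant[OF f x(2)], of k k] by simp
  ultimately show ?thesis by simp
qed

text \<open>If the drift failed arbitrarily close to \<open>F\<close>, a sequence of such points would approach some \<open>q \<in> F\<close> from a limiting
  direction \<open>v\<close>. By dominated convergence its drifts would tend to the negative of the expansion integral
  at \<open>v\<close>, which is at most \<open>- c\<close>.\<close>

lemma drift_near_F: "\<exists>R. \<forall>x. x \<notin> F \<longrightarrow> \<phi> x > R \<longrightarrow> \<Phi> n0 x - \<phi> x \<le> - (c / 2)"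
proof (rule ccontr)
  assume contra: "\<not> ?thesis"
  have "\<exists>x. x \<notin> F \<and> \<phi> x > real k \<and> \<Phi> n0 x - \<phi> x > - (c / 2)" for k :: nat
    using contra by (meson not_le)
  then obtain x where x: "\<And>k. x k \<notin> F" "\<And>k. \<phi> (x k) > real k" "\<And>k. \<Phi> n0 (x k) - \<phi> (x k) > - (c / 2)"
    by metis
  have le: "dist_F (x k) \<le> r * exp (- real k)" for k
    using \<phi>_less_iff[OF x(1), of k "real k"] x(2)[of k] by (meson not_le less_imp_not_less)
  have lr: "dist_F (x k) < r" for k
  proof -
    have "dist_F (x k) \<noteq> r" using x(2)[of k] r_pos by (auto simp: \<phi>_def)
    then show ?thesis using dist_F_le_r[of "x k"] by simp
  qed
  have lim0: "(\<lambda>k. dist_F (x k)) \<longlonglongrightarrow> 0"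
  proof (rule tendsto_sandwich[of "\<lambda>_. 0" _ _ "\<lambda>k. r * exp (- real k)"])
    have "(\<lambda>k. exp (- 1) ^ k) \<longlonglongrightarrow> (0::real)" by (rule LIMSEQ_power_zero) simp
    then have "(\<lambda>k. exp (- real k)) \<longlonglongrightarrow> 0" by (simp add: exp_of_nat_mult[symmetric])
    from tendsto_mult_right_zero[OF this] show "(\<lambda>k. r * exp (- real k)) \<longlonglongrightarrow> 0" .
  qed (use le dist_F_nonneg in auto)
  obtain q s u where qs: "q \<in> F" "strict_mono s" "(\<lambda>k. x (s k)) \<longlonglongrightarrow> q" "center_norm q u = 1"
    "(\<lambda>k. direction q (x (s k))) \<longlonglongrightarrow> u"
    by (rule sequence_approaching_F[OF x(1) lr lim0])
  define y where "y k = x (s k)" for k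
  have y: "y k \<notin> F" for k by (simp add: y_def x)
  let ?v = "tv (ch q) q u"
  let ?L = "\<lambda>f. ln (tnorm g (f q) (differential A f q ?v) / tnorm g q ?v)"
  have lim: "(\<lambda>k. \<phi> (f (y k)) - \<phi> (y k)) \<longlonglongrightarrow> - ?L f" if "f \<in> space \<nu>" for f
    using log_expansion_limit[OF qs(1,3) _ qs(4,5) that] x(1) by (simp add: y_def)
  have Lm0: "(\<lambda>f. - ?L f) \<in> borel_measurable \<nu>"
    by (rule borel_measurable_LIMSEQ_real[where u = "\<lambda>k f. \<phi> (f (y k)) - \<phi> (y k)"]) (use lim in auto)
  then have Lm: "?L \<in> borel_measurable \<nu>" using borel_measurable_uminus_eq by fastforce
  have "(\<lambda>k. \<integral>\<omega>. \<phi> (random_iterate \<omega> n0 (y k)) - \<phi> (y k) \<partial>S) \<longlonglongrightarrow> (\<integral>\<omega>. - ?L (random_iterate \<omega> n0) \<partial>S)"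
  proof (rule integral_dominated_convergence[where w = "\<lambda>\<omega>. \<Sum>i<n0. \<bar>\<xi> (\<omega> i)\<bar>"])
    show "(\<lambda>\<omega>. - ?L (random_iterate \<omega> n0)) \<in> borel_measurable S"
      by (rule measurable_compose[OF random_iterate_measurable Lm0])
    show "AE \<omega> in S. (\<lambda>k. \<phi> (random_iterate \<omega> n0 (y k)) - \<phi> (y k)) \<longlonglongrightarrow> - ?L (random_iterate \<omega> n0)"
      by (intro AE_I2 lim random_iterate_in_space)
    show "AE \<omega> in S. norm (\<phi> (random_iterate \<omega> n0 (y k)) - \<phi> (y k)) \<le> (\<Sum>i<n0. \<bar>\<xi> (\<omega> i)\<bar>)" for k
      using iterate_bound[OF _ y] by (intro AE_I2) simp
  qed (use xi_sum in simp_all)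
  moreover have "- (c / 2) \<le> (\<integral>\<omega>. \<phi> (random_iterate \<omega> n0 (y k)) - \<phi> (y k) \<partial>S)" for k
    using x(3)[of "s k"] \<Phi>_diff[OF y[of k], of n0] by (simp add: y_def)
  ultimately have "- (c / 2) \<le> (\<integral>\<omega>. - ?L (random_iterate \<omega> n0) \<partial>S)"
    by (intro LIMSEQ_le_const) auto
  also have "\<dots> = - (\<integral>\<omega>. ?L (random_iterate \<omega> n0) \<partial>S)" by simp
  also have "(\<integral>\<omega>. ?L (random_iterate \<omega> n0) \<partial>S) = (\<integral>f. ?L f \<partial>conv_power \<nu> n0)"
    unfolding conv_power_eq_distr by (rule integral_distr[OF random_iterate_measurable Lm, symmetric])
  finally have "(\<integral>f. ?L f \<partial>conv_power \<nu> n0) \<le> c / 2" by simp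
  moreover have "?v \<in> tangent_space A q - {zero_tvec}"
    using tv_tangent[OF some_chart_at] tv_eq_zero_iff[OF some_chart_at, of q u] qs(4) center_norm_0 by auto
  ultimately show False using expanding[OF qs(1), of ?v] c by linarith
qed

text \<open>Averaging over \<open>n0\<close> consecutive times telescopes: the one-step drift of \<open>\<psi>\<close> is the drift of \<open>\<phi>\<close> over \<open>n0\<close> steps,
  divided by \<open>n0\<close>.\<close>

definition \<psi> :: "'m \<Rightarrow> real" where
  "\<psi> x = (\<Sum>j<n0. \<Phi> j x) / real n0"

lemma \<psi>_nonneg: "0 \<le> \<psi> x"
  unfolding \<psi>_def by (intro divide_nonneg_nonneg sum_nonneg \<Phi>_nonneg) simp

lemma \<psi>_eval[measurable]: "(\<lambda>f. \<psi> (f x)) \<in> borel_measurable \<nu>"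
  unfolding \<psi>_def by measurable

lemma \<psi>_near:
  assumes x: "x \<notin> F"
  shows "\<bar>\<psi> x - \<phi> x\<bar> \<le> real n0 * mean_xi"
proof -
  have "\<psi> x - \<phi> x = (\<Sum>j<n0. \<Phi> j x - \<phi> x) / real n0"
    using n0 by (simp add: \<psi>_def sum_subtractf field_simps)
  also have "\<bar>\<dots>\<bar> \<le> (\<Sum>j<n0. \<bar>\<Phi> j x - \<phi> x\<bar>) / real n0"
    by (simp add: divide_right_mono sum_abs)
  also have "\<dots> \<le> (\<Sum>j<n0. real n0 * mean_xi) / real n0"
    using mean_xi_nonneg by (intro divide_right_mono sum_mono order.trans[OF \<Phi>_near[OF x]] mult_right_mono) auto
  also have "\<dots> = real n0 * mean_xi" using n0 by simp
  finally show ?thesis .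
qed

lemma \<psi>_drift:
  assumes x: "x \<notin> F"
  shows "integrable \<nu> (\<lambda>f. \<psi> (f x) - \<psi> x)" "(\<integral>f. \<psi> (f x) - \<psi> x \<partial>\<nu>) = (\<Phi> n0 x - \<phi> x) / real n0"
proof -
  have i: "integrable \<nu> (\<lambda>f. \<psi> (f x))"
    unfolding \<psi>_def using \<Phi>_step(1)[OF x] by simp
  then show "integrable \<nu> (\<lambda>f. \<psi> (f x) - \<psi> x)" by simp
  have "(\<integral>f. \<psi> (f x) - \<psi> x \<partial>\<nu>) = (\<integral>f. \<psi> (f x) \<partial>\<nu>) - \<psi> x" using i by (simp add: M.prob_space)
  also have "(\<integral>f. \<psi> (f x) \<partial>\<nu>) = (\<Sum>j<n0. \<Phi> (Suc j) x) / real n0"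
    unfolding \<psi>_def using \<Phi>_step[OF x] by (simp add: Bochner_Integration.integral_sum)
  also have "\<dots> - \<psi> x = (\<Sum>j<n0. \<Phi> (Suc j) x - \<Phi> j x) / real n0"
    by (simp add: \<psi>_def sum_subtractf diff_divide_distrib)
  also have "(\<Sum>j<n0. \<Phi> (Suc j) x - \<Phi> j x) = \<Phi> n0 x - \<phi> x"
    using sum_lessThan_telescope[of "\<lambda>j. \<Phi> j x" n0] by (simp only: \<Phi>_0)
  finally show "(\<integral>f. \<psi> (f x) - \<psi> x \<partial>\<nu>) = (\<Phi> n0 x - \<phi> x) / real n0" .
qed

text \<open>The functions \<open>\<phi>\<close> and \<open>\<psi>\<close> stay within \<open>n0 * mean_xi\<close> of each other, so the moments of \<open>\<xi>\<close> control the increments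
  of \<open>\<psi>\<close> as well.\<close>

lemma \<psi>_increment:
  assumes x: "x \<notin> F" and f: "f \<in> space \<nu>"
  shows "\<bar>\<psi> (f x) - \<psi> x\<bar> \<le> \<bar>\<xi> f\<bar> + 2 * (real n0 * mean_xi)"
  using \<psi>_near[OF x] \<psi>_near[OF compl_invariant[OF f x]] xi[OF f x] by linarith

lemma \<psi>_powr_drift:
  obtains c' b where "0 < c'" "0 \<le> b"
    "\<And>x. x \<notin> F \<Longrightarrow> integrable \<nu> (\<lambda>f. \<psi> (f x) powr p)"
    "\<And>x. x \<notin> F \<Longrightarrow> (\<integral>f. \<psi> (f x) powr p \<partial>\<nu>) \<le> \<psi> x powr p - c' * p * \<psi> x powr (p - 1) + b"
proof -
  let ?\<xi> = "\<lambda>f. \<bar>\<xi> f\<bar> + 2 * (real n0 * mean_xi)"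
  note [measurable] = xi_meas
  have int: "integrable \<nu> (\<lambda>f. \<bar>?\<xi> f\<bar> powr p)"
  proof (rule Bochner_Integration.integrable_bound)
    show "integrable \<nu> (\<lambda>f. 2 powr p * (\<bar>\<xi> f\<bar> powr p + (2 * (real n0 * mean_xi)) powr p))"
      using xi_powr by simp
    show "AE f in \<nu>. norm (\<bar>?\<xi> f\<bar> powr p) \<le> norm (2 powr p * (\<bar>\<xi> f\<bar> powr p + (2 * (real n0 * mean_xi)) powr p))"
    proof (rule AE_I2)
      fix f
      let ?a = "\<bar>\<xi> f\<bar>" and ?b = "2 * (real n0 * mean_xi)"
      have b0: "0 \<le> ?b" using mean_xi_nonneg by simp
      show "norm (\<bar>?\<xi> f\<bar> powr p) \<le> norm (2 powr p * (\<bar>\<xi> f\<bar> powr p + ?b powr p))"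
        using powr_add_le[of ?a ?b p] b0 p by simp
    qed
  qed measurable
  obtain R0 where R0: "\<And>x. x \<notin> F \<Longrightarrow> \<phi> x > R0 \<Longrightarrow> \<Phi> n0 x - \<phi> x \<le> - (c / 2)" using drift_near_F by blast
  define R where "R = max 0 (R0 + real n0 * mean_xi)"
  define c' where "c' = c / 2 / real n0"
  have c': "0 < c'" using c n0 by (simp add: c'_def)
  have dr: "(\<integral>f. \<psi> (f x) - \<psi> x \<partial>\<nu>) \<le> - c'" if x: "x \<notin> F" and "\<psi> x > R" for x
  proof -
    have "\<phi> x > R0" using \<psi>_near[OF x] \<open>\<psi> x > R\<close> unfolding R_def by linarith
    from R0[OF x this] have "(\<Phi> n0 x - \<phi> x) / real n0 \<le> - (c / 2) / real n0"
      by (intro divide_right_mono) auto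
    then show ?thesis unfolding \<psi>_drift(2)[OF x] by (simp add: c'_def)
  qed
  note D = M.drift_powr[where \<xi> = ?\<xi> and R = R and c = c' and p = p, OF \<psi>_eval _ \<psi>_nonneg \<psi>_nonneg _ p int]
  show ?thesis
  proof (rule that[OF c'])
    let ?b = "p * (\<integral>f. \<bar>?\<xi> f\<bar> powr p \<partial>\<nu>) + p * R powr (p - 1) * ((\<integral>f. \<bar>?\<xi> f\<bar> \<partial>\<nu>) + c')"
    show "0 \<le> ?b" using p c' by (intro add_nonneg_nonneg mult_nonneg_nonneg Bochner_Integration.integral_nonneg) auto
    fix x assume x: "x \<notin> F"
    show "integrable \<nu> (\<lambda>f. \<psi> (f x) powr p)"
      by (rule D(1)) (use \<psi>_increment[OF x] dr[OF x] c' in \<open>auto simp: R_def\<close>)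
    show "(\<integral>f. \<psi> (f x) powr p \<partial>\<nu>) \<le> \<psi> x powr p - c' * p * \<psi> x powr (p - 1) + ?b"
      by (rule D(2)) (use \<psi>_increment[OF x] dr[OF x] c' in \<open>auto simp: R_def\<close>)
  qed
qed

text \<open>The set \<open>K\<close> contains all points outside \<open>F\<close> with \<open>\<psi> < T\<close>. It is defined through the distance to \<open>F\<close>, which is
  continuous on the whole manifold, so that its compactness is evident.\<close>

theorem recurrence:
  assumes x: "x \<notin> F" and e: "0 < e"
  shows "\<exists>K. compact K \<and> K \<subseteq> - F \<and>
     (\<exists>N::nat. \<exists>V. open V \<and> x \<in> V \<and> V \<subseteq> - F \<and>
        (\<forall>y\<in>V. \<forall>n\<ge>N. measure (conv_dirac (conv_power \<nu> n) y) K \<ge> 1 - e)) \<and>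
     (AE \<omega> in S. limsup (\<lambda>n. ereal (real (card {k \<in> {1..n}. random_iterate \<omega> k x \<in> K}) / real n)) \<ge> ereal (1 - e))"
proof -
  obtain c' b where cb: "0 < c'" "0 \<le> b"
    "\<And>x. x \<notin> F \<Longrightarrow> integrable \<nu> (\<lambda>f. \<psi> (f x) powr p)"
    "\<And>x. x \<notin> F \<Longrightarrow> (\<integral>f. \<psi> (f x) powr p \<partial>\<nu>) \<le> \<psi> x powr p - c' * p * \<psi> x powr (p - 1) + b"
    using \<psi>_powr_drift by metis
  have e16: "0 < e / 16" using e by simp
  obtain T where T: "0 < T"
    "\<And>K y n. K \<in> sets borel \<Longrightarrow> (\<And>z. z \<in> - F \<Longrightarrow> \<psi> z < T \<Longrightarrow> z \<in> K) \<Longrightarrow> y \<in> - F \<Longrightarrow>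
       measure S {\<omega>\<in>space S. random_iterate \<omega> n y \<notin> K} \<le> (\<psi> y / (T + c' * real n)) powr p + e / 16"
    by (rule uniform_tightness[of "- F" \<psi> p c' b "e / 16"])
      (use compl_invariant \<psi>_nonneg p cb e16 in auto)
  define K where "K = {z. r * exp (- (T + real n0 * mean_xi)) \<le> dist_F z}"
  have Kcl: "closed K" unfolding K_def by (intro closed_Collect_le continuous_on_const dist_F_continuous)
  have Kco: "compact K" using closed_Int_compact[OF Kcl compact] by simp
  have KF: "K \<subseteq> - F"
  proof
    fix z assume "z \<in> K"
    then have "0 < dist_F z" unfolding K_def using r_pos by (auto intro: less_le_trans[rotated])
    then show "z \<in> - F" using dist_F_eq_0 by force
  qed
  have Kb: "K \<in> sets borel" using Kcl by (rule borel_closed)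
  have Kin: "z \<in> K" if z: "z \<in> - F" "\<psi> z < T" for z
  proof -
    have zF: "z \<notin> F" using z by simp
    have "\<phi> z < T + real n0 * mean_xi" using \<psi>_near[OF zF] z(2) by linarith
    then show ?thesis unfolding K_def \<phi>_less_iff[OF zF] by simp
  qed
  have bound: "\<exists>N. \<forall>y. y \<notin> F \<longrightarrow> \<psi> y \<le> B \<longrightarrow> (\<forall>n\<ge>N. measure S {\<omega>\<in>space S. random_iterate \<omega> n y \<notin> K} \<le> e / 8)" for B
  proof -
    define t where "t = (e / 16) powr (1 / p)"
    have t: "0 < t" "t powr p = e / 16" using e p by (simp_all add: t_def powr_powr)
    obtain N :: nat where N: "\<bar>B\<bar> / (t * c') \<le> real N" using real_arch_simple by blast
    have "measure S {\<omega>\<in>space S. random_iterate \<omega> n y \<notin> K} \<le> e / 8"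
      if y: "y \<notin> F" "\<psi> y \<le> B" and n: "n \<ge> N" for y n
    proof -
      have pos: "0 < T + c' * real n" using T cb by (simp add: add_pos_nonneg)
      have "\<bar>B\<bar> \<le> t * c' * real N" using N t cb by (simp add: field_simps)
      also have "\<dots> \<le> t * c' * real n" using n t cb by (intro mult_left_mono) auto
      also have "\<dots> \<le> t * (T + c' * real n)" using t T by (simp add: algebra_simps)
      finally have "\<psi> y / (T + c' * real n) \<le> t" using y pos by (simp add: divide_le_eq)
      then have "(\<psi> y / (T + c' * real n)) powr p \<le> t powr p"
        using \<psi>_nonneg[of y] pos p by (intro powr_mono2) auto
      then have "(\<psi> y / (T + c' * real n)) powr p \<le> e / 16" by (simp add: t)
      with T(2)[OF Kb Kin, of y n] y show ?thesis by simp
    qed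
    then show ?thesis by blast
  qed
  (* A neighbourhood of x on which psi is bounded, which makes N uniform there. *)
  define V where "V = {y. dist_F x / 2 < dist_F y}"
  have V: "open V" unfolding V_def by (intro open_Collect_less continuous_on_const dist_F_continuous)
  have FDx: "0 < dist_F x" by (rule dist_F_pos[OF x])
  have VF: "V \<subseteq> - F"
  proof
    fix y assume "y \<in> V"
    then have "0 < dist_F y" using FDx by (simp add: V_def)
    then show "y \<in> - F" using dist_F_eq_0 by force
  qed
  define B where "B = ln (r / (dist_F x / 2)) + real n0 * mean_xi"
  have VB: "\<psi> y \<le> B" if "y \<in> V" for y
  proof -
    have y: "y \<notin> F" "dist_F x / 2 < dist_F y" using that VF by (auto simp: V_def)
    have "r / dist_F y \<le> r / (dist_F x / 2)" using y FDx r_pos by (intro divide_left_mono) auto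
    then have "\<phi> y \<le> ln (r / (dist_F x / 2))"
      unfolding \<phi>_def using dist_F_pos[OF y(1)] FDx r_pos by (subst ln_le_cancel_iff) auto
    then show ?thesis using \<psi>_near[OF y(1)] unfolding B_def by linarith
  qed
  obtain N where N: "\<And>y n. y \<notin> F \<Longrightarrow> \<psi> y \<le> B \<Longrightarrow> n \<ge> N \<Longrightarrow>
      measure S {\<omega>\<in>space S. random_iterate \<omega> n y \<notin> K} \<le> e / 8"
    using bound[of B] by blast
  have conv: "measure (conv_dirac (conv_power \<nu> n) y) K \<ge> 1 - e" if y: "y \<in> V" and n: "n \<ge> N" for y n
  proof -
    let ?E = "{\<omega>\<in>space S. random_iterate \<omega> n y \<notin> K}"
    have E: "?E \<in> sets S" using orbit_measurable[of n y] Kb by measurable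
    have "{\<omega>\<in>space S. random_iterate \<omega> n y \<in> K} = space S - ?E" by blast
    then have "measure (conv_dirac (conv_power \<nu> n) y) K = 1 - measure S ?E"
      using P.prob_compl[OF E] by (simp add: measure_conv_dirac[OF Kb])
    moreover have "measure S ?E \<le> e / 8" using y n VF VB by (intro N) auto
    ultimately show ?thesis using e by simp
  qed
  have "AE \<omega> in S. limsup (\<lambda>n. ereal (real (card {k \<in> {1..n}. random_iterate \<omega> k x \<in> K}) / real n)) \<ge> ereal (1 - e)"
  proof (rule AE_limsup_visits[OF Kb e])
    fix f assume f: "f \<in> space \<nu>"
    show "\<exists>N. \<forall>n\<ge>N. measure S {\<omega>\<in>space S. random_iterate \<omega> n (f x) \<notin> K} \<le> e / 8"
      using bound[of "\<psi> (f x)"] compl_invariant[OF f x] by blast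
  qed
  then show ?thesis
    using Kco KF V VF conv FDx by (intro exI[of _ K] conjI exI[of _ N] exI[of _ V]) (auto simp: V_def)
qed

end


lemma (in riemannian) common_admissible_radius:
  assumes "finite F"
  obtains r where "0 < r" "\<And>q. q \<in> F \<Longrightarrow> admissible q r"
proof -
  obtain \<rho> where \<rho>: "\<And>q. admissible q (\<rho> q)" using admissible_exists by metis
  have pos: "0 < \<rho> q" for q using \<rho>[of q] by (simp add: admissible_def)
  show ?thesis
  proof (rule that[of "Min (insert 1 (\<rho> ` F))"])
    show r: "0 < Min (insert 1 (\<rho> ` F))" using assms pos by (subst Min_gr_iff) auto
    show "admissible q (Min (insert 1 (\<rho> ` F)))" if "q \<in> F" for q
      by (rule admissible_mono[OF \<rho> r]) (use assms that in auto)
  qed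
qed

lemma orbit_invariant:
  assumes "C2_diffeo_group A \<Gamma>" "is_orbit \<Gamma> F" "f \<in> \<Gamma>"
  shows "f ` F = F"
proof -
  obtain y where F: "F = (\<lambda>f. f y) ` \<Gamma>" using assms(2) by (auto simp: is_orbit_def)
  have sub: "h ` F \<subseteq> F" if "h \<in> \<Gamma>" for h
  proof
    fix z assume "z \<in> h ` F"
    then obtain k where "k \<in> \<Gamma>" "z = (h \<circ> k) y" unfolding F by auto
    moreover then have "h \<circ> k \<in> \<Gamma>" using assms(1) \<open>h \<in> \<Gamma>\<close> by (auto simp: C2_diffeo_group_def)
    ultimately show "z \<in> F" unfolding F by blast
  qed
  have fi: "inv f \<in> \<Gamma>" "bij f" using assms(1,3) by (auto simp: C2_diffeo_group_def Ck_diffeo_def)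
  have "F \<subseteq> f ` F"
  proof
    fix z assume "z \<in> F"
    then have "inv f z \<in> F" using sub[OF fi(1)] by blast
    moreover have "f (inv f z) = z" using fi(2) by (simp add: bij_is_surj surj_f_inv_f)
    ultimately show "z \<in> f ` F" by (metis imageI)
  qed
  with sub[OF assms(3)] show ?thesis by blast
qed

theorem theorem4p3:
  fixes A :: "('m::{t2_space, second_countable_topology}, 'e::euclidean_space) chart set"
    and g :: "('m, 'e) metric"
    and \<Gamma> :: "('m \<Rightarrow> 'm) set"
    and \<nu> :: "('m \<Rightarrow> 'm) measure"
    and p :: real
    and F :: "'m set"
  assumes "riemannian_manifold A g"
    and "compact (UNIV :: 'm set)"
    and "C2_diffeo_group A \<Gamma>"
    and "prob_measure_on_group \<Gamma> \<nu>"
    and "p > 1"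
    and "integrable \<nu> (\<lambda>f. (ln (C2_norm A g f) + ln (C2_norm A g (inv f))) powr p)"
    and "is_orbit \<Gamma> F"
    and "finite F"
    and "uniformly_expanding_on A g \<nu> F"
  shows "\<forall>x \<in> - F. \<forall>\<epsilon>>0. \<exists>K. compact K \<and> K \<subseteq> - F \<and>
     (\<exists>n\<^sub>x::nat. \<exists>V. open V \<and> x \<in> V \<and> V \<subseteq> - F \<and>
        (\<forall>y\<in>V. \<forall>n\<ge>n\<^sub>x. measure (conv_dirac (conv_power \<nu> n) y) K \<ge> 1 - \<epsilon>)) \<and>
     (AE \<omega> in PiM (UNIV :: nat set) (\<lambda>_. \<nu>).
        limsup (\<lambda>n. ereal (real (card {k \<in> {1..n}. random_iterate \<omega> k x \<in> K}) / real n))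
          \<ge> ereal (1 - \<epsilon>))"
proof -
  note \<nu> = assms(4)[unfolded prob_measure_on_group_def]
  have space: "space \<nu> = \<Gamma>" and pr: "prob_space \<nu>" using \<nu> by auto
  have id: "id \<in> \<Gamma>" and diffeo: "\<And>f. f \<in> \<Gamma> \<Longrightarrow> Ck_diffeo 2 A f"
    using assms(3) by (auto simp: C2_diffeo_group_def)
  interpret prob_space \<nu> by (rule pr)
  interpret R: random_maps \<nu>
    by unfold_locales (use \<nu> id in auto)
  interpret C: compact_riemannian A g
    by unfold_locales (rule assms)+
  obtain r where r: "0 < r" "\<And>q. q \<in> F \<Longrightarrow> C.admissible q r" using C.common_admissible_radius[OF assms(8)] by metis
  have "F \<noteq> {}" using assms(7) id by (auto simp: is_orbit_def)
  then interpret I: finite_invariant_set A g F r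
    by unfold_locales (use r assms in auto)
  note image_F = orbit_invariant[OF assms(3,7)]
  obtain c n0 where c: "0 < c" "1 \<le> n0" "\<And>q v. q \<in> F \<Longrightarrow> v \<in> tangent_space A q - {zero_tvec} \<Longrightarrow>
      c \<le> (\<integral>f. ln (tnorm g (f q) (differential A f q v) / tnorm g q v) \<partial>conv_power \<nu> n0)"
    using assms(9) unfolding uniformly_expanding_on_def by blast
  obtain K where K: "\<And>f x. Ck_diffeo 2 A f \<Longrightarrow> f ` F = F \<Longrightarrow> x \<notin> F \<Longrightarrow>
    \<bar>I.\<phi> (f x) - I.\<phi> x\<bar> \<le> K + (ln (C2_norm A g f) + ln (C2_norm A g (inv f)))"
    using I.\<phi>_change_le by metis
  define h where "h f = ln (C2_norm A g f) + ln (C2_norm A g (inv f))" for f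
  have hi: "integrable \<nu> (\<lambda>f. h f powr p)" using assms(6) by (simp add: h_def)
  (* The assumption gives measurability of h powr p only. Taking the p-th root recovers a measurable
     majorant of h. *)
  define \<xi> where "\<xi> f = \<bar>K\<bar> + (h f powr p) powr (1 / p)" for f
  have hm[measurable]: "(\<lambda>f. h f powr p) \<in> borel_measurable \<nu>" using hi by (rule borel_measurable_integrable)
  have \<xi>m: "\<xi> \<in> borel_measurable \<nu>" unfolding \<xi>_def[abs_def] by measurable
  have h\<xi>: "h f \<le> (h f powr p) powr (1 / p)" for f
  proof (cases "0 \<le> h f")
    case True
    then show ?thesis using assms(5) by (simp add: powr_powr)
  next
    case False
    then show ?thesis using powr_ge_zero[of "h f powr p" "1 / p"] by linarith
  qed
  have "integrable \<nu> (\<lambda>f. \<bar>\<xi> f\<bar> powr p)"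
  proof (rule Bochner_Integration.integrable_bound)
    show "integrable \<nu> (\<lambda>f. 2 powr p * (\<bar>K\<bar> powr p + h f powr p))" using hi by simp
    show "(\<lambda>f. \<bar>\<xi> f\<bar> powr p) \<in> borel_measurable \<nu>" using \<xi>m by measurable
    show "AE f in \<nu>. norm (\<bar>\<xi> f\<bar> powr p) \<le> norm (2 powr p * (\<bar>K\<bar> powr p + h f powr p))"
    proof (rule AE_I2)
      fix f
      have "1 / p * p = 1" using assms(5) by simp
      then have "((h f powr p) powr (1 / p)) powr p = h f powr p"
        unfolding powr_powr[of "h f powr p" "1 / p" p] by (simp only: powr_one[OF powr_ge_zero])
      then show "norm (\<bar>\<xi> f\<bar> powr p) \<le> norm (2 powr p * (\<bar>K\<bar> powr p + h f powr p))"
        using powr_add_le[of "\<bar>K\<bar>" "(h f powr p) powr (1 / p)" p] assms(5) by (simp add: \<xi>_def)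
    qed
  qed
  from integrable_of_powr[OF \<xi>m this, of "min p 2"] assms(5)
  have \<xi>i: "integrable \<nu> (\<lambda>f. \<bar>\<xi> f\<bar> powr (min p 2))" by simp
  interpret E: expanding_system \<nu> A g F r \<xi> "min p 2" c n0
  proof unfold_locales
    fix f x assume "f \<in> space \<nu>" "x \<notin> F"
    then have "\<bar>I.\<phi> (f x) - I.\<phi> x\<bar> \<le> K + h f" using K diffeo image_F by (simp add: space h_def)
    also have "\<dots> \<le> \<xi> f" unfolding \<xi>_def by (intro add_mono h\<xi>) simp
    finally show "\<bar>I.\<phi> (f x) - I.\<phi> x\<bar> \<le> \<xi> f" .
  qed (use diffeo image_F space \<xi>m \<xi>i assms(5) c in auto)
  show ?thesis by (intro ballI allI impI E.recurrence) simp_all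
qed

end
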